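(* Let $m,n\ge 1$ be integers, $N=m+n$, let $H_1\in\mathbb{C}^{m\times m}$ and $H_2\in\mathbb{C}^{n\times n}$ be Hermitian, let $E\in\mathbb{C}^{n\times m}$, and set $$A=\begin{bmatrix} H_1 & E^* \\ E & H_2 \end{bmatrix},\qquad \widetilde A=\begin{bmatrix} H_1 & 0 \\ 0 & H_2 \end{bmatrix},\qquad V=A-\widetilde A=\begin{bmatrix} 0 & E^* \\ E & 0 \end{bmatrix}.$$ Let $\epsilon_2=\|E\|_2$ and $\eta=\min\{|\mu_1-\mu_2| : \mu_1\in\operatorname{eig}(H_1),\ \mu_2\in\operatorname{eig}(H_2)\}$. If $\operatorname{rank}(E)\le 1$, then for every unitarily invariant norm $\|\cdot\|_{\mathrm{ui}}$ on $\mathbb{C}^{N\times N}$, $$\big\|\operatorname{diag}\big(\lambda(A)-\lambda(\widetilde A)\big)\big\|_{\mathrm{ui}}\le \phi(\eta,\epsilon_2)\,\|V\|_{\mathrm{ui}}.$$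
   Context: $(\cdot)^*$ is the conjugate transpose, $\|\cdot\|_2$ is the spectral norm, and $\operatorname{eig}(X)$ is the multiset of eigenvalues of $X$. For a Hermitian $X\in\mathbb{C}^{N\times N}$, $\lambda(X)=[\lambda_1(X),\ldots,\lambda_N(X)]^{\mathrm T}\in\mathbb{R}^N$ is the vector of its eigenvalues counted with multiplicity and arranged in decreasing order $\lambda_1(X)\ge\cdots\ge\lambda_N(X)$. For a vector $x$, $\operatorname{diag}(x)$ is the diagonal matrix with the entries of $x$ on its diagonal, in order. For $\delta,\epsilon\ge 0$, $\phi(\delta,\epsilon)=\dfrac{2\epsilon}{\delta+\sqrt{\delta^2+4\epsilon^2}}$ if $(\delta,\epsilon)\ne(0,0)$, and $\phi(0,0)=1$. A unitarily invariant norm on $\mathbb{C}^{N\times N}$ is a norm with $\|UYW\|=\|Y\|$ for all $Y$ and all unitary $U,W$. *)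

theory Defs
  imports
    "Jordan_Normal_Form.Schur_Decomposition"
    "Jordan_Normal_Form.DL_Rank"
    "HOL-Computational_Algebra.Fundamental_Theorem_Algebra"
begin

definition hermitian_mat :: "complex mat \<Rightarrow> bool" where
  "hermitian_mat X \<longleftrightarrow> mat_adjoint X = X"

definition unitary_mat :: "nat \<Rightarrow> complex mat \<Rightarrow> bool" where
  "unitary_mat k U \<longleftrightarrow>
     U \<in> carrier_mat k k \<and> mat_adjoint U * U = 1\<^sub>m k \<and> U * mat_adjoint U = 1\<^sub>m k"

definition eig :: "complex mat \<Rightarrow> complex multiset" where
  "eig X = proots (char_poly X)"

text \<open>The entries are in decreasing order. The eigenvalues of a Hermitian matrix are real, so
  that taking real parts loses nothing in the case of interest.\<close>

definition eigvals_decreasing :: "complex mat \<Rightarrow> real vec" where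
  "eigvals_decreasing X = vec_of_list (rev (sorted_list_of_multiset (image_mset Re (eig X))))"

lemma eigvals_decreasing_carrier:
  assumes "X \<in> carrier_mat k k"
  shows "eigvals_decreasing X \<in> carrier_vec k"
proof -
  have "length (sorted_list_of_multiset (image_mset Re (eig X))) = k"
    using assms
    by (metis (no_types, lifting) eig_def size_proots_complex degree_monic_char_poly
        mset_sorted_list_of_multiset size_image_mset size_mset)
  then show ?thesis
    unfolding eigvals_decreasing_def carrier_vec_def by auto
qed

definition diag_vec :: "real vec \<Rightarrow> complex mat" where
  "diag_vec x = mat_diag (dim_vec x) (\<lambda>i. complex_of_real (x $ i))"

definition euclidean_norm :: "complex vec \<Rightarrow> real" where
  "euclidean_norm v = sqrt (\<Sum>i<dim_vec v. (cmod (v $ i))\<^sup>2)"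

text \<open>The supremum is over a nonempty bounded set whenever \<open>X\<close> has at least one column.\<close>

definition spectral_norm :: "complex mat \<Rightarrow> real" where
  "spectral_norm X =
     (SUP v \<in> {v \<in> carrier_vec (dim_col X). euclidean_norm v = 1}. euclidean_norm (X *\<^sub>v v))"

definition phi :: "real \<Rightarrow> real \<Rightarrow> real" where
  "phi \<delta> \<epsilon> = (if (\<delta>, \<epsilon>) = (0, 0) then 1 else 2 * \<epsilon> / (\<delta> + sqrt (\<delta>\<^sup>2 + 4 * \<epsilon>\<^sup>2)))"

definition eig_gap :: "complex mat \<Rightarrow> complex mat \<Rightarrow> real" where
  "eig_gap X Y = Min {cmod (\<mu>\<^sub>1 - \<mu>\<^sub>2) | \<mu>\<^sub>1 \<mu>\<^sub>2. \<mu>\<^sub>1 \<in># eig X \<and> \<mu>\<^sub>2 \<in># eig Y}"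

text \<open>Only the values of \<open>nrm\<close> on \<open>k \<times> k\<close> matrices matter.\<close>

definition matrix_norm_on :: "nat \<Rightarrow> (complex mat \<Rightarrow> real) \<Rightarrow> bool" where
  "matrix_norm_on k nrm \<longleftrightarrow>
     (\<forall>X \<in> carrier_mat k k. 0 \<le> nrm X) \<and>
     (\<forall>X \<in> carrier_mat k k. nrm X = 0 \<longleftrightarrow> X = 0\<^sub>m k k) \<and>
     (\<forall>c. \<forall>X \<in> carrier_mat k k. nrm (c \<cdot>\<^sub>m X) = cmod c * nrm X) \<and>
     (\<forall>X \<in> carrier_mat k k. \<forall>Y \<in> carrier_mat k k. nrm (X + Y) \<le> nrm X + nrm Y)"

definition unitarily_invariant_norm :: "nat \<Rightarrow> (complex mat \<Rightarrow> real) \<Rightarrow> bool" where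
  "unitarily_invariant_norm k nrm \<longleftrightarrow>
     matrix_norm_on k nrm \<and>
     (\<forall>Y \<in> carrier_mat k k. \<forall>U W. unitary_mat k U \<longrightarrow> unitary_mat k W \<longrightarrow>
        nrm (U * Y * W) = nrm Y)"

lemma perturbation_block_form:
  assumes "E \<in> carrier_mat n m" and "H1 \<in> carrier_mat m m" and "H2 \<in> carrier_mat n n"
  shows "four_block_mat H1 (mat_adjoint E) E H2 - four_block_mat H1 (0\<^sub>m m n) (0\<^sub>m n m) H2
    = four_block_mat (0\<^sub>m m m) (mat_adjoint E) E (0\<^sub>m n n)"
  using assms
  by (intro eq_matI) (auto simp: mat_adjoint_def four_block_mat_def Let_def mat_of_rows_def)

end

theory Submission
  imports Defs "HOL-Analysis.L2_Norm"
begin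

text \<open>
  Write \<open>E = u w\<^sup>*\<close>, diagonalise \<open>H\<^sub>1\<close> and \<open>H\<^sub>2\<close> with eigenvalues \<open>\<alpha>\<^sub>i\<close> and \<open>\<beta>\<^sub>j\<close>, and let
  \<open>\<epsilon> = \<parallel>E\<parallel>\<^sub>2\<close>. Then \<open>\<chi>\<^sub>A = P Q (1 - \<epsilon>\<^sup>2 F G)\<close> with \<open>P = \<Prod>(x - \<alpha>\<^sub>i)\<close>, \<open>Q = \<Prod>(x - \<beta>\<^sub>j)\<close>,
  \<open>F = \<Sum>p\<^sub>i/(x - \<alpha>\<^sub>i)\<close>, \<open>G = \<Sum>q\<^sub>j/(x - \<beta>\<^sub>j)\<close> and probability weights \<open>p\<close>, \<open>q\<close>. Hence every eigenvalue
  \<open>\<mu>\<close> of \<open>A\<close> solves \<open>f g = \<epsilon>\<^sup>2\<close>, where \<open>f = 1/F\<close> and \<open>g = 1/G\<close> are increasing with slope at least \<open>1\<close>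
  between the zeros of \<open>F\<close> and \<open>G\<close>. It has moved up from a pole \<open>\<gamma>\<close> if \<open>f, g > 0\<close> at \<open>\<mu>\<close> and
  down from one if \<open>f, g < 0\<close>. Let \<open>Y = (f + g)/2\<close>. At \<open>\<gamma>\<close> one of \<open>f\<close>, \<open>g\<close> vanishes and the other one has
  absolute value at least \<open>\<eta>\<close>, so \<open>Y \<ge> \<eta>/2\<close> at the poles that move up and \<open>Y \<le> -\<eta>/2\<close> at those that move down.

  Since \<open>\<chi>\<^sub>A\<close> and \<open>P Q\<close> agree at the zeros of \<open>F G\<close> and in their two leading coefficients, and differ by \<open>\<epsilon>\<^sup>2\<close>
  in the third, \<open>\<Sum>\<integral>\<^sub>\<gamma>\<^sup>\<mu> Y = \<epsilon>\<^sup>2\<close>. By Boole's theorem \<open>Y\<close> preserves Lebesgue measure, so if the upward moves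
  have total length \<open>s\<close>, they contribute at least \<open>\<eta>s/2 + s\<^sup>2/2\<close> to this sum. The downward moves have the same
  total length because \<open>A\<close> and its block diagonal part have equal traces, and contribute as much.
  Thus \<open>s\<^sup>2 + \<eta>s \<le> \<epsilon>\<^sup>2\<close>, that is, \<open>s \<le> \<phi>(\<eta>, \<epsilon>) \<epsilon>\<close>.

  Finally, a vector with entries summing to zero and positive part of sum \<open>s\<close> is a nonnegative combination, of
  total weight \<open>s\<close>, of vectors \<open>e\<^sub>i - e\<^sub>j\<close>, and \<open>\<epsilon> diag(e\<^sub>i - e\<^sub>j)\<close> is unitarily similar to \<open>V\<close>.
\<close>

section \<open>Pick functions\<close>
definition node_poly :: "real set \<Rightarrow> real poly" where
  "node_poly Z = (\<Prod>z\<in>Z. [:-z, 1:])"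

text \<open>This is \<open>node_poly Z\<close> times \<open>pick Z r c\<close>: with the
  denominators cleared, zeros can be counted as roots of a polynomial.\<close>

definition pick_poly :: "real set \<Rightarrow> (real \<Rightarrow> real) \<Rightarrow> real \<Rightarrow> real poly" where
  "pick_poly Z r c = [:-c, 1:] * node_poly Z - (\<Sum>z\<in>Z. smult (r z) (node_poly (Z - {z})))"

text \<open>For positive \<open>r\<close> this is the shape of the reciprocal of a sum of
  \<open>p i / (x - \<alpha> i)\<close> with positive weights of total 1 (see
  \<open>poles_to_nodes\<close>): \<open>Z\<close> holds the zeros of that sum, and
  \<open>pick\<close> vanishes at the \<open>\<alpha> i\<close>.\<close>

definition pick :: "real set \<Rightarrow> (real \<Rightarrow> real) \<Rightarrow> real \<Rightarrow> real \<Rightarrow> real" where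
  "pick Z r c x = x - c - (\<Sum>z\<in>Z. r z / (x - z))"

text \<open>Two points outside \<open>Z\<close> lie in the same component of the complement of \<open>Z\<close> iff they have the same \<open>gap\<close>.\<close>

definition gap :: "real set \<Rightarrow> real \<Rightarrow> real set" where
  "gap Z x = {z \<in> Z. z < x}"

text \<open>A primitive of \<open>pick Z r c\<close> off \<open>Z\<close>. It allows integrals of \<open>pick\<close> to be replaced by finite sums.\<close>

definition pot :: "real set \<Rightarrow> (real \<Rightarrow> real) \<Rightarrow> real \<Rightarrow> real \<Rightarrow> real" where
  "pot Z r c x = x\<^sup>2 / 2 - c * x - (\<Sum>z\<in>Z. r z * ln \<bar>x - z\<bar>)"

section \<open>Real-rooted polynomials and their leading coefficients\<close>

interpretation of_real_poly_hom: map_poly_inj_idom_hom "of_real :: real \<Rightarrow> complex" ..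

text \<open>A squarefree complex polynomial is a product of distinct linear factors; here all of
  them are real, so the factorization descends to the reals. The hypotheses have the form that sign
  arguments supply: no nonreal roots, no double real roots.\<close>

lemma real_rooted_split:
  fixes p :: "real poly"
  assumes "\<And>w::complex. Im w \<noteq> 0 \<Longrightarrow> poly (map_poly of_real p) w \<noteq> 0"
    and simple: "\<And>x. poly p x = 0 \<Longrightarrow> poly (pderiv p) x \<noteq> 0"
    and "lead_coeff p = 1"
  shows "card {x. poly p x = 0} = degree p" "(\<Prod>x | poly p x = 0. [:-x, 1:]) = p"
proof -
  let ?q = "map_poly complex_of_real p"
  have p0: "p \<noteq> 0" using assms(3) by auto
  have pd: "pderiv ?q = map_poly complex_of_real (pderiv p)"
    by (rule poly_eqI) (simp add: coeff_pderiv coeff_map_poly)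
  have roots: "{w. poly ?q w = 0} = of_real ` {x. poly p x = 0}"
  proof (intro equalityI subsetI)
    fix w assume "w \<in> {w. poly ?q w = 0}"
    moreover from this have "Im w = 0" using assms(1)[of w] by auto
    then obtain x where "w = of_real x" by (metis complex_is_Real_iff Reals_cases)
    ultimately show "w \<in> of_real ` {x. poly p x = 0}"
      by (auto simp: of_real_hom.poly_map_poly)
  qed (auto simp: of_real_hom.poly_map_poly)
  have "rsquarefree ?q"
    unfolding rsquarefree_roots
  proof (intro allI notI)
    fix a assume a: "poly ?q a = 0 \<and> poly (pderiv ?q) a = 0"
    then obtain x where "a = of_real x" "poly p x = 0" using roots by blast
    with a simple[of x] show False by (simp add: pd of_real_hom.poly_map_poly)
  qed
  from complex_poly_decompose_rsquarefree[OF this]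
  have "smult (lead_coeff ?q) (\<Prod>w\<in>of_real ` {x. poly p x = 0}. [:-w, 1:]) = ?q"
    unfolding roots .
  then have eq: "(\<Prod>x | poly p x = 0. [:-complex_of_real x, 1:]) = ?q"
    using assms(3) by (simp add: prod.reindex inj_on_def degree_map_poly coeff_map_poly)
  have "degree (\<Prod>x | poly p x = 0. [:-complex_of_real x, 1:]) = card {x. poly p x = 0}"
    by (subst degree_prod_eq_sum_degree) auto
  then show "card {x. poly p x = 0} = degree p"
    by (simp add: eq degree_map_poly)
  have "map_poly complex_of_real (\<Prod>x | poly p x = 0. [:-x, 1:]) = ?q"
    unfolding eq[symmetric] by (simp add: of_real_poly_hom.hom_prod)
  then show "(\<Prod>x | poly p x = 0. [:-x, 1:]) = p"
    by (simp add: poly_eq_iff coeff_map_poly)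
qed

text \<open>The factor \<open>X\<^sup>2\<close> shifts the indices so that the third coefficient from the top exists even for \<open>card K \<le> 1\<close>.\<close>

lemma coeff_prod_linear:
  fixes t :: "'a \<Rightarrow> real"
  assumes "finite K"
  shows "coeff (monom 1 2 * (\<Prod>k\<in>K. [:-t k, 1:])) (card K + 2) = 1"
    and "coeff (monom 1 2 * (\<Prod>k\<in>K. [:-t k, 1:])) (card K + 1) = - sum t K"
    and "2 * coeff (monom 1 2 * (\<Prod>k\<in>K. [:-t k, 1:])) (card K) = (sum t K)\<^sup>2 - (\<Sum>k\<in>K. (t k)\<^sup>2)"
    and "\<And>i. i > card K + 2 \<Longrightarrow> coeff (monom 1 2 * (\<Prod>k\<in>K. [:-t k, 1:])) i = 0"
  using assms
proof (induction K)
  case empty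
  { case 1 show ?case by simp next case 2 show ?case by simp next case 3 show ?case by simp
    next case 4 then show ?case by simp }
next
  case (insert a K)
  let ?p = "monom 1 2 * (\<Prod>k\<in>K. [:-t k, 1:])"
  have *: "monom 1 2 * (\<Prod>k\<in>insert a K. [:-t k, 1:]) = [:-t a, 1:] * ?p"
    using insert.hyps by (simp add: algebra_simps)
  have c: "coeff ([:-t a, 1:] * ?p) (Suc i) = - t a * coeff ?p (Suc i) + coeff ?p i" for i
    by simp
  have card: "card (insert a K) = Suc (card K)" using insert.hyps by simp
  { case 1 show ?case using insert.IH unfolding * card by (simp add: c del: mult_pCons_left)
    next case 2 show ?case using insert.IH unfolding * card by (simp add: c insert.hyps del: mult_pCons_left)
    next case 3 show ?case using insert.IH unfolding * card
       by (simp add: c insert.hyps del: mult_pCons_left) (simp add: power2_eq_square algebra_simps)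
    next case 4 then obtain j where "i = Suc j" by (cases i) auto
      with 4 show ?case using insert.IH unfolding * card by (simp add: c insert.hyps del: mult_pCons_left) }
qed

lemma degree_prod_linear: "finite K \<Longrightarrow> degree (\<Prod>k\<in>K. [:-(t k :: real), 1:]) = card K"
  by (subst degree_prod_eq_sum_degree) auto

lemma lead_coeff_prod_linear: "lead_coeff (\<Prod>k\<in>K. [:-(t k :: real), 1:]) = 1"
  by (subst lead_coeff_prod) auto

lemma poly_node_poly: "poly (node_poly Z) x = (\<Prod>z\<in>Z. x - z)"
  by (simp add: node_poly_def poly_prod)

lemma node_poly_remove: "finite Z \<Longrightarrow> z \<in> Z \<Longrightarrow> node_poly Z = [:-z, 1:] * node_poly (Z - {z})"
  unfolding node_poly_def by (rule prod.remove)

lemma poly_pick_poly: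
  assumes "finite Z" "x \<notin> Z"
  shows "poly (pick_poly Z r c) x = poly (node_poly Z) x * pick Z r c x"
proof -
  have "r z * poly (node_poly (Z - {z})) x = poly (node_poly Z) x * (r z / (x - z))" if "z \<in> Z" for z
  proof -
    have "x - z \<noteq> 0" using assms that by auto
    then show ?thesis by (subst node_poly_remove[OF assms(1) that]) (simp add: field_simps)
  qed
  then show ?thesis
    by (simp add: pick_poly_def pick_def poly_sum sum_distrib_left algebra_simps)
qed

text \<open>At a node only the summand that omits its own factor survives. The value is independent
  of \<open>c\<close>, which makes the logarithms cancel in
  \<open>sum_pot_pick_zeros\<close>.\<close>

lemma poly_pick_poly_node:
  assumes "finite Z" "z \<in> Z"
  shows "poly (pick_poly Z r c) z = - r z * poly (node_poly (Z - {z})) z"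
proof -
  have "(\<Sum>w\<in>Z. r w * poly (node_poly (Z - {w})) z) = (\<Sum>w\<in>{z}. r w * poly (node_poly (Z - {w})) z)"
    using assms by (intro sum.mono_neutral_right) (auto simp: poly_node_poly)
  moreover have "poly (node_poly Z) z = 0" using assms by (auto simp: poly_node_poly)
  ultimately show ?thesis by (simp add: pick_poly_def poly_sum)
qed

lemma node_poly_nonzero: "finite Z \<Longrightarrow> x \<notin> Z \<Longrightarrow> poly (node_poly Z) x \<noteq> 0"
  by (auto simp: poly_node_poly)

lemma poly_pick_poly_node_nonzero:
  assumes "finite Z" "z \<in> Z" "r z \<noteq> 0"
  shows "poly (pick_poly Z r c) z \<noteq> 0"
  using assms by (simp add: poly_pick_poly_node node_poly_nonzero)

text \<open>The sum over the nodes lies two degrees below the leading term, so the weights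
  \<open>r\<close> enter only the third coefficient. The factor \<open>X^2\<close> shifts the
  indices as in \<open>coeff_prod_linear\<close>.\<close>

lemma coeff_pick_poly:
  assumes "finite Z"
  shows "coeff (monom 1 2 * pick_poly Z r c) (card Z + 3) = 1"
    and "coeff (monom 1 2 * pick_poly Z r c) (card Z + 2) = - \<Sum>Z - c"
    and "2 * coeff (monom 1 2 * pick_poly Z r c) (card Z + 1)
          = (\<Sum>Z)\<^sup>2 - (\<Sum>z\<in>Z. z\<^sup>2) + 2 * c * \<Sum>Z - 2 * sum r Z"
    and "\<And>i. i > card Z + 3 \<Longrightarrow> coeff (monom 1 2 * pick_poly Z r c) i = 0"
proof -
  let ?n = "monom 1 2 * node_poly Z" and ?s = "\<lambda>z. monom 1 2 * node_poly (Z - {z})"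
  have e: "monom 1 2 * pick_poly Z r c = [:-c, 1:] * ?n - (\<Sum>z\<in>Z. smult (r z) (?s z))"
    by (simp add: pick_poly_def algebra_simps sum_distrib_left)
  have n: "coeff (monom 1 2 * pick_poly Z r c) (Suc i)
     = - c * coeff ?n (Suc i) + coeff ?n i - (\<Sum>z\<in>Z. r z * coeff (?s z) (Suc i))" for i
    unfolding e by (simp add: coeff_sum)
  note N = coeff_prod_linear[where t = "\<lambda>z. z", OF assms, folded node_poly_def]
  have S: "coeff (?s z) (Suc (card Z)) = 1" "i > Suc (card Z) \<Longrightarrow> coeff (?s z) i = 0"
    if "z \<in> Z" for z i
    using coeff_prod_linear(1,4)[of "Z - {z}", where t = "\<lambda>z. z", folded node_poly_def] assms that
    by (auto simp: card_gt_0_iff Suc_diff_Suc[symmetric] card_Diff_singleton dest: card_Suc_Diff1)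
  show "coeff (monom 1 2 * pick_poly Z r c) (card Z + 3) = 1"
    using n[of "card Z + 2"] N S by (simp add: numeral_3_eq_3)
  show "coeff (monom 1 2 * pick_poly Z r c) (card Z + 2) = - \<Sum>Z - c"
    using n[of "card Z + 1"] N S by simp
  show "2 * coeff (monom 1 2 * pick_poly Z r c) (card Z + 1)
          = (\<Sum>Z)\<^sup>2 - (\<Sum>z\<in>Z. z\<^sup>2) + 2 * c * \<Sum>Z - 2 * sum r Z"
    using n[of "card Z"] N S by (simp add: algebra_simps)
  fix i assume i: "i > card Z + 3"
  then obtain j where "i = Suc j" by (cases i) auto
  with i show "coeff (monom 1 2 * pick_poly Z r c) i = 0"
    using n[of j] N S by simp
qed

lemma degree_pick_poly:
  assumes "finite Z"
  shows "degree (pick_poly Z r c) = card Z + 1" "lead_coeff (pick_poly Z r c) = 1"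
proof -
  have c: "coeff (monom 1 2 * p) (i + 2) = coeff p i" for p :: "real poly" and i
    by (simp add: coeff_monom_mult)
  have 1: "coeff (pick_poly Z r c) (card Z + 1) = 1"
    using coeff_pick_poly(1)[OF assms, of r c] c[of "pick_poly Z r c" "card Z + 1"]
    by (simp add: numeral_3_eq_3)
  have "coeff (pick_poly Z r c) i = 0" if "i > card Z + 1" for i
    using coeff_pick_poly(4)[OF assms, of "i + 2" r c] c[of "pick_poly Z r c" i] that by simp
  then have "degree (pick_poly Z r c) \<le> card Z + 1" by (intro degree_le) auto
  then show "degree (pick_poly Z r c) = card Z + 1" using 1 le_degree[of "pick_poly Z r c" "card Z + 1"]
    by simp
  then show "lead_coeff (pick_poly Z r c) = 1" using 1 by simp
qed

section \<open>Monotonicity of Pick functions on gaps\<close>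

lemma gap_eqD: "gap Z x = gap Z y \<Longrightarrow> z \<in> Z \<Longrightarrow> z < x \<longleftrightarrow> z < y"
  by (auto simp: gap_def)

lemma gap_eqI: "(\<And>z. z \<in> Z \<Longrightarrow> z < x \<longleftrightarrow> z < y) \<Longrightarrow> gap Z x = gap Z y"
  by (auto simp: gap_def)

lemma gap_mono: "x \<le> y \<Longrightarrow> gap Z x \<subseteq> gap Z y"
  by (auto simp: gap_def)

lemma gap_between:
  assumes "gap Z x = gap Z y" "x \<le> u" "u \<le> y"
  shows "gap Z u = gap Z x"
  using gap_mono[OF assms(2), of Z] gap_mono[OF assms(3), of Z] assms(1) by auto

lemma same_gap_sign:
  assumes "gap Z x = gap Z y" "x \<notin> Z" "y \<notin> Z" "z \<in> Z"
  shows "(x - z) * (y - z) > 0"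
  using gap_eqD[OF assms(1,4)] assms(2-4) by (cases "z < x") (auto intro: mult_neg_neg simp: not_less order.order_iff_strict)

text \<open>Each \<open>- r z / (x - z)\<close> is nondecreasing as long as \<open>x\<close> does
  not cross \<open>z\<close>; the linear term contributes slope 1.\<close>

lemma pick_diff:
  assumes "finite Z" "\<forall>z\<in>Z. r z \<ge> 0"
    and "gap Z x = gap Z y" "x \<notin> Z" "y \<notin> Z" "x \<le> y"
  shows "pick Z r c y - pick Z r c x \<ge> y - x"
proof -
  have "r z / (y - z) \<le> r z / (x - z)" if z: "z \<in> Z" for z
  proof -
    have *: "(x - z) * (y - z) > 0" by (rule same_gap_sign[OF assms(3-5) z])
    then have "x - z \<noteq> 0" "y - z \<noteq> 0" by auto
    then have "r z / (x - z) - r z / (y - z) = r z * (y - x) / ((x - z) * (y - z))"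
      by (simp add: diff_frac_eq right_diff_distrib algebra_simps)
    also have "\<dots> \<ge> 0" using * assms(2) z assms(6) by (intro divide_nonneg_pos mult_nonneg_nonneg) auto
    finally show ?thesis by simp
  qed
  then have "(\<Sum>z\<in>Z. r z / (y - z)) \<le> (\<Sum>z\<in>Z. r z / (x - z))" by (rule sum_mono)
  then show ?thesis by (simp add: pick_def)
qed

lemma pick_less_iff:
  assumes "finite Z" "\<forall>z\<in>Z. r z \<ge> 0"
    and "gap Z x = gap Z y" "x \<notin> Z" "y \<notin> Z"
  shows "pick Z r c x < pick Z r c y \<longleftrightarrow> x < y"
  using pick_diff[where c = c and r = r, OF assms] pick_diff[where c = c and r = r, OF assms(1,2) assms(3)[symmetric] assms(5,4)]
  by (cases "x < y"; cases "x = y") auto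

text \<open>Turns level sets into zero sets: the solutions of \<open>pick Z r c x = y\<close> are
  the zeros for the parameter \<open>c + y\<close>.\<close>

lemma pick_shift: "pick Z r (c + y) x = pick Z r c x - y"
  by (simp add: pick_def)

lemma pick_has_derivative:
  assumes "finite Z" "x \<notin> Z"
  shows "(pick Z r c has_real_derivative 1 + (\<Sum>z\<in>Z. r z / (x - z)\<^sup>2)) (at x)"
proof -
  have nz: "x - z \<noteq> 0" if "z \<in> Z" for z using assms that by auto
  show ?thesis
    unfolding pick_def
    by (rule derivative_eq_intros refl nz | assumption)+
      (simp add: power2_eq_square sum_negf)
qed

lemma poly_map_poly_node_poly:
  "poly (map_poly complex_of_real (node_poly Z)) w = (\<Prod>z\<in>Z. w - of_real z)"
  unfolding node_poly_def by (simp add: of_real_poly_hom.hom_prod poly_prod)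

lemma poly_map_poly_pick_poly:
  assumes "finite Z" "Im w \<noteq> 0"
  shows "poly (map_poly complex_of_real (pick_poly Z r c)) w
    = (\<Prod>z\<in>Z. w - of_real z) * (w - of_real c - (\<Sum>z\<in>Z. of_real (r z) / (w - of_real z)))"
proof -
  have h: "map_poly complex_of_real (pick_poly Z r c)
    = [:- of_real c, 1:] * map_poly of_real (node_poly Z)
      - (\<Sum>z\<in>Z. smult (of_real (r z)) (map_poly of_real (node_poly (Z - {z}))))"
    by (simp add: pick_poly_def of_real_poly_hom.hom_minus of_real_poly_hom.hom_mult of_real_poly_hom.hom_sum of_real_hom.map_poly_hom_smult
      of_real_hom.map_poly_pCons_hom del: mult_pCons_left)
  have "of_real (r z) * (\<Prod>z\<in>Z - {z}. w - of_real z) = (\<Prod>z\<in>Z. w - of_real z) * (of_real (r z) / (w - of_real z))"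
    if "z \<in> Z" for z
  proof -
    have "w - of_real z \<noteq> 0" using assms(2) by auto
    then show ?thesis by (subst prod.remove[OF assms(1) that]) (simp add: field_simps)
  qed
  then show ?thesis unfolding h
    by (simp add: poly_map_poly_node_poly poly_sum sum_distrib_left algebra_simps)
qed

text \<open>The Pick property: the upper and the lower half-plane are each mapped into themselves,
  because \<open>r z / (w - z)\<close> has imaginary part \<open>- r z * Im w / |w - z|^2\<close>.
  This excludes nonreal zeros.\<close>

lemma pick_complex_Im:
  assumes "\<forall>z\<in>Z. r z \<ge> 0" "Im w \<noteq> 0"
  shows "Im (w - of_real c - (\<Sum>z\<in>Z. of_real (r z) / (w - of_real z))) * Im w > 0"
proof -
  have "Im (of_real (r z) / (w - of_real z)) * Im w \<le> 0" if "z \<in> Z" for z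
  proof -
    have "Im (of_real (r z) / (w - of_real z)) = - r z * Im w / (cmod (w - of_real z))\<^sup>2"
      by (simp add: Im_divide cmod_power2)
    then show ?thesis using assms(1) that
      by (simp add: mult.assoc[of "r z"])
  qed
  then have "(\<Sum>z\<in>Z. Im (of_real (r z) / (w - of_real z)) * Im w) \<le> 0" by (rule sum_nonpos)
  then have "Im (\<Sum>z\<in>Z. of_real (r z) / (w - of_real z)) * Im w \<le> 0"
    by (simp add: sum_distrib_right)
  moreover have "Im w * Im w > 0" using assms(2) by (auto simp: zero_less_mult_iff)
  ultimately show ?thesis by (simp add: algebra_simps)
qed

section \<open>Zeros of Pick functions, one in each gap\<close>

definition pick_zeros :: "real set \<Rightarrow> (real \<Rightarrow> real) \<Rightarrow> real \<Rightarrow> real set" where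
  "pick_zeros Z r c = {x. poly (pick_poly Z r c) x = 0}"

lemma pick_zeros_iff:
  assumes "finite Z" "\<forall>z\<in>Z. r z > 0"
  shows "x \<in> pick_zeros Z r c \<longleftrightarrow> x \<notin> Z \<and> pick Z r c x = 0"
proof (cases "x \<in> Z")
  case True
  then show ?thesis using poly_pick_poly_node_nonzero[OF assms(1) True, of r c] assms(2) True
    by (auto simp: pick_zeros_def)
next
  case False
  then show ?thesis using poly_pick_poly[OF assms(1) False, of r c] node_poly_nonzero[OF assms(1) False]
    by (auto simp: pick_zeros_def)
qed

text \<open>Nonreal zeros contradict \<open>pick_complex_Im\<close>. At a real zero the derivative
  of \<open>pick_poly\<close> is \<open>node_poly\<close> times the slope of \<open>pick\<close>,
  which is at least 1, so the zero is simple.\<close>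

lemma pick_zeros:
  assumes Z: "finite Z" and r: "\<forall>z\<in>Z. r z > 0"
  shows finite_pick_zeros: "finite (pick_zeros Z r c)"
    and card_pick_zeros: "card (pick_zeros Z r c) = card Z + 1"
    and prod_pick_zeros: "(\<Prod>x\<in>pick_zeros Z r c. [:-x, 1:]) = pick_poly Z r c"
proof -
  have r0: "\<forall>z\<in>Z. r z \<ge> 0" using r by (simp add: less_imp_le)
  have nr: "poly (map_poly of_real (pick_poly Z r c)) w \<noteq> 0" if "Im w \<noteq> 0" for w :: complex
  proof -
    have "w - of_real c - (\<Sum>z\<in>Z. of_real (r z) / (w - of_real z)) \<noteq> 0"
      using pick_complex_Im[of Z r w c, OF r0 that] by (metis less_irrefl mult_zero_left zero_complex.sel(2))
    moreover have "(\<Prod>z\<in>Z. w - of_real z) \<noteq> 0" using that Z by auto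
    ultimately show ?thesis unfolding poly_map_poly_pick_poly[OF Z that] by simp
  qed
  have simple: "poly (pderiv (pick_poly Z r c)) x \<noteq> 0" if "poly (pick_poly Z r c) x = 0" for x
  proof -
    have x: "x \<notin> Z" "pick Z r c x = 0" using pick_zeros_iff[OF Z r, of x c] that by (auto simp: pick_zeros_def)
    have "((\<lambda>x. poly (node_poly Z) x * pick Z r c x) has_real_derivative
        poly (pderiv (node_poly Z)) x * pick Z r c x + (1 + (\<Sum>z\<in>Z. r z / (x - z)\<^sup>2)) * poly (node_poly Z) x) (at x)"
      by (rule DERIV_mult[OF poly_DERIV pick_has_derivative[OF Z x(1)]])
    moreover have "open (- Z)" using Z by (simp add: finite_imp_closed open_Compl)
    ultimately have "(poly (pick_poly Z r c) has_real_derivative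
        poly (pderiv (node_poly Z)) x * pick Z r c x + (1 + (\<Sum>z\<in>Z. r z / (x - z)\<^sup>2)) * poly (node_poly Z) x) (at x)"
      by (rule has_field_derivative_transform_within_open) (use x poly_pick_poly[OF Z] in auto)
    then have "poly (pderiv (pick_poly Z r c)) x = (1 + (\<Sum>z\<in>Z. r z / (x - z)\<^sup>2)) * poly (node_poly Z) x"
      using x(2) DERIV_unique[OF poly_DERIV] by fastforce
    moreover have "(\<Sum>z\<in>Z. r z / (x - z)\<^sup>2) \<ge> 0" using r0 by (intro sum_nonneg divide_nonneg_nonneg) auto
    ultimately show ?thesis using node_poly_nonzero[OF Z x(1)] by auto
  qed
  note * = real_rooted_split[OF nr simple degree_pick_poly(2)[OF Z], simplified, folded pick_zeros_def]
  show c: "card (pick_zeros Z r c) = card Z + 1" using * degree_pick_poly(1)[OF Z] by simp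
  \<comment> \<open>An infinite set has \<open>card\<close> 0, so the count itself yields
    finiteness.\<close>
  then show "finite (pick_zeros Z r c)" by (metis card.infinite Suc_eq_plus1 nat.distinct(1))
  show "(\<Prod>x\<in>pick_zeros Z r c. [:-x, 1:]) = pick_poly Z r c" using * by simp
qed

text \<open>Existence by counting instead of an intermediate value argument: strict monotonicity
  allows at most one zero per gap, and there are \<open>card Z + 1\<close> zeros for at most as many
  gaps.\<close>

lemma ex1_pick_zero_in_gap:
  assumes Z: "finite Z" and r: "\<forall>z\<in>Z. r z > 0"
  shows "\<exists>!u. u \<in> pick_zeros Z r c \<and> gap Z u = gap Z x"
proof -
  let ?X = "pick_zeros Z r c"
  have r0: "\<forall>z\<in>Z. r z \<ge> 0" using r by (simp add: less_imp_le)
  have fg: "finite (gap Z y)" for y using Z by (simp add: gap_def)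
  \<comment> \<open>The sets \<open>gap Z u\<close> are nested, so their cardinality determines
    them.\<close>
  have eq: "card (gap Z u) = card (gap Z v) \<Longrightarrow> gap Z u = gap Z v" for u v
    by (cases u v rule: linorder_le_cases) (metis card_subset_eq fg gap_mono)+
  have inj0: "u = v" if "u \<in> ?X" "v \<in> ?X" "gap Z u = gap Z v" for u v
    using that pick_less_iff[where c = c and r = r, OF Z r0 that(3)] pick_less_iff[where c = c and r = r, OF Z r0 that(3)[symmetric]]
    by (auto simp: pick_zeros_iff[OF Z r])
  have inj: "inj_on (\<lambda>u. card (gap Z u)) ?X"
    using inj0 eq by (auto intro!: inj_onI)
  have "(\<lambda>u. card (gap Z u)) ` ?X \<subseteq> {..card Z}"
    using Z by (auto simp: gap_def intro: card_mono)
  then have "(\<lambda>u. card (gap Z u)) ` ?X = {..card Z}"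
    by (intro card_subset_eq) (use card_image[OF inj] card_pick_zeros[OF Z r] in auto)
  moreover have "card (gap Z x) \<le> card Z" using Z by (auto simp: gap_def intro: card_mono)
  ultimately obtain u where "u \<in> ?X" "card (gap Z u) = card (gap Z x)" by (metis atMost_iff imageE)
  then show ?thesis using eq inj0 by metis
qed

text \<open>The tangent inequality for \<open>pot\<close>, which is convex on each gap with
  derivative \<open>pick\<close>. It follows from \<open>ln t \<le> t - 1\<close> at
  \<open>t = (y - z) / (x - z)\<close>, which is positive since \<open>x\<close> and
  \<open>y\<close> lie on the same side of \<open>z\<close>.\<close>

lemma pot_tangent:
  assumes Z: "finite Z" and r: "\<forall>z\<in>Z. r z \<ge> 0"
    and "gap Z x = gap Z y" "x \<notin> Z" "y \<notin> Z"
  shows "pot Z r c y - pot Z r c x \<ge> pick Z r c x * (y - x)"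
proof -
  have "r z * ln \<bar>y - z\<bar> - r z * ln \<bar>x - z\<bar> \<le> r z / (x - z) * (y - x)" if z: "z \<in> Z" for z
  proof -
    have s: "(x - z) * (y - z) > 0" by (rule same_gap_sign[OF assms(3-5) z])
    then have nz: "x - z \<noteq> 0" "y - z \<noteq> 0" by auto
    have q: "\<bar>y - z\<bar> / \<bar>x - z\<bar> = (y - z) / (x - z)"
    proof -
      have "(y - z) / (x - z) > 0" using s by (auto simp: zero_less_divide_iff zero_less_mult_iff)
      then show ?thesis unfolding abs_divide[symmetric] by (rule abs_of_pos)
    qed
    have "ln \<bar>y - z\<bar> - ln \<bar>x - z\<bar> = ln (\<bar>y - z\<bar> / \<bar>x - z\<bar>)" using nz by (simp add: ln_div)
    also have "\<dots> \<le> \<bar>y - z\<bar> / \<bar>x - z\<bar> - 1" using nz by (intro ln_le_minus_one) auto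
    also have "\<dots> = (y - x) / (x - z)" unfolding q using nz by (simp add: field_simps)
    finally have "r z * (ln \<bar>y - z\<bar> - ln \<bar>x - z\<bar>) \<le> r z * ((y - x) / (x - z))"
      by (rule mult_left_mono) (use r z in auto)
    then show ?thesis by (simp add: algebra_simps)
  qed
  then have "(\<Sum>z\<in>Z. r z * ln \<bar>y - z\<bar> - r z * ln \<bar>x - z\<bar>) \<le> (\<Sum>z\<in>Z. r z / (x - z) * (y - x))"
    by (rule sum_mono)
  then have "(\<Sum>z\<in>Z. r z * ln \<bar>y - z\<bar>) - (\<Sum>z\<in>Z. r z * ln \<bar>x - z\<bar>) \<le> (\<Sum>z\<in>Z. r z / (x - z)) * (y - x)"
    by (simp add: sum_subtractf sum_distrib_right)
  moreover have "y\<^sup>2 / 2 - x\<^sup>2 / 2 = x * (y - x) + (y - x)\<^sup>2 / 2"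
    by (simp add: power2_eq_square field_simps)
  moreover have "(y - x)\<^sup>2 / 2 \<ge> 0" by simp
  ultimately show ?thesis unfolding pot_def pick_def left_diff_distrib right_diff_distrib by linarith
qed

section \<open>Potentials summed over the roots of a polynomial\<close>

lemma sum_power2_roots:
  fixes t :: "'a \<Rightarrow> real"
  assumes "finite K" "card K = N" "(\<Prod>k\<in>K. [:-t k, 1:]) = p"
  shows "sum t K = - coeff (monom 1 2 * p) (N + 1)"
    and "(\<Sum>k\<in>K. (t k)\<^sup>2) = (coeff (monom 1 2 * p) (N + 1))\<^sup>2 - 2 * coeff (monom 1 2 * p) N"
  using coeff_prod_linear[where t = t, OF assms(1)] assms(2,3) by auto

lemma sum_ln_roots:
  fixes t :: "'a \<Rightarrow> real"
  assumes "finite K" "(\<Prod>k\<in>K. [:-t k, 1:]) = p" "poly p z \<noteq> 0"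
  shows "(\<Sum>k\<in>K. ln \<bar>t k - z\<bar>) = ln \<bar>poly p z\<bar>"
proof -
  have e: "poly p z = (\<Prod>k\<in>K. z - t k)" using assms(2) by (auto simp: poly_prod)
  then have nz: "z - t k \<noteq> 0" if "k \<in> K" for k using assms(1,3) that by auto
  have "ln \<bar>poly p z\<bar> = ln (\<Prod>k\<in>K. \<bar>t k - z\<bar>)" unfolding e by (simp add: abs_prod abs_minus_commute)
  also have "\<dots> = (\<Sum>k\<in>K. ln \<bar>t k - z\<bar>)" by (rule ln_prod) (use assms(1) nz in force)+
  finally show ?thesis by simp
qed

text \<open>The quadratic part of \<open>pot\<close> sums to power sums of the roots, hence to
  coefficients of \<open>p\<close>; the logarithms sum to \<open>ln |p z|\<close>. For two
  polynomials with equal values on \<open>Z\<close> only coefficients remain in the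
  difference.\<close>

lemma sum_pot_roots:
  fixes t :: "'a \<Rightarrow> real"
  assumes "finite K" "card K = N" "(\<Prod>k\<in>K. [:-t k, 1:]) = p" "\<forall>z\<in>Z. poly p z \<noteq> 0"
  shows "(\<Sum>k\<in>K. pot Z r c (t k)) = ((coeff (monom 1 2 * p) (N + 1))\<^sup>2 - 2 * coeff (monom 1 2 * p) N) / 2
    + c * coeff (monom 1 2 * p) (N + 1) - (\<Sum>z\<in>Z. r z * ln \<bar>poly p z\<bar>)"
proof -
  have "(\<Sum>k\<in>K. pot Z r c (t k)) = (\<Sum>k\<in>K. (t k)\<^sup>2) / 2 - c * sum t K - (\<Sum>k\<in>K. \<Sum>z\<in>Z. r z * ln \<bar>t k - z\<bar>)"
    by (simp add: pot_def sum_subtractf sum_divide_distrib sum_distrib_left)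
  also have "(\<Sum>k\<in>K. \<Sum>z\<in>Z. r z * ln \<bar>t k - z\<bar>) = (\<Sum>z\<in>Z. r z * (\<Sum>k\<in>K. ln \<bar>t k - z\<bar>))"
    by (subst sum.swap) (simp add: sum_distrib_left)
  also have "\<dots> = (\<Sum>z\<in>Z. r z * ln \<bar>poly p z\<bar>)"
    using sum_ln_roots[OF assms(1,3)] assms(4) by simp
  finally show ?thesis unfolding sum_power2_roots[OF assms(1-3)] by simp
qed

lemma sum_pick_zeros:
  assumes Z: "finite Z" and r: "\<forall>z\<in>Z. r z > 0"
  shows "\<Sum>(pick_zeros Z r c) = \<Sum>Z + c"
  using sum_power2_roots(1)[OF finite_pick_zeros[OF Z r] card_pick_zeros[OF Z r] prod_pick_zeros[OF Z r]]
    coeff_pick_poly[where r = r and c = c, OF Z] by (simp add: add.assoc)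

text \<open>Boole's theorem in integrated form: between the levels \<open>y'\<close> and
  \<open>y\<close> the integrals of \<open>pick\<close> over all gaps total the integral of the
  identity. The polynomials of the two levels agree at the nodes, so the logarithms cancel.\<close>

lemma sum_pot_pick_zeros:
  assumes Z: "finite Z" and r: "\<forall>z\<in>Z. r z > 0"
  shows "(\<Sum>x\<in>pick_zeros Z r (c + y). pot Z r c x) - (\<Sum>x\<in>pick_zeros Z r (c + y'). pot Z r c x)
    = y\<^sup>2 / 2 - y'\<^sup>2 / 2"
proof -
  have *: "(\<Sum>x\<in>pick_zeros Z r (c + y). pot Z r c x) = 
     ((\<Sum>Z + c + y)\<^sup>2 - (\<Sum>Z)\<^sup>2 + (\<Sum>z\<in>Z. z\<^sup>2) - 2 * (c + y) * \<Sum>Z + 2 * sum r Z) / 2 - c * (\<Sum>Z + c + y)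
       - (\<Sum>z\<in>Z. r z * ln \<bar>r z * poly (node_poly (Z - {z})) z\<bar>)" for y
  proof -
    have nz: "\<forall>z\<in>Z. poly (pick_poly Z r (c + y)) z \<noteq> 0"
      using poly_pick_poly_node_nonzero[OF Z] r by force
    have 1: "coeff (monom 1 2 * pick_poly Z r (c + y)) (card Z + 1 + 1) = - (\<Sum>Z + c + y)"
      using coeff_pick_poly(2)[where r = r and c = "c + y", OF Z] by simp
    have 2: "2 * coeff (monom 1 2 * pick_poly Z r (c + y)) (card Z + 1)
        = (\<Sum>Z)\<^sup>2 - (\<Sum>z\<in>Z. z\<^sup>2) + 2 * (c + y) * \<Sum>Z - 2 * sum r Z"
      by (rule coeff_pick_poly(3)[OF Z])
    have 3: "(\<Sum>z\<in>Z. r z * ln \<bar>poly (pick_poly Z r (c + y)) z\<bar>)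
        = (\<Sum>z\<in>Z. r z * ln \<bar>r z * poly (node_poly (Z - {z})) z\<bar>)"
      by (intro sum.cong) (simp_all add: poly_pick_poly_node[OF Z])
    show ?thesis
      using sum_pot_roots[where t = "\<lambda>x. x" and Z = Z and r = r and c = c,
          OF finite_pick_zeros[OF Z r] card_pick_zeros[OF Z r] prod_pick_zeros[OF Z r] nz]
      unfolding 1 2 3 by (simp add: power2_eq_square algebra_simps)
  qed
  have "((u + y)\<^sup>2 - v + w - 2 * (c + y) * q + p) / 2 - c * (u + y) - t
      - (((u + y')\<^sup>2 - v + w - 2 * (c + y') * q + p) / 2 - c * (u + y') - t) = y\<^sup>2 / 2 - y'\<^sup>2 / 2"
    if "u = q + c" for u v w p q t :: real
    by (simp add: that power2_eq_square field_simps)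
  then show ?thesis unfolding * by blast
qed


section \<open>Boole's theorem as a packing bound\<close>

text \<open>With \<open>y = h + s\<close>, let \<open>u\<close> and \<open>w u\<close> be the solutions of \<open>pick = y\<close> and \<open>pick = h\<close> in a gap. The lengths
  \<open>u - w u\<close> sum to \<open>y - h = s\<close> over all gaps, and by convexity of \<open>pot\<close> no interval \<open>[\<gamma> i, \<mu> i]\<close> does better
  than \<open>[w u, u]\<close> once lengths are charged at price \<open>y\<close>.\<close>

theorem packing:
  fixes \<gamma> \<mu> :: "'i \<Rightarrow> real"
  assumes Z: "finite Z" and r: "\<forall>z\<in>Z. r z > 0" and R: "finite R"
    and le: "\<And>i. i \<in> R \<Longrightarrow> \<gamma> i \<le> \<mu> i"
    and nodes: "\<And>i. i \<in> R \<Longrightarrow> \<gamma> i \<notin> Z" "\<And>i. i \<in> R \<Longrightarrow> \<mu> i \<notin> Z"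
    and gap: "\<And>i. i \<in> R \<Longrightarrow> gap Z (\<gamma> i) = gap Z (\<mu> i)"
    and inj: "inj_on (\<lambda>i. gap Z (\<gamma> i)) R"
    and h: "\<And>i. i \<in> R \<Longrightarrow> pick Z r c (\<gamma> i) \<ge> h"
  defines "s \<equiv> \<Sum>i\<in>R. \<mu> i - \<gamma> i"
  shows "(\<Sum>i\<in>R. pot Z r c (\<mu> i) - pot Z r c (\<gamma> i)) \<ge> h * s + s\<^sup>2 / 2"
proof -
  let ?p = "pick Z r c" and ?L = "pot Z r c"
  have r0: "\<forall>z\<in>Z. r z \<ge> 0" using r by (simp add: less_imp_le)
  define y where "y = h + s"
  have s0: "s \<ge> 0" unfolding s_def using le by (intro sum_nonneg) simp
  define X where "X = pick_zeros Z r (c + y)"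
  define W where "W = pick_zeros Z r (c + h)"
  define w where "w x = (THE u. u \<in> W \<and> gap Z u = gap Z x)" for x
  have w: "w x \<in> W" "gap Z (w x) = gap Z x" for x
    using theI'[OF ex1_pick_zero_in_gap[OF Z r, of "c + h" x]] by (auto simp: w_def W_def)
  have Xp: "x \<notin> Z" "?p x = y" if "x \<in> X" for x
    using that by (auto simp: X_def pick_zeros_iff[OF Z r] pick_shift)
  have Wp: "x \<notin> Z" "?p x = h" if "x \<in> W" for x
    using that by (auto simp: W_def pick_zeros_iff[OF Z r] pick_shift)
  have bij: "bij_betw w X W"
  proof (rule bij_betwI')
    fix x x' assume "x \<in> X" "x' \<in> X"
    then show "(w x = w x') = (x = x')"
      using ex1_pick_zero_in_gap[OF Z r, of "c + y" x] w(2) unfolding X_def by metis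
  next
    fix u assume u: "u \<in> W"
    obtain x where "x \<in> X" "gap Z x = gap Z u" using ex1_pick_zero_in_gap[OF Z r] unfolding X_def by metis
    moreover from this u have "w x = u"
      using ex1_pick_zero_in_gap[OF Z r, of "c + h" u] w unfolding W_def by metis
    ultimately show "\<exists>x\<in>X. u = w x" by blast
  qed (use w in auto)
  define x where "x i = (THE u. u \<in> X \<and> gap Z u = gap Z (\<gamma> i))" for i
  have x: "x i \<in> X" "gap Z (x i) = gap Z (\<gamma> i)" for i
    using theI'[OF ex1_pick_zero_in_gap[OF Z r, of "c + y" "\<gamma> i"]] by (auto simp: x_def X_def)
  have injx: "inj_on x R" using inj x(2) by (auto simp: inj_on_def) metis
  \<comment> \<open>\<open>D u\<close> is the integral of \<open>pick - y\<close> over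
    \<open>[w u, u]\<close>, the net value of this interval at price \<open>y\<close>.\<close>
  define D where "D u = ?L u - ?L (w u) - y * (u - w u)" for u
  have D0: "D u \<le> 0" if u: "u \<in> X" for u
    using pot_tangent[OF Z r0 w(2)[symmetric] Xp(1)[OF u] Wp(1)[OF w(1)], of c] Xp(2)[OF u]
    by (simp add: D_def algebra_simps)
  have DR: "?L (\<mu> i) - ?L (\<gamma> i) - y * (\<mu> i - \<gamma> i) \<ge> D (x i)" if i: "i \<in> R" for i
  proof (cases "\<gamma> i \<le> x i")
    \<comment> \<open>The interval is compared with \<open>[w (x i), x i]\<close>. Lowering its left
      end adds a stretch with \<open>pick \<le> y\<close>; moving its right end to
      \<open>x i\<close> either adds such a stretch or removes one with
      \<open>pick \<ge> y\<close>.\<close>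
    case True
    have wg: "w (x i) \<le> \<gamma> i"
    proof (rule ccontr)
      assume "\<not> w (x i) \<le> \<gamma> i"
      then have "?p (\<gamma> i) < ?p (w (x i))"
        by (subst pick_less_iff[OF Z r0]) (use w x nodes[OF i] Wp(1)[OF w(1)] in auto)
      then show False using h[OF i] Wp(2)[OF w(1)] by simp
    qed
    have "?p (\<gamma> i) \<le> y"
    proof (rule ccontr)
      assume "\<not> ?p (\<gamma> i) \<le> y"
      then have "?p (x i) < ?p (\<gamma> i)" using Xp(2)[OF x(1)] by simp
      then have "x i < \<gamma> i" by (subst (asm) pick_less_iff[OF Z r0]) (use x nodes[OF i] Xp(1)[OF x(1)] in auto)
      then show False using True by simp
    qed
    then have 1: "?p (\<gamma> i) * (\<gamma> i - w (x i)) \<le> y * (\<gamma> i - w (x i))"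
      using wg by (intro mult_right_mono) auto
    have 2: "?L (w (x i)) - ?L (\<gamma> i) \<ge> ?p (\<gamma> i) * (w (x i) - \<gamma> i)"
      by (rule pot_tangent[OF Z r0]) (use w x nodes[OF i] Wp(1)[OF w(1)] in auto)
    have 3: "?L (\<mu> i) - ?L (x i) \<ge> ?p (x i) * (\<mu> i - x i)"
      by (rule pot_tangent[OF Z r0]) (use x gap[OF i] nodes[OF i] Xp(1)[OF x(1)] in auto)
    show ?thesis using 1 2 3 Xp(2)[OF x(1)] by (simp add: D_def algebra_simps)
  next
    \<comment> \<open>The whole interval lies where \<open>pick \<ge> y\<close>, so its net value is
      nonnegative, while \<open>D\<close> is nonpositive.\<close>
    case False
    have "?p (x i) < ?p (\<gamma> i)"
      by (subst pick_less_iff[OF Z r0]) (use False x nodes[OF i] Xp(1)[OF x(1)] in auto)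
    then have "y * (\<mu> i - \<gamma> i) \<le> ?p (\<gamma> i) * (\<mu> i - \<gamma> i)"
      using le[OF i] Xp(2)[OF x(1)] by (intro mult_right_mono) auto
    also have "\<dots> \<le> ?L (\<mu> i) - ?L (\<gamma> i)"
      by (rule pot_tangent[OF Z r0]) (use gap[OF i] nodes[OF i] in auto)
    finally show ?thesis using D0[OF x(1)[of i]] by simp
  qed
  have finX: "finite X" unfolding X_def by (rule finite_pick_zeros[OF Z r])
  have xR: "x ` R \<subseteq> X" using x(1) by auto
  \<comment> \<open>Over all gaps the lengths \<open>u - w u\<close> total \<open>y - h\<close> and
    the integrals total \<open>(y^2 - h^2) / 2\<close>.\<close>
  have "y\<^sup>2 / 2 - h\<^sup>2 / 2 - y * (y - h) = (\<Sum>u\<in>X. D u)"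
  proof -
    have "(\<Sum>u\<in>X. ?L (w u)) = (\<Sum>u\<in>W. ?L u)" "(\<Sum>u\<in>X. w u) = \<Sum>W"
      using sum.reindex_bij_betw[OF bij, of ?L] sum.reindex_bij_betw[OF bij, of "\<lambda>u. u"] by auto
    moreover have "\<Sum>X = \<Sum>Z + (c + y)" "\<Sum>W = \<Sum>Z + (c + h)"
      unfolding X_def W_def by (rule sum_pick_zeros[OF Z r])+
    moreover have "(\<Sum>u\<in>X. ?L u) - (\<Sum>u\<in>W. ?L u) = y\<^sup>2 / 2 - h\<^sup>2 / 2"
      unfolding X_def W_def by (rule sum_pot_pick_zeros[OF Z r])
    moreover have "(\<Sum>u\<in>X. D u) = (\<Sum>u\<in>X. ?L u) - (\<Sum>u\<in>X. ?L (w u)) - y * (\<Sum>X - (\<Sum>u\<in>X. w u))"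
      unfolding D_def by (simp only: sum_subtractf sum_distrib_left[symmetric])
    ultimately show ?thesis by simp
  qed
  also have "\<dots> = (\<Sum>u\<in>X - x ` R. D u) + (\<Sum>u\<in>x ` R. D u)"
    by (rule sum.subset_diff[OF xR finX])
  \<comment> \<open>Gaps that contain no interval contribute nonpositive terms, so discarding them
    can only increase the sum.\<close>
  also have "\<dots> \<le> (\<Sum>u\<in>x ` R. D u)" using sum_nonpos[of "X - x ` R" D] D0 by simp
  also have "\<dots> = (\<Sum>i\<in>R. D (x i))" using injx by (simp add: sum.reindex)
  also have "\<dots> \<le> (\<Sum>i\<in>R. ?L (\<mu> i) - ?L (\<gamma> i) - y * (\<mu> i - \<gamma> i))" by (rule sum_mono[OF DR])
  also have "\<dots> = (\<Sum>i\<in>R. ?L (\<mu> i) - ?L (\<gamma> i)) - y * s"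
    unfolding s_def by (simp only: sum_subtractf sum_distrib_left[symmetric])
  finally have "y\<^sup>2 / 2 - h\<^sup>2 / 2 - y * (y - h) + y * s \<le> (\<Sum>i\<in>R. ?L (\<mu> i) - ?L (\<gamma> i))"
    by linarith
  moreover have "y\<^sup>2 / 2 - h\<^sup>2 / 2 - y * (y - h) + y * s = h * s + s\<^sup>2 / 2"
    by (simp add: y_def power2_eq_square algebra_simps)
  ultimately show ?thesis by simp
qed

lemma gap_uminus:
  assumes "x \<notin> Z"
  shows "gap (uminus ` Z) (- x) = uminus ` (Z - gap Z x)"
  using assms by (auto simp: gap_def image_iff not_less order.order_iff_strict)

lemma pick_uminus: "pick (uminus ` Z) (\<lambda>z. r (- z)) (- c) (- x) = - pick Z r c x"
proof -
  have "(\<Sum>z\<in>Z. r z / (z - x)) = - (\<Sum>z\<in>Z. r z / (x - z))"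
    unfolding sum_negf[symmetric] by (intro sum.cong) (simp_all add: minus_divide_right)
  then show ?thesis by (simp add: pick_def sum.reindex inj_on_def)
qed

lemma pot_uminus: "pot (uminus ` Z) (\<lambda>z. r (- z)) (- c) (- x) = pot Z r c x"
  by (simp add: pot_def sum.reindex inj_on_def abs_minus_commute)

text \<open>The reflection \<open>x \<mapsto> - x\<close> turns downward intervals into upward ones
  and negates \<open>pick\<close> up to reflecting its data, so \<open>packing\<close>
  applies.\<close>

theorem packing_below:
  fixes \<gamma> \<mu> :: "'i \<Rightarrow> real"
  assumes Z: "finite Z" and r: "\<forall>z\<in>Z. r z > 0" and R: "finite R"
    and le: "\<And>i. i \<in> R \<Longrightarrow> \<mu> i \<le> \<gamma> i"
    and nodes: "\<And>i. i \<in> R \<Longrightarrow> \<gamma> i \<notin> Z" "\<And>i. i \<in> R \<Longrightarrow> \<mu> i \<notin> Z"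
    and gap: "\<And>i. i \<in> R \<Longrightarrow> gap Z (\<gamma> i) = gap Z (\<mu> i)"
    and inj: "inj_on (\<lambda>i. gap Z (\<gamma> i)) R"
    and h: "\<And>i. i \<in> R \<Longrightarrow> pick Z r c (\<gamma> i) \<le> - h"
  defines "s \<equiv> \<Sum>i\<in>R. \<gamma> i - \<mu> i"
  shows "(\<Sum>i\<in>R. pot Z r c (\<mu> i) - pot Z r c (\<gamma> i)) \<ge> h * s + s\<^sup>2 / 2"
proof -
  have inj': "inj_on (\<lambda>i. gap (uminus ` Z) (- \<gamma> i)) R"
  proof (rule inj_onI)
    fix i j assume ij: "i \<in> R" "j \<in> R" "gap (uminus ` Z) (- \<gamma> i) = gap (uminus ` Z) (- \<gamma> j)"
    then have "Z - gap Z (\<gamma> i) = Z - gap Z (\<gamma> j)"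
      using nodes by (simp add: gap_uminus inj_image_eq_iff)
    then have "gap Z (\<gamma> i) = gap Z (\<gamma> j)" by (auto simp: gap_def)
    then show "i = j" using inj ij by (auto dest: inj_onD)
  qed
  have "h * (\<Sum>i\<in>R. - \<mu> i - - \<gamma> i) + (\<Sum>i\<in>R. - \<mu> i - - \<gamma> i)\<^sup>2 / 2
    \<le> (\<Sum>i\<in>R. pot (uminus ` Z) (\<lambda>z. r (- z)) (- c) (- \<mu> i) - pot (uminus ` Z) (\<lambda>z. r (- z)) (- c) (- \<gamma> i))"
    by (rule packing)
      (use Z r R le nodes gap inj' h in \<open>auto simp: pick_uminus gap_uminus le_minus_iff\<close>)
  then show ?thesis by (simp add: pot_uminus s_def)
qed

section \<open>Generic rank-one coupling\<close>

text \<open>Two numbers in the same open half-plane have arguments whose sum lies strictly between 0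
  and \<open>2 * pi\<close> in absolute value, so their product is not a positive real.\<close>

lemma complex_mult_not_pos:
  fixes f g w :: complex
  assumes "Im f * Im w > 0" "Im g * Im w > 0" "e > 0"
  shows "f * g \<noteq> of_real e"
proof
  assume eq: "f * g = of_real e"
  have "Im f * Im g > 0" using assms(1,2) by (auto simp: zero_less_mult_iff)
  moreover have 1: "Re f * Re g - Im f * Im g = e" "Re f * Im g + Im f * Re g = 0"
    using arg_cong[OF eq, of Re] arg_cong[OF eq, of Im] by simp_all
  ultimately have "(Re f * Re g) * (Im g)\<^sup>2 > 0" using assms(3) by (intro mult_pos_pos[of "Re f * Re g"]) auto
  moreover have "(Re f * Re g) * (Im g)\<^sup>2 = - (Im f * Im g) * (Re g)\<^sup>2"
  proof -
    have "Re f * Im g = - (Im f * Re g)" using 1(2) by linarith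
    then have "(Re f * Im g) * (Re g * Im g) = - (Im f * Re g) * (Re g * Im g)" by simp
    then show ?thesis by (simp add: power2_eq_square mult_ac)
  qed
  moreover have "- (Im f * Im g) * (Re g)\<^sup>2 \<le> 0" using \<open>Im f * Im g > 0\<close>
    by (simp add: mult_nonneg_nonneg)
  ultimately show False by simp
qed

text \<open>\<open>f\<close> and \<open>g\<close> below are the functions \<open>1/F\<close> and
  \<open>1/G\<close>. Genericity means that no zero or node of \<open>f\<close> is a zero or node of
  \<open>g\<close>, which accounts for the four disjointness conditions.\<close>

locale generic_pair =
  fixes Z1 Z2 :: "real set" and r1 r2 :: "real \<Rightarrow> real" and a1 a2 \<epsilon> :: real
  assumes Z1: "finite Z1" and Z2: "finite Z2" and disj: "Z1 \<inter> Z2 = {}"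
    and r1: "\<forall>z\<in>Z1. r1 z > 0" and r2: "\<forall>z\<in>Z2. r2 z > 0"
    and eps: "\<epsilon> > 0"
    and z12: "pick_zeros Z1 r1 a1 \<inter> Z2 = {}" and z21: "Z1 \<inter> pick_zeros Z2 r2 a2 = {}"
    and zz: "pick_zeros Z1 r1 a1 \<inter> pick_zeros Z2 r2 a2 = {}"
begin

abbreviation "P \<equiv> pick_poly Z1 r1 a1"
abbreviation "Q \<equiv> pick_poly Z2 r2 a2"
abbreviation "f \<equiv> pick Z1 r1 a1"
abbreviation "g \<equiv> pick Z2 r2 a2"
abbreviation "Z \<equiv> Z1 \<union> Z2"

text \<open>The characteristic polynomial of \<open>A\<close>: the two node polynomials are the
  numerators \<open>P F\<close> and \<open>Q G\<close>.\<close>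

definition \<chi> :: "real poly" where
  "\<chi> = P * Q - smult (\<epsilon>\<^sup>2) (node_poly Z1 * node_poly Z2)"

definition \<Lambda> :: "real set" where "\<Lambda> = {x. poly \<chi> x = 0}"

lemma r1': "\<forall>z\<in>Z1. r1 z \<ge> 0" and r2': "\<forall>z\<in>Z2. r2 z \<ge> 0"
  using r1 r2 by (auto simp: less_imp_le)

text \<open>The coupling term vanishes at every node. The resulting agreement with
  \<open>P * Q\<close> cancels the logarithms in \<open>shift_bound\<close>.\<close>

lemma poly_chi_node:
  assumes "z \<in> Z"
  shows "poly \<chi> z = poly P z * poly Q z" "poly \<chi> z \<noteq> 0"
proof -
  have "poly (node_poly Z1) z * poly (node_poly Z2) z = 0"
    using assms Z1 Z2 by (auto simp: poly_node_poly)
  then show *: "poly \<chi> z = poly P z * poly Q z" by (simp add: \<chi>_def)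
  have "poly P z \<noteq> 0" using assms z12 pick_zeros_iff[OF Z1 r1, of z a1] by (auto simp: pick_zeros_def)
  moreover have "poly Q z \<noteq> 0" using assms z21 pick_zeros_iff[OF Z2 r2, of z a2] by (auto simp: pick_zeros_def)
  ultimately show "poly \<chi> z \<noteq> 0" unfolding * by simp
qed

lemma poly_chi:
  assumes "x \<notin> Z"
  shows "poly \<chi> x = poly (node_poly Z1) x * poly (node_poly Z2) x * (f x * g x - \<epsilon>\<^sup>2)"
  using assms by (simp add: \<chi>_def poly_pick_poly[OF Z1] poly_pick_poly[OF Z2] algebra_simps)

lemma Lambda_iff: "x \<in> \<Lambda> \<longleftrightarrow> x \<notin> Z \<and> f x * g x = \<epsilon>\<^sup>2"
proof (cases "x \<in> Z")
  case True
  then show ?thesis using poly_chi_node by (auto simp: \<Lambda>_def)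
next
  case False
  then show ?thesis using node_poly_nonzero[OF Z1, of x] node_poly_nonzero[OF Z2, of x]
    by (auto simp: \<Lambda>_def poly_chi)
qed

text \<open>The product of the node polynomials is monic of degree \<open>N - 2\<close>, so the
  coupling first shows in the third coefficient.\<close>

lemma coeff_chi:
  defines "N \<equiv> card Z1 + card Z2 + 2"
  shows "degree \<chi> = N" "lead_coeff \<chi> = 1"
    and "coeff (monom 1 2 * \<chi>) (N + 1) = coeff (monom 1 2 * (P * Q)) (N + 1)"
    and "coeff (monom 1 2 * \<chi>) N = coeff (monom 1 2 * (P * Q)) N - \<epsilon>\<^sup>2"
proof -
  let ?n = "node_poly Z1 * node_poly Z2"
  have dn: "degree (node_poly Z1) = card Z1" "degree (node_poly Z2) = card Z2"
     "lead_coeff (node_poly Z1) = 1" "lead_coeff (node_poly Z2) = 1"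
    unfolding node_poly_def by (rule degree_prod_linear lead_coeff_prod_linear Z1 Z2)+
  have nz: "node_poly Z1 \<noteq> 0" "node_poly Z2 \<noteq> 0" using dn by auto
  have d: "degree ?n = card Z1 + card Z2" "lead_coeff ?n = 1"
    using dn nz coeff_mult_degree_sum[of "node_poly Z1" "node_poly Z2"] by (auto simp: degree_mult_eq)
  have "P \<noteq> 0" "Q \<noteq> 0" using degree_pick_poly(2)[OF Z1, of r1 a1] degree_pick_poly(2)[OF Z2, of r2 a2] by auto
  then have D: "degree (P * Q) = N" "lead_coeff (P * Q) = 1"
    using degree_pick_poly[OF Z1, of r1 a1] degree_pick_poly[OF Z2, of r2 a2]
      coeff_mult_degree_sum[of P Q] by (auto simp: degree_mult_eq N_def)
  have c: "coeff \<chi> i = coeff (P * Q) i - \<epsilon>\<^sup>2 * coeff ?n i" for i by (simp add: \<chi>_def)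
  have c0: "coeff ?n i = 0" if "i > card Z1 + card Z2" for i using that d by (intro coeff_eq_0) simp
  have "coeff \<chi> N = 1" using D c0[of N] by (simp add: c N_def)
  moreover have "degree \<chi> \<le> N" using D c0 by (intro degree_le) (auto simp: c N_def coeff_eq_0)
  ultimately show "degree \<chi> = N" "lead_coeff \<chi> = 1" using le_degree[of \<chi> N] by auto
  have m: "coeff (monom 1 2 * p) (i + 2) = coeff p i" for p :: "real poly" and i
    by (simp add: coeff_monom_mult)
  show "coeff (monom 1 2 * \<chi>) (N + 1) = coeff (monom 1 2 * (P * Q)) (N + 1)"
    using c0[of "card Z1 + card Z2 + 1"] m[of _ "card Z1 + card Z2 + 1"] by (simp add: N_def c)
  show "coeff (monom 1 2 * \<chi>) N = coeff (monom 1 2 * (P * Q)) N - \<epsilon>\<^sup>2"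
    using d m[of _ "card Z1 + card Z2"] by (simp add: N_def c)
qed

text \<open>At a nonreal \<open>w\<close> both factors lie in the half-plane of \<open>w\<close>, so
  their product is not \<open>\<epsilon>\<^sup>2\<close>. At a real root \<open>f\<close> and
  \<open>g\<close> have the same sign and positive slopes, so \<open>f * g\<close> has nonzero
  derivative and the root is simple.\<close>

lemma Lambda:
  shows finite_Lambda: "finite \<Lambda>"
    and card_Lambda: "card \<Lambda> = card Z1 + card Z2 + 2"
    and prod_Lambda: "(\<Prod>x\<in>\<Lambda>. [:-x, 1:]) = \<chi>"
proof -
  have nr: "poly (map_poly of_real \<chi>) w \<noteq> 0" if w: "Im w \<noteq> 0" for w :: complex
  proof -
    let ?f = "\<lambda>Z r c. w - complex_of_real c - (\<Sum>z\<in>Z. of_real (r z) / (w - of_real z))"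
    have "poly (map_poly of_real \<chi>) w = (\<Prod>z\<in>Z1. w - of_real z) * (\<Prod>z\<in>Z2. w - of_real z)
       * (?f Z1 r1 a1 * ?f Z2 r2 a2 - of_real (\<epsilon>\<^sup>2))"
      by (simp add: \<chi>_def of_real_poly_hom.hom_minus of_real_poly_hom.hom_mult of_real_hom.map_poly_hom_smult
        poly_map_poly_pick_poly[OF Z1 w] poly_map_poly_pick_poly[OF Z2 w] poly_map_poly_node_poly algebra_simps)
    moreover have "?f Z1 r1 a1 * ?f Z2 r2 a2 \<noteq> of_real (\<epsilon>\<^sup>2)"
      by (rule complex_mult_not_pos[OF pick_complex_Im[OF r1' w] pick_complex_Im[OF r2' w]]) (use eps in simp)
    moreover have "(\<Prod>z\<in>Z1. w - of_real z) \<noteq> 0" "(\<Prod>z\<in>Z2. w - of_real z) \<noteq> 0" using w Z1 Z2 by auto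
    ultimately show ?thesis by simp
  qed
  have simple: "poly (pderiv \<chi>) x \<noteq> 0" if "poly \<chi> x = 0" for x
  proof -
    have x: "x \<notin> Z" "f x * g x = \<epsilon>\<^sup>2" using Lambda_iff[of x] that by (auto simp: \<Lambda>_def)
    let ?n = "\<lambda>x. poly (node_poly Z1 * node_poly Z2) x"
    obtain f' where f': "(f has_real_derivative f') (at x)" "f' > 0"
    proof
      show "(f has_real_derivative 1 + (\<Sum>z\<in>Z1. r1 z / (x - z)\<^sup>2)) (at x)"
        using x by (intro pick_has_derivative Z1) simp
      show "1 + (\<Sum>z\<in>Z1. r1 z / (x - z)\<^sup>2) > 0" using r1'
        by (intro add_pos_nonneg sum_nonneg divide_nonneg_nonneg) auto
    qed
    obtain g' where g': "(g has_real_derivative g') (at x)" "g' > 0"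
    proof
      show "(g has_real_derivative 1 + (\<Sum>z\<in>Z2. r2 z / (x - z)\<^sup>2)) (at x)"
        using x by (intro pick_has_derivative Z2) simp
      show "1 + (\<Sum>z\<in>Z2. r2 z / (x - z)\<^sup>2) > 0" using r2'
        by (intro add_pos_nonneg sum_nonneg divide_nonneg_nonneg) auto
    qed
    have "((\<lambda>x. ?n x * (f x * g x - \<epsilon>\<^sup>2)) has_real_derivative
        poly (pderiv (node_poly Z1 * node_poly Z2)) x * (f x * g x - \<epsilon>\<^sup>2)
        + (f' * g x + g' * f x - 0) * ?n x) (at x)"
      by (intro DERIV_mult poly_DERIV DERIV_diff DERIV_const f' g')
    moreover have "open (- Z)" using Z1 Z2 by (intro open_Compl finite_imp_closed) simp
    ultimately have "(poly \<chi> has_real_derivative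
        poly (pderiv (node_poly Z1 * node_poly Z2)) x * (f x * g x - \<epsilon>\<^sup>2)
        + (f' * g x + g' * f x - 0) * ?n x) (at x)"
      by (rule has_field_derivative_transform_within_open) (use x poly_chi in auto)
    then have "poly (pderiv \<chi>) x = (f' * g x + g' * f x) * ?n x"
      using x(2) DERIV_unique[OF poly_DERIV] by fastforce
    moreover have "?n x \<noteq> 0" using x node_poly_nonzero[OF Z1, of x] node_poly_nonzero[OF Z2, of x] by simp
    moreover have "f' * g x + g' * f x \<noteq> 0"
    proof -
      have "f x * g x > 0" using x eps by simp
      then consider "f x > 0" "g x > 0" | "f x < 0" "g x < 0" by (auto simp: zero_less_mult_iff)
      then show ?thesis
      proof cases
        case 1 then have "f' * g x + g' * f x > 0" using f' g' by (intro add_pos_pos mult_pos_pos) then show ?thesis by simp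
      next
        case 2 then have "f' * g x + g' * f x < 0" using f' g' by (intro add_neg_neg mult_pos_neg) then show ?thesis by simp
      qed
    qed
    ultimately show ?thesis by simp
  qed
  note * = real_rooted_split[OF nr simple coeff_chi(2), folded \<Lambda>_def]
  show c: "card \<Lambda> = card Z1 + card Z2 + 2" using * coeff_chi(1) by simp
  then show "finite \<Lambda>" using card.infinite[of \<Lambda>] by auto
  show "(\<Prod>x\<in>\<Lambda>. [:-x, 1:]) = \<chi>" using * by simp
qed

text \<open>The poles in the gaps of \<open>f\<close> and \<open>g\<close> that contain \<open>x\<close>; the later one is where an upward move to \<open>x\<close> starts.\<close>

definition \<alpha> :: "real \<Rightarrow> real" where
  "\<alpha> x = (THE u. u \<in> pick_zeros Z1 r1 a1 \<and> gap Z1 u = gap Z1 x)"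

definition \<beta> :: "real \<Rightarrow> real" where
  "\<beta> x = (THE u. u \<in> pick_zeros Z2 r2 a2 \<and> gap Z2 u = gap Z2 x)"

text \<open>On \<open>\<Lambda>\<close> this is the nearer of the two poles: both lie below
  \<open>x\<close> if \<open>f x > 0\<close>, and above \<open>x\<close> otherwise.\<close>

definition \<gamma> :: "real \<Rightarrow> real" where
  "\<gamma> x = (if f x > 0 then max (\<alpha> x) (\<beta> x) else min (\<alpha> x) (\<beta> x))"

lemma alpha: "\<alpha> x \<in> pick_zeros Z1 r1 a1" "gap Z1 (\<alpha> x) = gap Z1 x" "\<alpha> x \<notin> Z" "f (\<alpha> x) = 0"
proof -
  show *: "\<alpha> x \<in> pick_zeros Z1 r1 a1" "gap Z1 (\<alpha> x) = gap Z1 x"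
    using theI'[OF ex1_pick_zero_in_gap[OF Z1 r1, of a1 x]] by (auto simp: \<alpha>_def)
  from *(1) show "\<alpha> x \<notin> Z" "f (\<alpha> x) = 0" using z12 by (auto simp: pick_zeros_iff[OF Z1 r1])
qed

lemma beta: "\<beta> x \<in> pick_zeros Z2 r2 a2" "gap Z2 (\<beta> x) = gap Z2 x" "\<beta> x \<notin> Z" "g (\<beta> x) = 0"
proof -
  show *: "\<beta> x \<in> pick_zeros Z2 r2 a2" "gap Z2 (\<beta> x) = gap Z2 x"
    using theI'[OF ex1_pick_zero_in_gap[OF Z2 r2, of a2 x]] by (auto simp: \<beta>_def)
  from *(1) show "\<beta> x \<notin> Z" "g (\<beta> x) = 0" using z21 by (auto simp: pick_zeros_iff[OF Z2 r2])
qed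

lemma Lambda_cases:
  assumes "x \<in> \<Lambda>"
  obtains "x \<notin> Z" "f x > 0" "g x > 0" | "x \<notin> Z" "f x < 0" "g x < 0"
proof -
  have "f x * g x > 0" "x \<notin> Z" using assms eps by (auto simp: Lambda_iff)
  then show ?thesis using that by (auto simp: zero_less_mult_iff)
qed

lemma gap_split: "gap Z x = gap Z y \<longleftrightarrow> gap Z1 x = gap Z1 y \<and> gap Z2 x = gap Z2 y"
  using gap_eqD[of Z x y] gap_eqD[of Z1 x y] gap_eqD[of Z2 x y] by (auto intro!: gap_eqI)

text \<open>At the larger pole one of \<open>f\<close>, \<open>g\<close> vanishes; the other has
  left its own zero behind by at least \<open>\<eta>\<close> and has slope at least 1.\<close>

lemma pole_up:
  assumes "x \<in> \<Lambda>" "f x > 0"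
    and gap: "\<And>u v. u \<in> pick_zeros Z1 r1 a1 \<Longrightarrow> v \<in> pick_zeros Z2 r2 a2 \<Longrightarrow> \<eta> \<le> \<bar>u - v\<bar>"
  shows "\<gamma> x \<notin> Z" "gap Z (\<gamma> x) = gap Z x" "\<gamma> x \<le> x" "f (\<gamma> x) \<ge> 0" "g (\<gamma> x) \<ge> 0"
    "f (\<gamma> x) + g (\<gamma> x) \<ge> \<eta>"
proof -
  have x: "x \<notin> Z" "g x > 0" using assms by (auto elim: Lambda_cases)
  have a: "\<alpha> x < x" using pick_less_iff[where c = a1, OF Z1 r1' alpha(2)] alpha x assms(2) by auto
  have b: "\<beta> x < x" using pick_less_iff[where c = a2, OF Z2 r2' beta(2)] beta x by auto
  have \<gamma>: "\<gamma> x = max (\<alpha> x) (\<beta> x)" using assms(2) by (simp add: \<gamma>_def)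
  show n: "\<gamma> x \<notin> Z" using alpha(3) beta(3) by (auto simp: \<gamma> max_def)
  show le: "\<gamma> x \<le> x" using a b by (simp add: \<gamma>)
  have g1: "gap Z1 (\<gamma> x) = gap Z1 (\<alpha> x)" by (rule gap_between[OF alpha(2)]) (use le in \<open>auto simp: \<gamma>\<close>)
  have g2: "gap Z2 (\<gamma> x) = gap Z2 (\<beta> x)" by (rule gap_between[OF beta(2)]) (use le in \<open>auto simp: \<gamma>\<close>)
  show "gap Z (\<gamma> x) = gap Z x" using g1 g2 alpha(2) beta(2) by (simp add: gap_split)
  have 1: "f (\<gamma> x) - f (\<alpha> x) \<ge> \<gamma> x - \<alpha> x"
    by (rule pick_diff[OF Z1 r1' g1[symmetric]]) (use n alpha in \<open>auto simp: \<gamma>\<close>)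
  have 2: "g (\<gamma> x) - g (\<beta> x) \<ge> \<gamma> x - \<beta> x"
    by (rule pick_diff[OF Z2 r2' g2[symmetric]]) (use n beta in \<open>auto simp: \<gamma>\<close>)
  show "f (\<gamma> x) \<ge> 0" "g (\<gamma> x) \<ge> 0" "f (\<gamma> x) + g (\<gamma> x) \<ge> \<eta>"
    using 1 2 alpha(4) beta(4) gap[OF alpha(1) beta(1), of x x] by (auto simp: \<gamma> max_def split: if_splits)
qed

lemma pole_down:
  assumes "x \<in> \<Lambda>" "\<not> f x > 0"
    and gap: "\<And>u v. u \<in> pick_zeros Z1 r1 a1 \<Longrightarrow> v \<in> pick_zeros Z2 r2 a2 \<Longrightarrow> \<eta> \<le> \<bar>u - v\<bar>"
  shows "\<gamma> x \<notin> Z" "gap Z (\<gamma> x) = gap Z x" "x \<le> \<gamma> x" "f (\<gamma> x) \<le> 0" "g (\<gamma> x) \<le> 0"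
    "f (\<gamma> x) + g (\<gamma> x) \<le> - \<eta>"
proof -
  have x: "x \<notin> Z" "f x < 0" "g x < 0" using assms by (auto elim: Lambda_cases)
  have a: "x < \<alpha> x" using pick_less_iff[where c = a1, OF Z1 r1' alpha(2)[symmetric]] alpha x by auto
  have b: "x < \<beta> x" using pick_less_iff[where c = a2, OF Z2 r2' beta(2)[symmetric]] beta x by auto
  have \<gamma>: "\<gamma> x = min (\<alpha> x) (\<beta> x)" using assms(2) by (simp add: \<gamma>_def)
  show n: "\<gamma> x \<notin> Z" using alpha(3) beta(3) by (auto simp: \<gamma> min_def)
  show le: "x \<le> \<gamma> x" using a b by (simp add: \<gamma>)
  have g1: "gap Z1 (\<gamma> x) = gap Z1 x" by (rule gap_between[OF alpha(2)[symmetric]]) (use le in \<open>auto simp: \<gamma>\<close>)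
  have g2: "gap Z2 (\<gamma> x) = gap Z2 x" by (rule gap_between[OF beta(2)[symmetric]]) (use le in \<open>auto simp: \<gamma>\<close>)
  show "gap Z (\<gamma> x) = gap Z x" using g1 g2 by (simp add: gap_split)
  have 1: "f (\<alpha> x) - f (\<gamma> x) \<ge> \<alpha> x - \<gamma> x"
    by (rule pick_diff[OF Z1 r1']) (use n alpha g1 in \<open>auto simp: \<gamma>\<close>)
  have 2: "g (\<beta> x) - g (\<gamma> x) \<ge> \<beta> x - \<gamma> x"
    by (rule pick_diff[OF Z2 r2']) (use n beta g2 in \<open>auto simp: \<gamma>\<close>)
  show "f (\<gamma> x) \<le> 0" "g (\<gamma> x) \<le> 0" "f (\<gamma> x) + g (\<gamma> x) \<le> - \<eta>"
    using 1 2 alpha(4) beta(4) gap[OF alpha(1) beta(1), of x x] by (auto simp: \<gamma> min_def split: if_splits)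
qed

lemma gamma_in: "\<gamma> x \<in> pick_zeros Z1 r1 a1 \<union> pick_zeros Z2 r2 a2"
  using alpha(1)[of x] beta(1)[of x] by (simp add: \<gamma>_def max_def min_def)

text \<open>Within a gap \<open>f\<close> and \<open>g\<close> increase, so \<open>f * g\<close> is
  strictly monotone where both are positive and where both are negative. It takes the value
  \<open>\<epsilon>\<^sup>2\<close> at most once for each sign.\<close>

lemma Lambda_gap_inj:
  assumes "x \<in> \<Lambda>" "y \<in> \<Lambda>" "f x > 0 \<longleftrightarrow> f y > 0" "gap Z x = gap Z y"
  shows "x = y"
proof -
  have False if "x \<in> \<Lambda>" "y \<in> \<Lambda>" "f x > 0 \<longleftrightarrow> f y > 0" "gap Z x = gap Z y" "x < y" for x y
  proof -
    have n: "x \<notin> Z" "y \<notin> Z" and e: "f x * g x = f y * g y" using that by (auto simp: Lambda_iff)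
    have lt: "f x < f y" "g x < g y"
      using pick_less_iff[where c = a1, OF Z1 r1', of x y] pick_less_iff[where c = a2, OF Z2 r2', of x y] n that
      by (auto simp: gap_split)
    from that(1) show False
    proof (cases rule: Lambda_cases)
      case 1
      then have "f x * g x < f y * g y" using lt by (intro mult_strict_mono) auto
      then show False using e by simp
    next
      case 2
      then have "f y < 0" "g y < 0" using that by (auto elim: Lambda_cases)
      then have "f y * g y < f x * g x" using lt 2 mult_strict_mono[of "- f y" "- f x" "- g y" "- g x"] by simp
      then show False using e by simp
    qed
  qed
  then show ?thesis using assms by (metis linorder_neqE)
qed

text \<open>An upward and a downward move from one pole would make \<open>f\<close> and
  \<open>g\<close> vanish there together, against \<open>zz\<close>. Two moves in the same direction
  end in the same gap, where \<open>Lambda_gap_inj\<close> applies.\<close>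

lemma gamma_inj: "inj_on \<gamma> \<Lambda>"
proof (rule inj_onI)
  fix x y assume x: "x \<in> \<Lambda>" and y: "y \<in> \<Lambda>" and eq: "\<gamma> x = \<gamma> y"
  \<comment> \<open>Only signs and gaps are used here, so the separation is instantiated with the
    bound \<open>- 1\<close>, which holds for all pairs.\<close>
  have no_eta: "- 1 \<le> \<bar>u - v\<bar>" for u v :: real by simp
  note up = pole_up[OF _ _ no_eta] and down = pole_down[OF _ _ no_eta]
  have "False" if "x \<in> \<Lambda>" "y \<in> \<Lambda>" "\<gamma> x = \<gamma> y" "f x > 0" "\<not> f y > 0" for x y
  proof -
    have "f (\<gamma> x) = 0" "g (\<gamma> x) = 0" using up[OF that(1,4)] down[OF that(2,5)] that(3) by auto
    moreover have "\<gamma> x \<notin> Z" using up[OF that(1,4)] by simp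
    ultimately have "\<gamma> x \<in> pick_zeros Z1 r1 a1 \<inter> pick_zeros Z2 r2 a2"
      by (simp add: pick_zeros_iff[OF Z1 r1] pick_zeros_iff[OF Z2 r2])
    then show False using zz by simp
  qed
  then have s: "f x > 0 \<longleftrightarrow> f y > 0" using x y eq by metis
  moreover have "gap Z x = gap Z y" using up(2) down(2) x y eq s by metis
  ultimately show "x = y" by (rule Lambda_gap_inj[OF x y])
qed

text \<open>Injectivity suffices because there are as many eigenvalues in \<open>\<Lambda>\<close>
  as poles.\<close>

lemma gamma_bij: "bij_betw \<gamma> \<Lambda> (pick_zeros Z1 r1 a1 \<union> pick_zeros Z2 r2 a2)"
proof -
  let ?G = "pick_zeros Z1 r1 a1 \<union> pick_zeros Z2 r2 a2"
  have "card ?G = card \<Lambda>"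
    using card_Un_disjoint[OF finite_pick_zeros[OF Z1 r1] finite_pick_zeros[OF Z2 r2] zz]
    by (simp add: card_pick_zeros[OF Z1 r1] card_pick_zeros[OF Z2 r2] card_Lambda)
  moreover have "\<gamma> ` \<Lambda> \<subseteq> ?G" using gamma_in by auto
  ultimately have "\<gamma> ` \<Lambda> = ?G"
    using finite_pick_zeros[OF Z1 r1] finite_pick_zeros[OF Z2 r2] card_image[OF gamma_inj]
    by (intro card_subset_eq) auto
  then show ?thesis using gamma_inj by (simp add: bij_betw_def)
qed

lemma prod_gamma: "(\<Prod>x\<in>\<Lambda>. [:- \<gamma> x, 1:]) = P * Q"
proof -
  have "(\<Prod>x\<in>\<Lambda>. [:- \<gamma> x, 1:]) = (\<Prod>u\<in>pick_zeros Z1 r1 a1 \<union> pick_zeros Z2 r2 a2. [:- u, 1:])"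
    using prod.reindex_bij_betw[OF gamma_bij, of "\<lambda>u. [:-u, 1:]"] .
  also have "\<dots> = P * Q"
    by (subst prod.union_disjoint[OF finite_pick_zeros[OF Z1 r1] finite_pick_zeros[OF Z2 r2] zz])
      (simp add: prod_pick_zeros[OF Z1 r1] prod_pick_zeros[OF Z2 r2])
  finally show ?thesis .
qed

text \<open>The potential available is \<open>\<epsilon>\<^sup>2\<close>; upward and downward moves
  have the same total length \<open>s\<close>, and each direction uses at least
  \<open>\<eta> * s / 2 + s\<^sup>2 / 2\<close> of it.\<close>

theorem shift_bound:
  assumes gap: "\<And>u v. u \<in> pick_zeros Z1 r1 a1 \<Longrightarrow> v \<in> pick_zeros Z2 r2 a2 \<Longrightarrow> \<eta> \<le> \<bar>u - v\<bar>"
  defines "s \<equiv> \<Sum>x\<in>\<Lambda>. max 0 (x - \<gamma> x)"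
  shows "(\<Sum>x\<in>\<Lambda>. x - \<gamma> x) = 0" "s\<^sup>2 + \<eta> * s \<le> \<epsilon>\<^sup>2"
proof -
  \<comment> \<open>With these data \<open>pick Z r c\<close> is the mean of \<open>f\<close> and
    \<open>g\<close>; disjointness of \<open>Z1\<close> and \<open>Z2\<close> lets one weight
    function serve both.\<close>
  define r where "r z = (if z \<in> Z1 then r1 z / 2 else r2 z / 2)" for z
  define c where "c = (a1 + a2) / 2"
  let ?L = "pot Z r c"
  have Z: "finite Z" using Z1 Z2 by simp
  have r: "\<forall>z\<in>Z. r z > 0" using r1 r2 by (auto simp: r_def)
  have Y: "pick Z r c x = (f x + g x) / 2" for x
  proof -
    have "(\<Sum>z\<in>Z. r z / (x - z)) = (\<Sum>z\<in>Z1. r z / (x - z)) + (\<Sum>z\<in>Z2. r z / (x - z))"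
      by (rule sum.union_disjoint[OF Z1 Z2 disj])
    also have "(\<Sum>z\<in>Z1. r z / (x - z)) = (\<Sum>z\<in>Z1. r1 z / (x - z)) / 2"
      unfolding sum_divide_distrib by (intro sum.cong) (auto simp: r_def)
    also have "(\<Sum>z\<in>Z2. r z / (x - z)) = (\<Sum>z\<in>Z2. r2 z / (x - z)) / 2"
      unfolding sum_divide_distrib using disj by (intro sum.cong) (auto simp: r_def)
    finally show ?thesis by (simp add: pick_def c_def field_simps)
  qed
  let ?N = "card Z1 + card Z2 + 2"
  have prodL: "(\<Prod>x\<in>\<Lambda>. [:- (\<lambda>x. x) x, 1:]) = \<chi>" by (simp add: prod_Lambda)
  note sumL = sum_power2_roots[OF finite_Lambda card_Lambda prodL]
    and sumG = sum_power2_roots[OF finite_Lambda card_Lambda prod_gamma]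
  show sum0: "(\<Sum>x\<in>\<Lambda>. x - \<gamma> x) = 0"
    using sumL(1) sumG(1) coeff_chi(3) by (simp add: sum_subtractf)
  \<comment> \<open>The polynomials of the eigenvalues and of the poles agree at the nodes and in
    two leading coefficients; only the third coefficient contributes.\<close>
  have "(\<Sum>x\<in>\<Lambda>. ?L x) - (\<Sum>x\<in>\<Lambda>. ?L (\<gamma> x)) = \<epsilon>\<^sup>2"
  proof -
    have nz: "\<forall>z\<in>Z. poly \<chi> z \<noteq> 0" "\<forall>z\<in>Z. poly (P * Q) z \<noteq> 0"
      using poly_chi_node by auto
    have eq: "(\<Sum>z\<in>Z. r z * ln \<bar>poly \<chi> z\<bar>) = (\<Sum>z\<in>Z. r z * ln \<bar>poly (P * Q) z\<bar>)"
      by (intro sum.cong refl) (simp only: poly_chi_node(1) poly_mult)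
    have *: "A - B = e" if "A = (a\<^sup>2 - 2 * (b - e)) / 2 + k * a - t" "B = (a\<^sup>2 - 2 * b) / 2 + k * a - t"
      for A B a b e k t :: real
      using that by (simp add: field_simps)
    show ?thesis
      by (rule *[OF sum_pot_roots[where Z = Z and r = r and c = c, OF finite_Lambda card_Lambda prodL nz(1),
            unfolded eq coeff_chi(3,4)]
          sum_pot_roots[where Z = Z and r = r and c = c, OF finite_Lambda card_Lambda prod_gamma nz(2)]])
  qed
  define R where "R = {x \<in> \<Lambda>. f x > 0}"
  define D where "D = {x \<in> \<Lambda>. \<not> f x > 0}"
  have RD: "\<Lambda> = R \<union> D" "R \<inter> D = {}" and fin: "finite R" "finite D"
    using finite_Lambda by (auto simp: R_def D_def)
  have split: "(\<Sum>x\<in>\<Lambda>. h x) = (\<Sum>x\<in>R. h x) + (\<Sum>x\<in>D. h x)" for h :: "real \<Rightarrow> real"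
    unfolding RD(1) by (rule sum.union_disjoint[OF fin RD(2)])
  have up: "x \<notin> Z" "\<gamma> x \<notin> Z" "gap Z (\<gamma> x) = gap Z x" "\<gamma> x \<le> x" "f (\<gamma> x) + g (\<gamma> x) \<ge> \<eta>" if "x \<in> R" for x
    using pole_up[OF _ _ gap, of x] that by (auto simp: R_def elim: Lambda_cases)
  have down: "x \<notin> Z" "\<gamma> x \<notin> Z" "gap Z (\<gamma> x) = gap Z x" "x \<le> \<gamma> x" "f (\<gamma> x) + g (\<gamma> x) \<le> - \<eta>" if "x \<in> D" for x
    using pole_down[OF _ _ gap, of x] that by (auto simp: D_def elim: Lambda_cases)
  have injR: "inj_on (\<lambda>x. gap Z (\<gamma> x)) R"
    by (rule inj_onI) (use up(3) Lambda_gap_inj in \<open>auto simp: R_def\<close>)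
  have injD: "inj_on (\<lambda>x. gap Z (\<gamma> x)) D"
    by (rule inj_onI) (use down(3) Lambda_gap_inj in \<open>auto simp: D_def\<close>)
  have sR: "s = (\<Sum>x\<in>R. x - \<gamma> x)"
  proof -
    have "(\<Sum>x\<in>D. max 0 (x - \<gamma> x)) = 0" using down(4) by (intro sum.neutral) auto
    moreover have "(\<Sum>x\<in>R. max 0 (x - \<gamma> x)) = (\<Sum>x\<in>R. x - \<gamma> x)" using up(4) by (intro sum.cong) auto
    ultimately show ?thesis by (simp add: s_def split)
  qed
  \<comment> \<open>Equality of the traces: the displacements sum to zero.\<close>
  have sD: "s = (\<Sum>x\<in>D. \<gamma> x - x)"
    using sum0 unfolding split sR by (simp add: sum_subtractf)
  \<comment> \<open>The mean of \<open>f\<close> and \<open>g\<close> is at least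
    \<open>\<eta> / 2\<close> at the poles that move up, which is the level \<open>h\<close> of
    \<open>packing\<close>.\<close>
  have "\<eta> / 2 * s + s\<^sup>2 / 2 \<le> (\<Sum>x\<in>R. ?L x - ?L (\<gamma> x))"
    unfolding sR by (rule packing[OF Z r fin(1)]) (use up injR in \<open>auto simp: Y\<close>)
  moreover have "\<eta> / 2 * s + s\<^sup>2 / 2 \<le> (\<Sum>x\<in>D. ?L x - ?L (\<gamma> x))"
    unfolding sD by (rule packing_below[OF Z r fin(2)]) (use down injD in \<open>auto simp: Y\<close>)
  ultimately have "\<eta> * s + s\<^sup>2 \<le> (\<Sum>x\<in>\<Lambda>. ?L x - ?L (\<gamma> x))" unfolding split by simp
  also have "\<dots> = \<epsilon>\<^sup>2" using \<open>(\<Sum>x\<in>\<Lambda>. ?L x) - (\<Sum>x\<in>\<Lambda>. ?L (\<gamma> x)) = \<epsilon>\<^sup>2\<close> by (simp add: sum_subtractf)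
  finally show "s\<^sup>2 + \<eta> * s \<le> \<epsilon>\<^sup>2" by simp
qed

end

section \<open>From poles to nodes, and removal of genericity\<close>

definition linear_prod :: "'i set \<Rightarrow> ('i \<Rightarrow> real) \<Rightarrow> real poly" where
  "linear_prod I \<alpha> = (\<Prod>i\<in>I. [:- \<alpha> i, 1:])"

text \<open>The numerator of the sum of \<open>p i / (x - \<alpha> i)\<close> over the denominator
  \<open>linear_prod I \<alpha>\<close>. As a polynomial it stays meaningful for repeated
  \<open>\<alpha> i\<close> and in limits.\<close>

definition weighted_poly :: "'i set \<Rightarrow> ('i \<Rightarrow> real) \<Rightarrow> ('i \<Rightarrow> real) \<Rightarrow> real poly" where
  "weighted_poly I \<alpha> p = (\<Sum>i\<in>I. smult (p i) (linear_prod (I - {i}) \<alpha>))"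

lemma poly_linear_prod: "poly (linear_prod I \<alpha>) x = (\<Prod>i\<in>I. x - \<alpha> i)"
  by (simp add: linear_prod_def poly_prod)

lemma poly_weighted_poly: "poly (weighted_poly I \<alpha> p) x = (\<Sum>i\<in>I. p i * (\<Prod>k\<in>I - {i}. x - \<alpha> k))"
  by (simp add: weighted_poly_def poly_sum poly_linear_prod)

lemma weighted_poly_quotient:
  assumes "finite I" "x \<notin> \<alpha> ` I"
  shows "poly (weighted_poly I \<alpha> p) x = poly (linear_prod I \<alpha>) x * (\<Sum>i\<in>I. p i / (x - \<alpha> i))"
proof -
  have "p i * (\<Prod>k\<in>I - {i}. x - \<alpha> k) = (\<Prod>k\<in>I. x - \<alpha> k) * (p i / (x - \<alpha> i))" if "i \<in> I" for i
  proof -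
    have "x - \<alpha> i \<noteq> 0" using assms(2) that by auto
    then show ?thesis by (subst prod.remove[OF assms(1) that]) (simp add: field_simps)
  qed
  then show ?thesis by (simp add: poly_weighted_poly poly_linear_prod sum_distrib_left)
qed

lemma degree_weighted_poly:
  assumes "finite I" "I \<noteq> {}" "sum p I = 1"
  shows "degree (weighted_poly I \<alpha> p) = card I - 1" "lead_coeff (weighted_poly I \<alpha> p) = 1"
proof -
  have d: "degree (linear_prod (I - {i}) \<alpha>) = card I - 1" "lead_coeff (linear_prod (I - {i}) \<alpha>) = 1" if "i \<in> I" for i
    unfolding linear_prod_def lead_coeff_prod_linear using assms(1) that by (auto simp: degree_prod_linear)
  have "coeff (weighted_poly I \<alpha> p) (card I - 1) = (\<Sum>i\<in>I. p i * 1)"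
    unfolding weighted_poly_def coeff_sum coeff_smult by (intro sum.cong refl arg_cong2[of _ _ _ _ "(*)"]) (use d in metis)
  then have 1: "coeff (weighted_poly I \<alpha> p) (card I - 1) = 1" using assms(3) by simp
  have "degree (weighted_poly I \<alpha> p) \<le> card I - 1"
    unfolding weighted_poly_def by (intro degree_sum_le assms order_trans[OF degree_smult_le]) (simp add: d)
  then show "degree (weighted_poly I \<alpha> p) = card I - 1" using 1 le_degree[of "weighted_poly I \<alpha> p" "card I - 1"] by simp
  then show "lead_coeff (weighted_poly I \<alpha> p) = 1" using 1 by simp
qed

text \<open>Every term has imaginary part of the sign opposite to \<open>Im w\<close>, so the terms
  cannot cancel.\<close>

lemma Im_sum_poles:
  assumes "finite I" "I \<noteq> {}" "\<forall>i\<in>I. p i > 0" "Im w \<noteq> 0"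
  shows "(\<Sum>i\<in>I. complex_of_real (p i) / (w - of_real (\<alpha> i))) \<noteq> 0"
proof -
  have "Im (complex_of_real (p i) / (w - of_real (\<alpha> i))) * Im w < 0" if "i \<in> I" for i
  proof -
    have "Im (complex_of_real (p i) / (w - of_real (\<alpha> i))) * Im w = - (p i * (Im w * Im w) / (cmod (w - of_real (\<alpha> i)))\<^sup>2)"
      by (simp add: Im_divide cmod_power2 mult.assoc)
    moreover have "w \<noteq> of_real (\<alpha> i)" using assms(4) by auto
    moreover have "Im w * Im w > 0" using assms(4) by (auto simp: zero_less_mult_iff)
    ultimately show ?thesis using assms(3) that by simp
  qed
  then have "(\<Sum>i\<in>I. Im (complex_of_real (p i) / (w - of_real (\<alpha> i))) * Im w) < 0"
    using assms(1,2) sum_strict_mono[of I _ "\<lambda>_. 0"] by fastforce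
  then have "Im (\<Sum>i\<in>I. complex_of_real (p i) / (w - of_real (\<alpha> i))) \<noteq> 0"
    by (auto simp flip: sum_distrib_right)
  then show ?thesis by (metis zero_complex.sel(2))
qed

text \<open>Let \<open>F\<close> be the sum of \<open>p i / (x - \<alpha> i)\<close>. Since
  \<open>F' < 0\<close>, its zeros are simple, and the residues \<open>1 / F'\<close> of
  \<open>1/F\<close> there are negative. So the partial fraction expansion of \<open>1/F\<close> is
  a \<open>pick\<close> function.\<close>

lemma poles_to_nodes:
  assumes I: "finite I" "I \<noteq> {}" and inj: "inj_on \<alpha> I" and p: "\<forall>i\<in>I. p i > 0" "sum p I = 1"
  obtains Z r a where "finite Z" "\<forall>z\<in>Z. r z > 0" "node_poly Z = weighted_poly I \<alpha> p"
    "pick_poly Z r a = linear_prod I \<alpha>"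
proof -
  let ?W = "weighted_poly I \<alpha> p" and ?P = "linear_prod I \<alpha>"
  define F' where "F' x = - (\<Sum>i\<in>I. p i / (x - \<alpha> i)\<^sup>2)" for x
  define Z where "Z = {x. poly ?W x = 0}"
  have Zn: "x \<notin> \<alpha> ` I" "(\<Sum>i\<in>I. p i / (x - \<alpha> i)) = 0" "poly ?P x \<noteq> 0" if "x \<in> Z" for x
  proof -
    show n: "x \<notin> \<alpha> ` I"
    proof
      assume "x \<in> \<alpha> ` I"
      then obtain i where i: "i \<in> I" "x = \<alpha> i" by auto
      have "poly ?W x = p i * (\<Prod>k\<in>I - {i}. x - \<alpha> k) + (\<Sum>j\<in>I - {i}. p j * (\<Prod>k\<in>I - {j}. x - \<alpha> k))"
        unfolding poly_weighted_poly by (rule sum.remove[OF I(1) i(1)])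
      also have "(\<Sum>j\<in>I - {i}. p j * (\<Prod>k\<in>I - {j}. x - \<alpha> k)) = 0"
        using i I(1) by (intro sum.neutral) auto
      finally have "p i * (\<Prod>k\<in>I - {i}. x - \<alpha> k) = 0" using that by (simp add: Z_def)
      moreover have "p i > 0" using p i by simp
      ultimately have "(\<Prod>k\<in>I - {i}. x - \<alpha> k) = 0" by simp
      then show False using inj i I(1) by (auto dest: inj_onD)
    qed
    then show nz: "poly ?P x \<noteq> 0" using I(1) by (auto simp: poly_linear_prod)
    have "poly ?W x = 0" using that by (simp add: Z_def)
    then show "(\<Sum>i\<in>I. p i / (x - \<alpha> i)) = 0"
      using weighted_poly_quotient[OF I(1) n, of p] nz by simp
  qed
  have F'neg: "F' x < 0" if "x \<in> Z" for x
  proof -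
    have "p i / (x - \<alpha> i)\<^sup>2 > 0" if "i \<in> I" for i
      using p(1) that Zn(1)[OF \<open>x \<in> Z\<close>] by (intro divide_pos_pos) auto
    then have "(\<Sum>i\<in>I. p i / (x - \<alpha> i)\<^sup>2) > 0" using I by (intro sum_pos) auto
    then show ?thesis by (simp add: F'_def)
  qed
  have deriv: "poly (pderiv ?W) x = poly ?P x * F' x" if "x \<in> Z" for x
  proof -
    have nz: "x - \<alpha> i \<noteq> 0" if "i \<in> I" for i using Zn(1)[OF \<open>x \<in> Z\<close>] that by auto
    have "((\<lambda>x. \<Sum>i\<in>I. p i / (x - \<alpha> i)) has_real_derivative F' x) (at x)"
      unfolding F'_def by (rule derivative_eq_intros refl nz | assumption)+ (simp add: power2_eq_square sum_negf)
    then have "((\<lambda>x. poly ?P x * (\<Sum>i\<in>I. p i / (x - \<alpha> i))) has_real_derivative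
      poly (pderiv ?P) x * (\<Sum>i\<in>I. p i / (x - \<alpha> i)) + F' x * poly ?P x) (at x)"
      by (rule DERIV_mult[OF poly_DERIV])
    moreover have "open (- (\<alpha> ` I))" using I(1) by (intro open_Compl finite_imp_closed) simp
    ultimately have "(poly ?W has_real_derivative
      poly (pderiv ?P) x * (\<Sum>i\<in>I. p i / (x - \<alpha> i)) + F' x * poly ?P x) (at x)"
      by (rule has_field_derivative_transform_within_open)
        (use Zn(1)[OF that] weighted_poly_quotient[OF I(1), of _ \<alpha> p] in auto)
    then show ?thesis using Zn(2)[OF that] DERIV_unique[OF poly_DERIV] by fastforce
  qed
  have nr: "poly (map_poly of_real ?W) w \<noteq> 0" if w: "Im w \<noteq> 0" for w :: complex
  proof -
    have "poly (map_poly of_real ?W) w = (\<Sum>i\<in>I. of_real (p i) * (\<Prod>k\<in>I - {i}. w - of_real (\<alpha> k)))"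
      by (simp add: weighted_poly_def linear_prod_def of_real_poly_hom.hom_sum of_real_hom.map_poly_hom_smult
          of_real_poly_hom.hom_prod poly_sum poly_prod)
    also have "\<dots> = (\<Prod>k\<in>I. w - of_real (\<alpha> k)) * (\<Sum>i\<in>I. of_real (p i) / (w - of_real (\<alpha> i)))"
    proof -
      have "of_real (p i) * (\<Prod>k\<in>I - {i}. w - of_real (\<alpha> k))
        = (\<Prod>k\<in>I. w - of_real (\<alpha> k)) * (of_real (p i) / (w - of_real (\<alpha> i)))" if "i \<in> I" for i
      proof -
        have "w - of_real (\<alpha> i) \<noteq> 0" using w by auto
        then show ?thesis by (subst prod.remove[OF I(1) that]) (simp add: field_simps)
      qed
      then show ?thesis by (simp add: sum_distrib_left)
    qed
    also have "\<dots> \<noteq> 0" using Im_sum_poles[OF I p(1) w] w I(1) by auto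
    finally show ?thesis .
  qed
  have simple: "poly (pderiv ?W) x \<noteq> 0" if "poly ?W x = 0" for x
    using deriv[of x] F'neg[of x] Zn(3)[of x] that by (auto simp: Z_def)
  note W = degree_weighted_poly[OF I p(2), of \<alpha>]
  note * = real_rooted_split[OF nr simple W(2), folded Z_def]
  have cZ: "card Z = card I - 1" using * W(1) by simp
  have "?W \<noteq> 0" using W(2) by auto
  then have Z: "finite Z" by (simp add: Z_def poly_roots_finite)
  have node: "node_poly Z = ?W" using * by (simp add: node_poly_def)
  \<comment> \<open>The values are forced: \<open>a\<close> by the second coefficient, and
    \<open>r z = - 1 / F' z\<close> by the value at the node \<open>z\<close>.\<close>
  define a where "a = sum \<alpha> I - \<Sum>Z"
  define r where "r z = - poly ?P z / poly (node_poly (Z - {z})) z" for z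
  have nd: "poly (node_poly (Z - {z})) z = poly ?P z * F' z" if "z \<in> Z" for z
  proof -
    have "poly (pderiv (node_poly Z)) z = poly (node_poly (Z - {z})) z"
      by (subst node_poly_remove[OF Z that]) (simp add: pderiv_mult pderiv_pCons del: mult_pCons_left)
    then show ?thesis using deriv[OF that] by (simp add: node)
  qed
  have r: "\<forall>z\<in>Z. r z > 0"
  proof
    fix z assume z: "z \<in> Z"
    then show "r z > 0" using Zn(3)[OF z] F'neg[OF z] by (simp add: r_def nd divide_less_0_iff)
  qed
  \<comment> \<open>The two leading coefficients agree, so a nonzero difference would have degree
    below \<open>card Z\<close> and yet vanish on all of \<open>Z\<close>.\<close>
  have "?P - pick_poly Z r a = 0"
  proof (rule ccontr)
    let ?D = "?P - pick_poly Z r a"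
    assume D: "?D \<noteq> 0"
    have cI: "card I = card Z + 1" using cZ I by (simp add: card_gt_0_iff Suc_diff_1)
    have m: "coeff (monom 1 2 * q) (i + 2) = coeff q i" for q :: "real poly" and i
      by (simp add: coeff_monom_mult)
    have cD: "coeff ?D i = 0" if "i \<ge> card Z" for i
    proof -
      consider "i = card Z" | "i = card Z + 1" | "i > card Z + 1" using \<open>i \<ge> card Z\<close> by linarith
      then show ?thesis
      proof cases
        case 1
        then show ?thesis
          using m[of ?P "card Z"] m[of "pick_poly Z r a" "card Z"] coeff_pick_poly(2)[OF Z, of r a]
            coeff_prod_linear(2)[where t = \<alpha>, OF I(1)] cI by (simp add: a_def linear_prod_def)
      next
        case 2
        then show ?thesis
          using degree_pick_poly[OF Z, of r a] degree_prod_linear[OF I(1), of \<alpha>] lead_coeff_prod_linear[of \<alpha> I] cI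
          by (simp add: linear_prod_def)
      next
        case 3
        then show ?thesis
          using degree_pick_poly[OF Z, of r a] degree_prod_linear[OF I(1), of \<alpha>] cI
          by (simp add: linear_prod_def coeff_eq_0)
      qed
    qed
    have "degree ?D < card Z" using cD[of "degree ?D"] D by (metis leading_coeff_0_iff not_less)
    moreover have "Z \<subseteq> {x. poly ?D x = 0}"
    proof
      fix z assume z: "z \<in> Z"
      show "z \<in> {x. poly ?D x = 0}"
        using Zn(3)[OF z] F'neg[OF z] by (simp add: poly_pick_poly_node[OF Z z] r_def nd[OF z])
    qed
    ultimately show False
      using card_poly_roots_bound[OF D] card_mono[OF poly_roots_finite[OF D], of Z] by simp
  qed
  then show thesis using that[OF Z r node, of a] by simp
qed

text \<open>Transfers \<open>shift_bound\<close> to indexed eigenvalues. \<open>P * P'\<close>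
  vanishes at the zeros and nodes of the first Pick function and \<open>Q * Q'\<close> at those of
  the second, so \<open>generic\<close> contains all disjointness conditions of
  \<open>generic_pair\<close>.\<close>

lemma shift_bound_distinct:
  fixes \<alpha> \<beta> p q :: "nat \<Rightarrow> real"
  assumes mn: "m \<ge> 1" "n \<ge> 1"
    and inj: "inj_on \<alpha> {..<m}" "inj_on \<beta> {..<n}"
    and p: "\<forall>i<m. p i > 0" "sum p {..<m} = 1" and q: "\<forall>j<n. q j > 0" "sum q {..<n} = 1"
    and eps: "\<epsilon> > 0" and gap: "\<And>i j. i < m \<Longrightarrow> j < n \<Longrightarrow> \<eta> \<le> \<bar>\<alpha> i - \<beta> j\<bar>"
  defines "P \<equiv> linear_prod {..<m} \<alpha>" and "Q \<equiv> linear_prod {..<n} \<beta>"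
    and "P' \<equiv> weighted_poly {..<m} \<alpha> p" and "Q' \<equiv> weighted_poly {..<n} \<beta> q"
    and "\<gamma> \<equiv> \<lambda>k. if k < m then \<alpha> k else \<beta> (k - m)"
  assumes generic: "\<And>x. \<not> (poly (P * P') x = 0 \<and> poly (Q * Q') x = 0)"
  shows "\<exists>\<mu>. linear_prod {..<m + n} \<mu> = P * Q - smult (\<epsilon>\<^sup>2) (P' * Q')
    \<and> (\<Sum>k<m + n. \<mu> k - \<gamma> k) = 0
    \<and> (\<Sum>k<m + n. max 0 (\<mu> k - \<gamma> k))\<^sup>2 + \<eta> * (\<Sum>k<m + n. max 0 (\<mu> k - \<gamma> k)) \<le> \<epsilon>\<^sup>2"
proof -
  obtain Z1 r1 a1 where 1: "finite Z1" "\<forall>z\<in>Z1. r1 z > 0" "node_poly Z1 = P'" "pick_poly Z1 r1 a1 = P"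
    unfolding P_def P'_def by (rule poles_to_nodes[of "{..<m}" \<alpha> p]) (use mn inj p in auto)
  obtain Z2 r2 a2 where 2: "finite Z2" "\<forall>z\<in>Z2. r2 z > 0" "node_poly Z2 = Q'" "pick_poly Z2 r2 a2 = Q"
    unfolding Q_def Q'_def by (rule poles_to_nodes[of "{..<n}" \<beta> q]) (use mn inj q in auto)
  have z1: "x \<in> Z1 \<longleftrightarrow> poly P' x = 0" for x using 1 by (auto simp: 1(3)[symmetric] poly_node_poly)
  have z2: "x \<in> Z2 \<longleftrightarrow> poly Q' x = 0" for x using 2 by (auto simp: 2(3)[symmetric] poly_node_poly)
  have pz1: "pick_zeros Z1 r1 a1 = \<alpha> ` {..<m}" by (auto simp: pick_zeros_def 1(4) P_def poly_linear_prod)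
  have pz2: "pick_zeros Z2 r2 a2 = \<beta> ` {..<n}" by (auto simp: pick_zeros_def 2(4) Q_def poly_linear_prod)
  have pz: "x \<in> pick_zeros Z1 r1 a1 \<longleftrightarrow> poly P x = 0" "x \<in> pick_zeros Z2 r2 a2 \<longleftrightarrow> poly Q x = 0" for x
    by (auto simp: pick_zeros_def 1(4) 2(4))
  interpret G: generic_pair Z1 Z2 r1 r2 a1 a2 \<epsilon>
  proof
    have "\<not> (x \<in> pick_zeros Z1 r1 a1 \<union> Z1 \<and> x \<in> pick_zeros Z2 r2 a2 \<union> Z2)" for x
      using generic[of x] unfolding Un_iff pz z1 z2 by auto
    then show "Z1 \<inter> Z2 = {}" "pick_zeros Z1 r1 a1 \<inter> Z2 = {}" "Z1 \<inter> pick_zeros Z2 r2 a2 = {}"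
      "pick_zeros Z1 r1 a1 \<inter> pick_zeros Z2 r2 a2 = {}" by blast+
  qed (use 1 2 eps in auto)
  have disj: "\<alpha> i \<noteq> \<beta> j" if "i < m" "j < n" for i j
    using G.zz that unfolding pz1 pz2 by auto
  have bij: "bij_betw \<gamma> {..<m + n} (pick_zeros Z1 r1 a1 \<union> pick_zeros Z2 r2 a2)"
  proof (rule bij_betw_imageI)
    show "inj_on \<gamma> {..<m + n}"
    proof (rule inj_onI)
      fix x y assume xy: "x \<in> {..<m + n}" "y \<in> {..<m + n}" "\<gamma> x = \<gamma> y"
      show "x = y"
      proof (cases "x < m"; cases "y < m")
        assume "x < m" "y < m"
        then show ?thesis using xy inj_onD[OF inj(1), of x y] by (simp add: \<gamma>_def)
      next
        assume "x < m" "\<not> y < m"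
        moreover from this have "y - m < n" using xy by auto
        ultimately show ?thesis using xy disj[of x "y - m"] by (simp add: \<gamma>_def)
      next
        assume "\<not> x < m" "y < m"
        moreover from this have "x - m < n" using xy by auto
        ultimately show ?thesis using xy disj[of y "x - m"] by (simp add: \<gamma>_def)
      next
        assume "\<not> x < m" "\<not> y < m"
        moreover from this have "x - m < n" "y - m < n" using xy by auto
        ultimately show ?thesis using xy inj_onD[OF inj(2), of "x - m" "y - m"] by (simp add: \<gamma>_def)
      qed
    qed
    have "\<gamma> ` {..<m + n} = \<gamma> ` {..<m} \<union> \<gamma> ` {m..<m + n}" by (auto simp: image_Un[symmetric] ivl_disj_un)
    also have "\<gamma> ` {..<m} = \<alpha> ` {..<m}" by (auto simp: \<gamma>_def)
    also have "\<gamma> ` {m..<m + n} = \<beta> ` {..<n}"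
    proof -
      have "{m..<m + n} = (+) m ` {..<n}" by (simp add: lessThan_atLeast0 add.commute)
      then show ?thesis by (simp only: image_image) (simp add: \<gamma>_def)
    qed
    finally show "\<gamma> ` {..<m + n} = pick_zeros Z1 r1 a1 \<union> pick_zeros Z2 r2 a2" by (simp add: pz1 pz2)
  qed
  \<comment> \<open>The map \<open>G.\<gamma>\<close> leads from eigenvalues back to poles, so its
    inverse gives the eigenvalue to which the pole \<open>\<gamma> k\<close> moves.\<close>
  define \<mu> where "\<mu> k = inv_into G.\<Lambda> G.\<gamma> (\<gamma> k)" for k
  have bm: "bij_betw \<mu> {..<m + n} G.\<Lambda>"
    using bij_betw_trans[OF bij bij_betw_inv_into[OF G.gamma_bij]] by (simp add: comp_def \<mu>_def[abs_def])
  have g: "G.\<gamma> (\<mu> k) = \<gamma> k" if "k < m + n" for k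
  proof -
    have "\<gamma> k \<in> G.\<gamma> ` G.\<Lambda>" using that bij_betwE[OF bij] bij_betw_imp_surj_on[OF G.gamma_bij] by auto
    then show ?thesis unfolding \<mu>_def by (rule f_inv_into_f)
  qed
  have sum_eq: "(\<Sum>x\<in>G.\<Lambda>. h x (G.\<gamma> x)) = (\<Sum>k<m + n. h (\<mu> k) (\<gamma> k))" for h :: "real \<Rightarrow> real \<Rightarrow> real"
    using sum.reindex_bij_betw[OF bm, of "\<lambda>x. h x (G.\<gamma> x)"] g by simp
  have "linear_prod {..<m + n} \<mu> = G.\<chi>"
    unfolding linear_prod_def G.prod_Lambda[symmetric] by (rule prod.reindex_bij_betw[OF bm])
  moreover have gap': "\<eta> \<le> \<bar>u - v\<bar>" if "u \<in> pick_zeros Z1 r1 a1" "v \<in> pick_zeros Z2 r2 a2" for u v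
    using gap that by (auto simp: pz1 pz2)
  ultimately show ?thesis
    using G.shift_bound[OF gap'] sum_eq[of "\<lambda>x y. x - y"] sum_eq[of "\<lambda>x y. max 0 (x - y)"]
    by (intro exI[of _ \<mu>]) (auto simp: G.\<chi>_def 1 2)
qed


text \<open>Bolzano-Weierstrass one coordinate at a time: a bounded sequence has a monotone, hence
  convergent, subsequence, and thinning out keeps the earlier coordinates convergent.\<close>

lemma Bseq_common_subsequence:
  fixes x :: "nat \<Rightarrow> nat \<Rightarrow> real"
  assumes "\<And>k. k < N \<Longrightarrow> Bseq (\<lambda>l. x l k)"
  shows "\<exists>\<phi>. strict_mono \<phi> \<and> (\<forall>k<N. convergent (\<lambda>l. x (\<phi> l) k))"
  using assms
proof (induction N)
  case 0
  then show ?case by (intro exI[of _ "\<lambda>l. l"]) (auto simp: strict_mono_def)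
next
  case (Suc N)
  then obtain \<phi> where \<phi>: "strict_mono \<phi>" "\<forall>k<N. convergent (\<lambda>l. x (\<phi> l) k)" by auto
  obtain \<psi> :: "nat \<Rightarrow> nat" where \<psi>: "strict_mono \<psi>" "monoseq (\<lambda>l. x (\<phi> (\<psi> l)) N)"
    using seq_monosub[of "\<lambda>l. x (\<phi> l) N"] by blast
  have "Bseq (\<lambda>l. x (\<phi> (\<psi> l)) N)"
    using Suc.prems[of N] Bseq_subseq[of "\<lambda>l. x l N" "\<phi> \<circ> \<psi>"] by simp
  then have "convergent (\<lambda>l. x (\<phi> (\<psi> l)) N)" using \<psi>(2) by (rule Bseq_monoseq_convergent)
  moreover have "convergent (\<lambda>l. x (\<phi> (\<psi> l)) k)" if "k < N" for k
    using convergent_subseq_convergent[OF \<phi>(2)[rule_format, OF that] \<psi>(1)] by (simp add: comp_def)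
  ultimately show ?case
    using strict_mono_o[OF \<phi>(1) \<psi>(1)]
    by (intro exI[of _ "\<phi> \<circ> \<psi>"]) (auto simp: less_Suc_eq comp_def)
qed

text \<open>Shifting \<open>\<alpha>\<^sub>i\<close> by \<open>\<delta> i\<close> makes the \<open>\<alpha>\<^sub>i\<close> distinct for all but finitely many \<open>\<delta>\<close>.\<close>

lemma finite_collisions:
  fixes \<alpha> :: "nat \<Rightarrow> real"
  shows "finite {\<delta>. \<not> inj_on (\<lambda>i. \<alpha> i + \<delta> * real i) {..<m}}"
proof (rule finite_subset)
  show "{\<delta>. \<not> inj_on (\<lambda>i. \<alpha> i + \<delta> * real i) {..<m}}
    \<subseteq> (\<lambda>(i, j). (\<alpha> j - \<alpha> i) / (real i - real j)) ` ({..<m} \<times> {..<m})"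
  proof
    fix \<delta> assume "\<delta> \<in> {\<delta>. \<not> inj_on (\<lambda>i. \<alpha> i + \<delta> * real i) {..<m}}"
    then obtain i j where ij: "i < m" "j < m" "i \<noteq> j" "\<alpha> i + \<delta> * real i = \<alpha> j + \<delta> * real j"
      by (auto simp: inj_on_def)
    then have "\<delta> = (\<alpha> j - \<alpha> i) / (real i - real j)" by (simp add: field_simps)
    then show "\<delta> \<in> (\<lambda>(i, j). (\<alpha> j - \<alpha> i) / (real i - real j)) ` ({..<m} \<times> {..<m})"
      using ij by auto
  qed
qed simp

lemma exists_small_avoiding:
  assumes "finite B" "e > (0::real)"
  obtains d where "0 < d" "d < e" "d \<notin> B"
proof -
  have "infinite ({0<..<e} - B)" using assms by (simp add: Diff_infinite_finite infinite_Ioo)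
  then obtain d where "d \<in> {0<..<e} - B" by (metis ex_in_conv finite.emptyI)
  then show thesis using that by auto
qed

lemma poly_linear_prod_shift:
  "poly (linear_prod I (\<lambda>i. \<alpha> i + t)) x = poly (linear_prod I \<alpha>) (x - t)"
  "poly (weighted_poly I (\<lambda>i. \<alpha> i + t) p) x = poly (weighted_poly I \<alpha> p) (x - t)"
  by (simp_all add: poly_linear_prod poly_weighted_poly algebra_simps)

text \<open>Perturbation and limit: \<open>d\<close> separates coinciding eigenvalues and makes the
  weights positive, a translation of the \<open>\<beta> j\<close> by \<open>t\<close> removes common
  zeros and nodes, and both parameters tend to 0.\<close>

theorem shift_bound_general:
  fixes \<alpha> \<beta> p q :: "nat \<Rightarrow> real"
  assumes mn: "m \<ge> 1" "n \<ge> 1"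
    and p: "\<forall>i<m. p i \<ge> 0" "sum p {..<m} = 1" and q: "\<forall>j<n. q j \<ge> 0" "sum q {..<n} = 1"
    and eps: "\<epsilon> > 0" and gap: "\<And>i j. i < m \<Longrightarrow> j < n \<Longrightarrow> \<eta> \<le> \<bar>\<alpha> i - \<beta> j\<bar>"
  defines "\<gamma> \<equiv> \<lambda>k. if k < m then \<alpha> k else \<beta> (k - m)"
  shows "\<exists>\<mu>. linear_prod {..<m + n} \<mu> = linear_prod {..<m} \<alpha> * linear_prod {..<n} \<beta>
      - smult (\<epsilon>\<^sup>2) (weighted_poly {..<m} \<alpha> p * weighted_poly {..<n} \<beta> q)
    \<and> (\<Sum>k<m + n. \<mu> k - \<gamma> k) = 0
    \<and> (\<Sum>k<m + n. max 0 (\<mu> k - \<gamma> k))\<^sup>2 + \<eta> * (\<Sum>k<m + n. max 0 (\<mu> k - \<gamma> k)) \<le> \<epsilon>\<^sup>2"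
proof -
  define A where "A (d::real) = (\<lambda>i. \<alpha> i + d * real i)" for d
  define B where "B (d::real) (t::real) = (\<lambda>j. \<beta> j + d * real j + t)" for d t
  define wt :: "nat \<Rightarrow> real \<Rightarrow> (nat \<Rightarrow> real) \<Rightarrow> nat \<Rightarrow> real"
    where "wt N d p = (\<lambda>i. (p i + d) / (1 + real N * d))" for N d p
  define C where "C d t = (\<lambda>k. if k < m then A d k else B d t (k - m))" for d t
  define S where "S d t \<mu> = (\<Sum>k<m + n. max 0 (\<mu> k - C d t k))" for d t \<mu>
  define X where "X d t = linear_prod {..<m} (A d) * linear_prod {..<n} (B d t)
      - smult (\<epsilon>\<^sup>2) (weighted_poly {..<m} (A d) (wt m d p) * weighted_poly {..<n} (B d t) (wt n d q))" for d t
  \<comment> \<open>The perturbation changes each distance between the two spectra by at most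
    \<open>(m + n) * d + t\<close>, by which the separation is reduced.\<close>
  define Pr where "Pr d t \<mu> \<longleftrightarrow> linear_prod {..<m + n} \<mu> = X d t
    \<and> (\<Sum>k<m + n. \<mu> k - C d t k) = 0
    \<and> (S d t \<mu>)\<^sup>2 + (\<eta> - real (m + n) * d - t) * S d t \<mu> \<le> \<epsilon>\<^sup>2" for d t \<mu>
  have wt: "\<forall>i<N. wt N d p i > 0" "sum (wt N d p) {..<N} = 1"
    if "\<forall>i<N. p i \<ge> 0" "sum p {..<N} = 1" "d > 0" for N d p
  proof -
    have "1 + real N * d > 0" using that by (intro add_pos_nonneg) auto
    moreover have "(\<Sum>i<N. p i + d) = 1 + real N * d" using that by (simp add: sum.distrib)
    ultimately show "\<forall>i<N. wt N d p i > 0" "sum (wt N d p) {..<N} = 1"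
      unfolding wt_def sum_divide_distrib[symmetric] using that by (auto simp: add_nonneg_pos)
  qed
  have ex: "\<exists>d t \<mu>. 0 < d \<and> d < e \<and> 0 < t \<and> t < e \<and> Pr d t \<mu>" if e: "e > 0" for e :: real
  proof -
    obtain d where d: "0 < d" "d < e" and inj: "inj_on (A d) {..<m}" "inj_on (\<lambda>i. \<beta> i + d * real i) {..<n}"
      using exists_small_avoiding[OF finite_UnI[OF finite_collisions[of \<alpha> m] finite_collisions[of \<beta> n]] e]
      unfolding A_def by blast
    let ?F = "linear_prod {..<m} (A d) * weighted_poly {..<m} (A d) (wt m d p)"
    let ?G = "linear_prod {..<n} (\<lambda>j. \<beta> j + d * real j) * weighted_poly {..<n} (\<lambda>j. \<beta> j + d * real j) (wt n d q)"
    have nz: "linear_prod {..<N} a * weighted_poly {..<N} a (wt N d w) \<noteq> 0"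
      if "N \<ge> 1" "\<forall>i<N. w i \<ge> 0" "sum w {..<N} = 1" for N a w
    proof -
      have "lead_coeff (linear_prod {..<N} a) = 1" by (simp add: linear_prod_def lead_coeff_prod_linear del: lead_coeff_prod)
      moreover have "lead_coeff (weighted_poly {..<N} a (wt N d w)) = 1"
        by (rule degree_weighted_poly) (use that wt(2)[OF that(2,3) d(1)] in auto)
      ultimately show ?thesis by auto
    qed
    have "finite {x. poly ?F x = 0}" "finite {x. poly ?G x = 0}"
      using nz[OF mn(1) p] nz[OF mn(2) q] poly_roots_finite by blast+
    then have "finite ((\<lambda>(x, y). x - y) ` ({x. poly ?F x = 0} \<times> {x. poly ?G x = 0}))" by blast
    then obtain t where t: "0 < t" "t < e" "t \<notin> (\<lambda>(x, y). x - y) ` ({x. poly ?F x = 0} \<times> {x. poly ?G x = 0})"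
      using e by (rule exists_small_avoiding)
    have "\<exists>\<mu>. Pr d t \<mu>"
      unfolding Pr_def X_def S_def C_def
    proof (rule shift_bound_distinct[OF mn inj(1)])
      show "inj_on (B d t) {..<n}" using inj(2) by (auto simp: B_def inj_on_def)
      show "\<forall>i<m. wt m d p i > 0" "sum (wt m d p) {..<m} = 1" by (rule wt[OF p d(1)])+
      show "\<forall>j<n. wt n d q j > 0" "sum (wt n d q) {..<n} = 1" by (rule wt[OF q d(1)])+
      show "\<eta> - real (m + n) * d - t \<le> \<bar>A d i - B d t j\<bar>" if "i < m" "j < n" for i j
      proof -
        have "d * real i \<le> m * d" "d * real j \<le> n * d" "0 \<le> d * real i" "0 \<le> d * real j" using that d by auto
        moreover have "\<eta> \<le> \<bar>\<alpha> i - \<beta> j\<bar>" by (rule gap[OF that])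
        ultimately show ?thesis using t(1) unfolding A_def B_def of_nat_add ring_distribs by linarith
      qed
      fix x
      show "\<not> (poly ?F x = 0 \<and> poly (linear_prod {..<n} (B d t) * weighted_poly {..<n} (B d t) (wt n d q)) x = 0)"
      proof
        assume "poly ?F x = 0 \<and> poly (linear_prod {..<n} (B d t) * weighted_poly {..<n} (B d t) (wt n d q)) x = 0"
        then have "poly ?F x = 0" "poly ?G (x - t) = 0"
          unfolding B_def poly_mult poly_linear_prod_shift by simp_all
        then have "(x, x - t) \<in> {x. poly ?F x = 0} \<times> {x. poly ?G x = 0}" by blast
        then have "t \<in> (\<lambda>(x, y). x - y) ` ({x. poly ?F x = 0} \<times> {x. poly ?G x = 0})" by force
        then show False using t(3) by simp
      qed
    qed (rule eps)
    then show ?thesis using d t by blast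
  qed
  have "\<forall>l. \<exists>d t \<mu>. 0 < d \<and> d < inverse (real (Suc l)) \<and> 0 < t \<and> t < inverse (real (Suc l)) \<and> Pr d t \<mu>"
    using ex by simp
  then obtain d t M where d: "\<And>l. 0 < d l" "\<And>l. d l < inverse (real (Suc l))"
    and t: "\<And>l. 0 < t l" "\<And>l. t l < inverse (real (Suc l))" and M: "\<And>l. Pr (d l) (t l) (M l)"
    by metis
  have d0: "d \<longlonglongrightarrow> 0"
    by (rule tendsto_sandwich[OF _ _ tendsto_const LIMSEQ_inverse_real_of_nat]) (use d in \<open>auto intro!: always_eventually less_imp_le simp del: of_nat_Suc\<close>)
  have t0: "t \<longlonglongrightarrow> 0"
    by (rule tendsto_sandwich[OF _ _ tendsto_const LIMSEQ_inverse_real_of_nat]) (use t in \<open>auto intro!: always_eventually less_imp_le simp del: of_nat_Suc\<close>)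
  have A0: "(\<lambda>l. A (d l) i) \<longlonglongrightarrow> \<alpha> i" for i
    unfolding A_def using tendsto_add[OF tendsto_const[of "\<alpha> i"] tendsto_mult[OF d0 tendsto_const[of "real i"]]] by simp
  have B0: "(\<lambda>l. B (d l) (t l) i) \<longlonglongrightarrow> \<beta> i" for i
    unfolding B_def
    using tendsto_add[OF tendsto_add[OF tendsto_const[of "\<beta> i"] tendsto_mult[OF d0 tendsto_const[of "real i"]]] t0] by simp
  have C0: "(\<lambda>l. C (d l) (t l) k) \<longlonglongrightarrow> \<gamma> k" for k
    using A0 B0 by (cases "k < m") (simp_all add: C_def \<gamma>_def)
  define \<eta>' where "\<eta>' l = \<eta> - real (m + n) * d l - t l" for l
  have \<eta>': "\<eta>' \<longlonglongrightarrow> \<eta>"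
    using tendsto_diff[OF tendsto_diff[OF tendsto_const tendsto_mult[OF tendsto_const d0]] t0, of \<eta> "real (m + n)"]
    unfolding \<eta>'_def[abs_def] by simp
  have "Bseq \<eta>'" using \<eta>' convergent_imp_Bseq convergentI by blast
  then obtain K where K: "K > 0" "\<And>l. \<bar>\<eta>' l\<bar> \<le> K" by (auto elim: BseqE)
  \<comment> \<open>The quadratic inequality bounds the total upward shift; by the zero sum the
    downward shift has the same bound. So the approximating eigenvalues stay bounded.\<close>
  have dev: "\<bar>M l k - C (d l) (t l) k\<bar> \<le> K + \<epsilon>" if "k < m + n" for l k
  proof -
    let ?c = "C (d l) (t l)" and ?s = "S (d l) (t l) (M l)"
    have s0: "?s \<ge> 0" unfolding S_def by (intro sum_nonneg) simp
    have "?s \<le> K + \<epsilon>"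
    proof (rule ccontr)
      assume "\<not> ?s \<le> K + \<epsilon>"
      then have "(K + \<epsilon>) * \<epsilon> < ?s * (?s - K)" using eps K by (intro mult_strict_mono) auto
      moreover have "\<epsilon>\<^sup>2 \<le> (K + \<epsilon>) * \<epsilon>" using eps K by (simp add: power2_eq_square)
      moreover have "?s * (?s - K) \<le> ?s * (?s + \<eta>' l)" using K(2)[of l] s0 by (intro mult_left_mono) auto
      moreover have "?s * (?s + \<eta>' l) \<le> \<epsilon>\<^sup>2"
        using M[of l] by (simp add: Pr_def \<eta>'_def power2_eq_square algebra_simps)
      ultimately show False by linarith
    qed
    moreover have "max 0 (M l k - ?c k) \<le> ?s"
      unfolding S_def using that by (intro member_le_sum) auto
    moreover have "max 0 (?c k - M l k) \<le> (\<Sum>k<m + n. max 0 (?c k - M l k))"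
      using that by (intro member_le_sum) auto
    moreover have "(\<Sum>k<m + n. max 0 (?c k - M l k)) = ?s"
    proof -
      have "?s - (\<Sum>k<m + n. max 0 (?c k - M l k)) = (\<Sum>k<m + n. M l k - ?c k)"
        unfolding S_def sum_subtractf[symmetric] by (intro sum.cong) auto
      then show ?thesis using M[of l] by (simp add: Pr_def)
    qed
    ultimately show ?thesis by linarith
  qed
  have "Bseq (\<lambda>l. M l k)" if "k < m + n" for k
  proof -
    have "Bseq (\<lambda>l. C (d l) (t l) k)" using C0 convergent_imp_Bseq convergentI by blast
    then obtain c where "\<And>l. \<bar>C (d l) (t l) k\<bar> \<le> c" unfolding Bseq_def real_norm_def by blast
    then have "\<bar>C (d l) (t l) k\<bar> + \<bar>M l k - C (d l) (t l) k\<bar> \<le> c + (K + \<epsilon>)" for l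
      by (intro add_mono dev[OF that])
    then have "norm (M l k) \<le> c + (K + \<epsilon>)" for l
      using abs_triangle_ineq[of "C (d l) (t l) k" "M l k - C (d l) (t l) k"] order_trans by fastforce
    then show ?thesis by (rule BseqI')
  qed
  from Bseq_common_subsequence[of "m + n" M, OF this] obtain \<phi>
    where \<phi>: "strict_mono \<phi>" "\<forall>k<m + n. convergent (\<lambda>l. M (\<phi> l) k)" by blast
  define \<mu> where "\<mu> k = lim (\<lambda>l. M (\<phi> l) k)" for k
  have \<mu>: "(\<lambda>l. M (\<phi> l) k) \<longlonglongrightarrow> \<mu> k" if "k < m + n" for k
    using \<phi>(2) that by (simp add: \<mu>_def convergent_LIMSEQ_iff)
  note sub = LIMSEQ_subseq_LIMSEQ[OF _ \<phi>(1), unfolded comp_def]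
  have C1: "(\<lambda>l. C (d (\<phi> l)) (t (\<phi> l)) k) \<longlonglongrightarrow> \<gamma> k" for k using sub[OF C0] .
  have S1: "(\<lambda>l. S (d (\<phi> l)) (t (\<phi> l)) (M (\<phi> l))) \<longlonglongrightarrow> (\<Sum>k<m + n. max 0 (\<mu> k - \<gamma> k))"
    unfolding S_def by (intro tendsto_sum tendsto_max tendsto_const tendsto_diff \<mu> C1) auto
  have "(\<Sum>k<m + n. max 0 (\<mu> k - \<gamma> k))\<^sup>2 + \<eta> * (\<Sum>k<m + n. max 0 (\<mu> k - \<gamma> k)) \<le> \<epsilon>\<^sup>2"
  proof (rule LIMSEQ_le_const2)
    show "(\<lambda>l. (S (d (\<phi> l)) (t (\<phi> l)) (M (\<phi> l)))\<^sup>2 + \<eta>' (\<phi> l) * S (d (\<phi> l)) (t (\<phi> l)) (M (\<phi> l)))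
      \<longlonglongrightarrow> (\<Sum>k<m + n. max 0 (\<mu> k - \<gamma> k))\<^sup>2 + \<eta> * (\<Sum>k<m + n. max 0 (\<mu> k - \<gamma> k))"
      by (intro tendsto_add tendsto_power tendsto_mult S1 sub[OF \<eta>'])
  qed (use M in \<open>auto simp: Pr_def \<eta>'_def\<close>)
  moreover have "(\<Sum>k<m + n. \<mu> k - \<gamma> k) = 0"
  proof (rule LIMSEQ_unique)
    show "(\<lambda>l. \<Sum>k<m + n. M (\<phi> l) k - C (d (\<phi> l)) (t (\<phi> l)) k) \<longlonglongrightarrow> (\<Sum>k<m + n. \<mu> k - \<gamma> k)"
      by (intro tendsto_sum tendsto_diff \<mu> C1) auto
    show "(\<lambda>l. \<Sum>k<m + n. M (\<phi> l) k - C (d (\<phi> l)) (t (\<phi> l)) k) \<longlonglongrightarrow> 0"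
      using M by (simp add: Pr_def)
  qed
  moreover have "linear_prod {..<m + n} \<mu> = linear_prod {..<m} \<alpha> * linear_prod {..<n} \<beta>
      - smult (\<epsilon>\<^sup>2) (weighted_poly {..<m} \<alpha> p * weighted_poly {..<n} \<beta> q)" (is "_ = ?X")
  proof -
    have "poly (linear_prod {..<m + n} \<mu>) x = poly ?X x" for x
    proof (rule LIMSEQ_unique)
      show "(\<lambda>l. poly (linear_prod {..<m + n} (M (\<phi> l))) x) \<longlonglongrightarrow> poly (linear_prod {..<m + n} \<mu>) x"
        unfolding poly_linear_prod by (intro tendsto_prod tendsto_diff tendsto_const \<mu>) auto
      have wl: "(\<lambda>l. wt N (d (\<phi> l)) w i) \<longlonglongrightarrow> w i" for N w i
      proof -
        have "(\<lambda>l. wt N (d (\<phi> l)) w i) \<longlonglongrightarrow> (w i + 0) / (1 + real N * 0)"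
          unfolding wt_def by (intro tendsto_intros sub[OF d0]) simp
        then show ?thesis by simp
      qed
      have "(\<lambda>l. poly (X (d (\<phi> l)) (t (\<phi> l))) x) \<longlonglongrightarrow> poly ?X x"
        unfolding X_def poly_diff poly_mult poly_smult poly_linear_prod poly_weighted_poly
        by (intro tendsto_diff tendsto_mult tendsto_prod tendsto_sum tendsto_const wl sub[OF A0] sub[OF B0])
      moreover have "X (d (\<phi> l)) (t (\<phi> l)) = linear_prod {..<m + n} (M (\<phi> l))" for l
        using M by (simp add: Pr_def)
      ultimately show "(\<lambda>l. poly (linear_prod {..<m + n} (M (\<phi> l))) x) \<longlonglongrightarrow> poly ?X x" by simp
    qed
    then show ?thesis by (simp add: poly_eq_poly_eq_iff[symmetric] fun_eq_iff)
  qed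
  ultimately show ?thesis by blast
qed

section \<open>Sorted eigenvalues and norms of diagonal matrices\<close>

text \<open>By counting: with \<open>t = sort ys ! i\<close>, failure would leave at most
  \<open>i\<close> entries of \<open>xs\<close> below or at \<open>t\<close>, but \<open>ys\<close>
  has at least \<open>i + 1\<close> of them, and the matching entries of \<open>xs\<close> are no
  larger.\<close>

lemma sort_mono:
  fixes xs ys :: "real list"
  assumes len: "length xs = length ys" and le: "\<And>i. i < length xs \<Longrightarrow> xs ! i \<le> ys ! i"
    and i: "i < length xs"
  shows "sort xs ! i \<le> sort ys ! i"
proof (rule ccontr)
  assume neg: "\<not> sort xs ! i \<le> sort ys ! i"
  define t where "t = sort ys ! i"
  have cnt: "card {k. k < length (sort zs) \<and> sort zs ! k \<le> t} = card {k. k < length zs \<and> zs ! k \<le> t}" for zs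
  proof -
    have "size (filter_mset (\<lambda>u. u \<le> t) (mset (sort zs))) = size (filter_mset (\<lambda>u. u \<le> t) (mset zs))" by simp
    then show ?thesis unfolding mset_filter[symmetric] size_mset length_filter_conv_card .
  qed
  have "{k. k < length (sort xs) \<and> sort xs ! k \<le> t} \<subseteq> {..<i}"
  proof
    fix k assume k: "k \<in> {k. k < length (sort xs) \<and> sort xs ! k \<le> t}"
    show "k \<in> {..<i}"
    proof (rule ccontr)
      assume "k \<notin> {..<i}"
      then have "sort xs ! i \<le> sort xs ! k" using k by (intro sorted_nth_mono) auto
      then show False using k neg by (simp add: t_def)
    qed
  qed
  then have "card {k. k < length (sort xs) \<and> sort xs ! k \<le> t} \<le> i"
    using card_mono[of "{..<i}"] by fastforce
  moreover have "{..i} \<subseteq> {k. k < length (sort ys) \<and> sort ys ! k \<le> t}"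
    using i len by (auto simp: t_def intro!: sorted_nth_mono)
  then have "card {..i} \<le> card {k. k < length (sort ys) \<and> sort ys ! k \<le> t}"
    by (intro card_mono) auto
  moreover have "card {k. k < length ys \<and> ys ! k \<le> t} \<le> card {k. k < length xs \<and> xs ! k \<le> t}"
    using len le by (intro card_mono) (auto intro: order_trans)
  ultimately show False unfolding cnt by simp
qed

lemma sum_nth_sort:
  fixes xs :: "real list"
  shows "(\<Sum>i<length xs. sort xs ! i) = (\<Sum>i<length xs. xs ! i)"
proof -
  have "(\<Sum>i<length zs. zs ! i) = sum_list zs" for zs :: "real list"
    by (simp add: sum_list_sum_nth lessThan_atLeast0)
  from this[of "sort xs"] this[of xs] show ?thesis
    by (metis length_sort mset_sort sum_mset_sum_list)
qed

text \<open>Both sorted lists lie below the sorted pointwise maximum, and sorting preserves sums.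
  Hence pairing eigenvalues by rank does not increase the total upward shift.\<close>

lemma sum_max_sort_le:
  fixes f g :: "nat \<Rightarrow> real"
  shows "(\<Sum>i<N. max 0 (sort (map f [0..<N]) ! i - sort (map g [0..<N]) ! i)) \<le> (\<Sum>i<N. max 0 (f i - g i))"
proof -
  let ?s = "\<lambda>f. sort (map f [0..<N])" and ?h = "\<lambda>i. max (f i) (g i)"
  have sum: "(\<Sum>i<N. ?s f ! i) = (\<Sum>i<N. f i)" for f :: "nat \<Rightarrow> real"
    using sum_nth_sort[of "map f [0..<N]"] by simp
  have "max 0 (?s f ! i - ?s g ! i) \<le> ?s ?h ! i - ?s g ! i" if "i < N" for i
  proof -
    have "?s f ! i \<le> ?s ?h ! i" "?s g ! i \<le> ?s ?h ! i" using that by (intro sort_mono; simp)+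
    then show ?thesis by simp
  qed
  then have "(\<Sum>i<N. max 0 (?s f ! i - ?s g ! i)) \<le> (\<Sum>i<N. ?s ?h ! i - ?s g ! i)" by (intro sum_mono) auto
  also have "\<dots> = (\<Sum>i<N. max (f i) (g i) - g i)" unfolding sum_subtractf sum ..
  also have "\<dots> = (\<Sum>i<N. max 0 (f i - g i))" by (intro sum.cong) auto
  finally show ?thesis .
qed

lemma eigvals_decreasing_nth:
  assumes "eig X = image_mset (\<lambda>k. complex_of_real (f k)) (mset_set {..<N})"
  shows "dim_vec (eigvals_decreasing X) = N"
    and "\<And>i. i < N \<Longrightarrow> eigvals_decreasing X $ i = sort (map f [0..<N]) ! (N - 1 - i)"
proof -
  have "image_mset Re (eig X) = mset (map f [0..<N])"
    by (simp add: assms image_mset.compositionality comp_def lessThan_atLeast0)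
  then have e: "eigvals_decreasing X = vec_of_list (rev (sort (map f [0..<N])))"
    unfolding eigvals_decreasing_def by (simp only: sorted_list_of_multiset_mset)
  show "dim_vec (eigvals_decreasing X) = N" by (simp add: e)
  fix i assume "i < N"
  then show "eigvals_decreasing X $ i = sort (map f [0..<N]) ! (N - 1 - i)"
    by (simp add: e vec_of_list_index rev_nth)
qed

lemma eigvals_decreasing_diff:
  assumes A: "eig A = image_mset (\<lambda>k. complex_of_real (f k)) (mset_set {..<N})"
    and B: "eig B = image_mset (\<lambda>k. complex_of_real (g k)) (mset_set {..<N})"
  defines "d \<equiv> eigvals_decreasing A - eigvals_decreasing B"
  shows "dim_vec d = N" "(\<Sum>i<N. d $ i) = (\<Sum>i<N. f i - g i)"
    "(\<Sum>i<N. max 0 (d $ i)) \<le> (\<Sum>i<N. max 0 (f i - g i))"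
proof -
  note A = eigvals_decreasing_nth[OF A] and B = eigvals_decreasing_nth[OF B]
  show dim: "dim_vec d = N" using A B by (simp add: d_def)
  have d: "d $ i = sort (map f [0..<N]) ! (N - 1 - i) - sort (map g [0..<N]) ! (N - 1 - i)" if "i < N" for i
    using A B that by (simp add: d_def)
  have r: "(\<Sum>i<N. h (d $ i)) = (\<Sum>i<N. h (sort (map f [0..<N]) ! i - sort (map g [0..<N]) ! i))"
    for h :: "real \<Rightarrow> real"
    by (subst sum.nat_diff_reindex[symmetric]) (simp add: d)
  show "(\<Sum>i<N. d $ i) = (\<Sum>i<N. f i - g i)"
    using r[of "\<lambda>x. x"] sum_nth_sort[of "map f [0..<N]"] sum_nth_sort[of "map g [0..<N]"]
    by (simp add: sum_subtractf)
  show "(\<Sum>i<N. max 0 (d $ i)) \<le> (\<Sum>i<N. max 0 (f i - g i))"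
    unfolding r using sum_max_sort_le by blast
qed

section \<open>Norms of real diagonal matrices\<close>

abbreviation real_diag :: "nat \<Rightarrow> (nat \<Rightarrow> real) \<Rightarrow> complex mat" where
  "real_diag N g \<equiv> mat_diag N (\<lambda>i. complex_of_real (g i))"

lemma norm_real_diag_sum:
  assumes nrm: "matrix_norm_on N nrm" and "finite K"
  shows "nrm (real_diag N (\<lambda>k. \<Sum>x\<in>K. c x * g x k)) \<le> (\<Sum>x\<in>K. \<bar>c x\<bar> * nrm (real_diag N (g x)))"
  using assms(2)
proof (induction K)
  case empty
  have "real_diag N (\<lambda>k. 0) = 0\<^sub>m N N" by (intro eq_matI) (auto simp: mat_diag_def)
  moreover have "nrm (0\<^sub>m N N) = 0" using nrm by (simp add: matrix_norm_on_def)
  ultimately show ?case by simp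
next
  case (insert x K)
  have "real_diag N (\<lambda>k. \<Sum>y\<in>insert x K. c y * g y k)
    = of_real (c x) \<cdot>\<^sub>m real_diag N (g x) + real_diag N (\<lambda>k. \<Sum>y\<in>K. c y * g y k)"
    using insert.hyps by (intro eq_matI) (auto simp: mat_diag_def)
  also have "nrm \<dots> \<le> nrm (of_real (c x) \<cdot>\<^sub>m real_diag N (g x)) + nrm (real_diag N (\<lambda>k. \<Sum>y\<in>K. c y * g y k))"
  proof -
    have "of_real (c x) \<cdot>\<^sub>m real_diag N (g x) \<in> carrier_mat N N"
      "real_diag N (\<lambda>k. \<Sum>y\<in>K. c y * g y k) \<in> carrier_mat N N"
      by (auto simp: mat_diag_def)
    then show ?thesis using nrm unfolding matrix_norm_on_def by blast
  qed
  also have "nrm (of_real (c x) \<cdot>\<^sub>m real_diag N (g x)) = \<bar>c x\<bar> * nrm (real_diag N (g x))"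
    using nrm by (simp add: matrix_norm_on_def)
  finally show ?case using insert by simp
qed

text \<open>A transport argument: the positive part of \<open>d\<close> is carried to its negative
  part, which writes \<open>d\<close> as a combination of vectors \<open>e_i - e_j\<close> with
  nonnegative weights of total \<open>s\<close>.\<close>

lemma norm_real_diag_le:
  fixes d :: "nat \<Rightarrow> real"
  assumes nrm: "matrix_norm_on N nrm" and d0: "(\<Sum>k<N. d k) = 0"
    and unit: "\<And>i j. i < N \<Longrightarrow> j < N \<Longrightarrow> i \<noteq> j \<Longrightarrow>
      nrm (real_diag N (\<lambda>k. (if k = i then 1 else 0) - (if k = j then 1 else 0))) \<le> \<kappa>"
  shows "nrm (real_diag N d) \<le> (\<Sum>k<N. max 0 (d k)) * \<kappa>"
proof -
  define s where "s = (\<Sum>k<N. max 0 (d k))"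
  let ?u = "\<lambda>(i, j) k. (if k = i then 1 else 0) - (if k = j then 1 else (0::real))"
  have neg: "(\<Sum>k<N. max 0 (- d k)) = s"
  proof -
    have "s - (\<Sum>k<N. max 0 (- d k)) = (\<Sum>k<N. d k)"
      unfolding s_def sum_subtractf[symmetric] by (intro sum.cong) auto
    then show ?thesis using d0 by simp
  qed
  have s0: "s \<ge> 0" unfolding s_def by (intro sum_nonneg) simp
  \<comment> \<open>The product coupling of the positive and the negative part. If
    \<open>s = 0\<close>, division by zero gives zero weights, as it should, since then
    \<open>d\<close> vanishes.\<close>
  define w where "w x = max 0 (d (fst x)) * max 0 (- d (snd x)) / s" for x
  have w: "w x \<ge> 0" for x using s0 by (simp add: w_def)
  let ?K = "{..<N} \<times> {..<N}"
  have dec: "d k = (\<Sum>x\<in>?K. w x * ?u x k)" if k: "k < N" for k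
  proof (cases "s = 0")
    case True
    then have "max 0 (d k) = 0" "max 0 (- d k) = 0"
      using k neg sum_nonneg_eq_0_iff[of "{..<N}" "\<lambda>k. max 0 (d k)"]
        sum_nonneg_eq_0_iff[of "{..<N}" "\<lambda>k. max 0 (- d k)"] by (auto simp: s_def)
    then show ?thesis using True by (simp add: w_def max_def split: if_splits)
  next
    case False
    have "(\<Sum>x\<in>?K. w x * ?u x k)
      = (\<Sum>i<N. \<Sum>j<N. w (i, j) * (if k = i then 1 else 0)) - (\<Sum>i<N. \<Sum>j<N. w (i, j) * (if k = j then 1 else 0))"
      unfolding sum.cartesian_product sum_subtractf[symmetric]
      by (intro sum.cong refl) (auto simp: algebra_simps)
    also have "(\<Sum>i<N. \<Sum>j<N. w (i, j) * (if k = i then 1 else 0)) = (\<Sum>j<N. w (k, j))"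
      by (subst sum.swap) (use k in \<open>simp add: if_distrib sum.delta cong: if_cong\<close>)
    also have "\<dots> = max 0 (d k)"
      using neg False by (simp add: w_def sum_divide_distrib[symmetric] sum_distrib_left[symmetric])
    also have "(\<Sum>i<N. \<Sum>j<N. w (i, j) * (if k = j then 1 else 0)) = (\<Sum>i<N. w (i, k))"
      using k by (simp add: if_distrib sum.delta cong: if_cong)
    also have "\<dots> = max 0 (- d k)"
      using False by (simp add: w_def sum_divide_distrib[symmetric] sum_distrib_right[symmetric] s_def)
    finally show ?thesis by simp
  qed
  have "real_diag N d = real_diag N (\<lambda>k. \<Sum>x\<in>?K. w x * ?u x k)"
    by (intro eq_matI) (auto simp: mat_diag_def dec)
  then have "nrm (real_diag N d) \<le> (\<Sum>x\<in>?K. \<bar>w x\<bar> * nrm (real_diag N (?u x)))"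
    using norm_real_diag_sum[OF nrm, of ?K w ?u] by simp
  also have "\<dots> \<le> (\<Sum>x\<in>?K. w x * \<kappa>)"
  proof (intro sum_mono)
    fix x assume x: "x \<in> ?K"
    show "\<bar>w x\<bar> * nrm (real_diag N (?u x)) \<le> w x * \<kappa>"
    proof (cases "fst x = snd x")
      \<comment> \<open>On the diagonal the weight is zero: an entry of \<open>d\<close> cannot have
        both a positive and a negative part.\<close>
      case True
      then show ?thesis by (simp add: w_def max_def)
    next
      case False
      then have "nrm (real_diag N (?u x)) \<le> \<kappa>" using unit[of "fst x" "snd x"] x by (auto simp: split_beta)
      then show ?thesis using w[of x] by (simp add: mult_left_mono)
    qed
  qed
  also have "\<dots> = s * \<kappa>"
  proof -
    have "sum w ?K = (\<Sum>i<N. \<Sum>j<N. max 0 (d i) * max 0 (- d j)) / s"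
      unfolding sum.cartesian_product w_def sum_divide_distrib by (simp add: split_beta)
    also have "\<dots> = s * s / s" by (simp add: sum_product[symmetric] neg s_def[symmetric])
    also have "\<dots> = s" by simp
    finally show ?thesis by (simp add: sum_distrib_right[symmetric])
  qed
  finally show ?thesis by (simp add: s_def)
qed

section \<open>The spectral theorem for Hermitian matrices\<close>

lemma mat_adjoint_index [simp]:
  fixes A :: "complex mat"
  assumes "i < dim_col A" "j < dim_row A"
  shows "mat_adjoint A $$ (i, j) = cnj (A $$ (j, i))"
  using assms by (simp add: mat_adjoint_def mat_of_rows_def)

lemma mat_adjoint_dim [simp]:
  fixes A :: "complex mat"
  shows "dim_row (mat_adjoint A) = dim_col A" "dim_col (mat_adjoint A) = dim_row A"
  unfolding mat_adjoint_def by simp_all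

lemma mat_adjoint_carrier:
  fixes A :: "complex mat"
  shows "A \<in> carrier_mat n m \<Longrightarrow> mat_adjoint A \<in> carrier_mat m n"
  by (intro carrier_matI) (auto dest: carrier_matD)

lemma mat_adjoint_adjoint [simp]: "mat_adjoint (mat_adjoint A) = (A :: complex mat)"
  by (intro eq_matI) auto

lemma mat_adjoint_mult:
  fixes A B :: "complex mat"
  assumes "A \<in> carrier_mat n m" "B \<in> carrier_mat m k"
  shows "mat_adjoint (A * B) = mat_adjoint B * mat_adjoint A"
  using assms by (intro eq_matI) (auto simp: scalar_prod_def mult.commute)

lemma mat_adjoint_one [simp]: "mat_adjoint (1\<^sub>m n) = (1\<^sub>m n :: complex mat)"
  by (intro eq_matI) auto

lemma unitary_matD:
  assumes "unitary_mat k U"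
  shows "U \<in> carrier_mat k k" "mat_adjoint U \<in> carrier_mat k k"
    "mat_adjoint U * U = 1\<^sub>m k" "U * mat_adjoint U = 1\<^sub>m k"
  using assms by (auto simp: unitary_mat_def mat_adjoint_carrier)

lemma unitary_mat_adjoint: "unitary_mat k U \<Longrightarrow> unitary_mat k (mat_adjoint U)"
  by (auto simp: unitary_mat_def mat_adjoint_carrier)

lemma unitary_matI:
  assumes "U \<in> carrier_mat k k" "mat_adjoint U * U = 1\<^sub>m k"
  shows "unitary_mat k U"
  using assms mat_mult_left_right_inverse[of "mat_adjoint U" k U] by (auto simp: unitary_mat_def mat_adjoint_carrier)

lemma mult_mid_cancel:
  fixes A B C D :: "complex mat"
  assumes "A \<in> carrier_mat n k" "B \<in> carrier_mat k k" "C \<in> carrier_mat k k" "D \<in> carrier_mat k l"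
    "B * C = 1\<^sub>m k"
  shows "A * B * (C * D) = A * D"
proof -
  have "A * B * (C * D) = A * (B * (C * D))" using assms by (intro assoc_mult_mat) auto
  also have "B * (C * D) = B * C * D" using assms by (intro assoc_mult_mat[symmetric]) auto
  finally show ?thesis using assms by simp
qed

lemma unitary_mat_mult:
  assumes "unitary_mat k U" "unitary_mat k W"
  shows "unitary_mat k (U * W)"
proof (rule unitary_matI)
  note U = unitary_matD[OF assms(1)] and W = unitary_matD[OF assms(2)]
  show "U * W \<in> carrier_mat k k" using U W by simp
  show "mat_adjoint (U * W) * (U * W) = 1\<^sub>m k"
    using mult_mid_cancel[OF W(2) U(2) U(1) W(1) U(3)] W by (simp add: mat_adjoint_mult[OF U(1) W(1)])
qed

lemma mat_adjoint_four_block: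
  fixes A B C D :: "complex mat"
  assumes "A \<in> carrier_mat n m" "B \<in> carrier_mat n k" "C \<in> carrier_mat l m" "D \<in> carrier_mat l k"
  shows "mat_adjoint (four_block_mat A B C D)
    = four_block_mat (mat_adjoint A) (mat_adjoint C) (mat_adjoint B) (mat_adjoint D)"
  using assms by (intro eq_matI) (auto simp: not_less)

lemma unitary_mat_four_block:
  assumes "unitary_mat m U" "unitary_mat n W"
  shows "unitary_mat (m + n) (four_block_mat U (0\<^sub>m m n) (0\<^sub>m n m) W)"
proof (rule unitary_matI)
  note U = unitary_matD[OF assms(1)] and W = unitary_matD[OF assms(2)]
  show "four_block_mat U (0\<^sub>m m n) (0\<^sub>m n m) W \<in> carrier_mat (m + n) (m + n)" using U W by simp
  have z: "mat_adjoint (0\<^sub>m a b) = (0\<^sub>m b a :: complex mat)" for a b by (intro eq_matI) auto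
  show "mat_adjoint (four_block_mat U (0\<^sub>m m n) (0\<^sub>m n m) W) * four_block_mat U (0\<^sub>m m n) (0\<^sub>m n m) W = 1\<^sub>m (m + n)"
    unfolding mat_adjoint_four_block[OF U(1) zero_carrier_mat zero_carrier_mat W(1)] z
    by (subst mult_four_block_mat[of _ m m _ n _ n]) (use U W in auto)
qed

text \<open>\<open>v\<close> is completed to a basis and orthogonalised by Gram-Schmidt, which keeps
  the first vector; normalising the columns produces the factor \<open>c\<close>.\<close>

lemma exists_unitary_first_col:
  fixes v :: "complex vec"
  assumes v: "v \<in> carrier_vec n" "v \<noteq> 0\<^sub>v n"
  obtains U c where "unitary_mat n U" "c \<noteq> 0" "col U 0 = c \<cdot>\<^sub>v v"
proof -
  interpret cof_vec_space n "TYPE(complex)" .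
  have n: "n \<noteq> 0" using v by (intro notI) auto
  define b where "b = basis_completion v"
  define ws where "ws = gram_schmidt n b"
  from basis_completion[OF v, folded b_def]
  have dist_b: "distinct b" and indep: "\<not> lin_dep (set b)" and b: "set b \<subseteq> carrier_vec n"
    and hdb: "hd b = v" and len_b: "length b = n" by auto
  from hdb len_b n obtain vs where bv: "b = v # vs" by (cases b) auto
  from gram_schmidt_result[OF b dist_b indep refl, folded ws_def]
  have ws: "set ws \<subseteq> carrier_vec n" "corthogonal ws" "length ws = n" by (auto simp: len_b)
  have "hd ws = v" using gram_schmidt_hd[OF v(1), of vs] by (simp add: ws_def bv)
  then have ws0: "ws ! 0 = v" using ws(3) n by (cases ws) auto
  define nn where "nn i = sqrt (\<Sum>k<n. (cmod (ws ! i $ k))\<^sup>2)" for i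
  have wsc: "ws ! i \<in> carrier_vec n" if "i < n" for i using ws that by auto
  have self: "ws ! i \<bullet>c ws ! i = of_real ((nn i)\<^sup>2)" if "i < n" for i
  proof -
    have "ws ! i \<bullet>c ws ! i = (\<Sum>k<n. of_real ((cmod (ws ! i $ k))\<^sup>2))"
      using wsc[OF that] by (auto simp: scalar_prod_def lessThan_atLeast0 complex_norm_square[symmetric] intro!: sum.cong)
    then show ?thesis by (simp add: nn_def real_sqrt_pow2 sum_nonneg)
  qed
  have nn0: "nn i \<noteq> 0" if "i < n" for i
    using self[OF that] corthogonalD[OF ws(2), of i i] ws(3) that by auto
  define U where "U = mat n n (\<lambda>(k, i). ws ! i $ k / of_real (nn i))"
  have U: "U \<in> carrier_mat n n" by (simp add: U_def)
  have "mat_adjoint U * U = 1\<^sub>m n"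
  proof (rule eq_matI)
    fix i j assume ij: "i < dim_row (1\<^sub>m n :: complex mat)" "j < dim_col (1\<^sub>m n :: complex mat)"
    then have "(mat_adjoint U * U) $$ (i, j)
      = (\<Sum>k<n. cnj (ws ! i $ k) / of_real (nn i) * (ws ! j $ k / of_real (nn j)))"
      by (simp add: scalar_prod_def U_def lessThan_atLeast0)
    also have "\<dots> = (ws ! j \<bullet>c ws ! i) / of_real (nn i * nn j)"
      using ij carrier_vecD[OF wsc[of i]]
      by (simp add: scalar_prod_def lessThan_atLeast0 sum_divide_distrib mult.commute)
    also have "\<dots> = (if i = j then 1 else 0)"
      using ij self[of i] nn0[of i] corthogonalD[OF ws(2), of j i] ws(3) by (auto simp: power2_eq_square)
    finally show "(mat_adjoint U * U) $$ (i, j) = 1\<^sub>m n $$ (i, j)" using ij by simp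
  qed (simp_all add: U_def)
  then have "unitary_mat n U" using U by (rule unitary_matI[rotated])
  moreover have "col U 0 = (1 / of_real (nn 0)) \<cdot>\<^sub>v v"
    using n v(1) by (intro eq_vecI) (auto simp: U_def ws0)
  moreover have "1 / complex_of_real (nn 0) \<noteq> 0" using nn0[of 0] n by simp
  ultimately show thesis using that by blast
qed

lemma hermitian_conj:
  assumes "hermitian_mat A" "A \<in> carrier_mat n n" "U \<in> carrier_mat n k"
  shows "hermitian_mat (mat_adjoint U * A * U)"
proof -
  note U = mat_adjoint_carrier[OF assms(3)]
  have "mat_adjoint (mat_adjoint U * A * U) = mat_adjoint U * mat_adjoint (mat_adjoint U * A)"
    by (rule mat_adjoint_mult[OF mult_carrier_mat[OF U assms(2)] assms(3)])
  also have "mat_adjoint (mat_adjoint U * A) = A * U"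
    using mat_adjoint_mult[OF U assms(2)] assms(1) by (simp add: hermitian_mat_def)
  also have "mat_adjoint U * (A * U) = mat_adjoint U * A * U"
    by (rule assoc_mult_mat[OF U assms(2,3), symmetric])
  finally show ?thesis by (simp add: hermitian_mat_def)
qed

lemma unitary_conj_back:
  assumes "unitary_mat n U" "A \<in> carrier_mat n n"
  shows "U * (mat_adjoint U * A * U) * mat_adjoint U = A"
proof -
  note U = unitary_matD[OF assms(1)]
  have "U * (mat_adjoint U * A * U) = U * (mat_adjoint U * (A * U))"
    by (simp only: assoc_mult_mat[OF U(2) assms(2) U(1)])
  also have "\<dots> = U * mat_adjoint U * (A * U)"
    by (rule assoc_mult_mat[OF U(1,2) mult_carrier_mat[OF assms(2) U(1)], symmetric])
  also have "\<dots> = A * U" using U assms(2) by simp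
  also have "\<dots> * mat_adjoint U = A * (U * mat_adjoint U)" by (rule assoc_mult_mat[OF assms(2) U(1,2)])
  finally show ?thesis using U assms(2) by simp
qed

lemma char_poly_unitary_conj:
  assumes "unitary_mat n U" "A \<in> carrier_mat n n"
  shows "char_poly (U * A * mat_adjoint U) = char_poly A"
proof (rule char_poly_similar)
  note U = unitary_matD[OF assms(1)]
  show "similar_mat (U * A * mat_adjoint U) A"
    unfolding similar_mat_def
    by (intro exI, rule similar_mat_witI[of U "mat_adjoint U" n]) (use U assms(2) in auto)
qed

lemma conj_conj:
  fixes A B C D E :: "complex mat"
  assumes A: "A \<in> carrier_mat n n" and B: "B \<in> carrier_mat n n" and C: "C \<in> carrier_mat n n"
    and D: "D \<in> carrier_mat n n" and E: "E \<in> carrier_mat n n"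
  shows "A * (B * C * D) * E = (A * B) * C * (D * E)"
proof -
  have "A * (B * C * D) = A * (B * C) * D" by (rule assoc_mult_mat[OF A mult_carrier_mat[OF B C] D, symmetric])
  also have "A * (B * C) = A * B * C" by (rule assoc_mult_mat[OF A B C, symmetric])
  also have "A * B * C * D * E = A * B * C * (D * E)"
    by (rule assoc_mult_mat[OF mult_carrier_mat[OF mult_carrier_mat[OF A B] C] D E])
  finally show ?thesis .
qed

text \<open>Deflation: a unitary matrix whose first column is an eigenvector for \<open>e\<close>
  splits off a 1 by 1 block, and Hermitian symmetry clears the first row. The list \<open>es\<close>
  prescribes the order of the diagonal, so matrices with equal characteristic polynomials get the
  same diagonal form.\<close>

theorem hermitian_spectral:
  fixes A :: "complex mat"
  assumes "A \<in> carrier_mat n n" "hermitian_mat A" "char_poly A = (\<Prod>e\<leftarrow>es. [:-e, 1:])"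
  shows "\<exists>U. unitary_mat n U \<and> A = U * mat_diag n (\<lambda>i. es ! i) * mat_adjoint U"
  using assms
proof (induction es arbitrary: n A)
  case Nil
  then have "n = 0" using degree_monic_char_poly[OF Nil(1)] by simp
  then have "A = 1\<^sub>m n * mat_diag n (\<lambda>i. [] ! i) * mat_adjoint (1\<^sub>m n)" using Nil(1) by (intro eq_matI) auto
  then show ?case by (intro exI[of _ "1\<^sub>m n"]) (simp add: unitary_mat_def)
next
  case (Cons e es)
  note A = Cons.prems(1)
  have cp: "char_poly A = [:-e, 1:] * (\<Prod>e\<leftarrow>es. [:-e, 1:])" using Cons.prems(3) by simp
  have mon: "monic (\<Prod>e\<leftarrow>es. [:-e, 1:])" by (rule monic_prod_list) auto
  have "degree (char_poly A) = Suc (degree (\<Prod>e\<leftarrow>es. [:-e, 1:]))" unfolding cp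
    by (subst degree_mult_eq) (use mon in auto)
  then obtain k where n: "n = Suc k" using degree_monic_char_poly[OF A] by (cases n) auto
  have "eigenvalue A e" unfolding eigenvalue_root_char_poly[OF A] cp by simp
  then obtain v where "eigenvector A v e" unfolding eigenvalue_def by blast
  then have v: "v \<in> carrier_vec n" "v \<noteq> 0\<^sub>v n" "A *\<^sub>v v = e \<cdot>\<^sub>v v" using A by (auto simp: eigenvector_def)
  obtain U c where U: "unitary_mat n U" and c: "c \<noteq> 0" "col U 0 = c \<cdot>\<^sub>v v"
    using exists_unitary_first_col[OF v(1,2)] .
  note Uc = unitary_matD[OF U]
  define B where "B = mat_adjoint U * A * U"
  have B: "B \<in> carrier_mat n n" using A Uc by (simp add: B_def)
  have herm: "hermitian_mat B" unfolding B_def by (rule hermitian_conj[OF Cons.prems(2) A Uc(1)])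
  have cpB: "char_poly B = char_poly A"
    using char_poly_unitary_conj[OF U B] unitary_conj_back[OF U A] by (simp add: B_def)
  have colB: "col B 0 = e \<cdot>\<^sub>v unit_vec n 0"
  proof -
    have "col B 0 = mat_adjoint U *\<^sub>v (A *\<^sub>v col U 0)"
      unfolding B_def assoc_mult_mat[OF Uc(2) A Uc(1)]
      by (simp only: n zero_less_Suc col_mult2[OF Uc(2) mult_carrier_mat[OF A Uc(1)], unfolded n]
          col_mult2[OF A Uc(1), unfolded n])
    also have "A *\<^sub>v col U 0 = e \<cdot>\<^sub>v col U 0"
      using v A by (simp add: c(2) mult_mat_vec[OF A v(1)] smult_smult_assoc mult.commute)
    also have "mat_adjoint U *\<^sub>v (e \<cdot>\<^sub>v col U 0) = e \<cdot>\<^sub>v (mat_adjoint U *\<^sub>v col U 0)"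
      by (intro mult_mat_vec[OF Uc(2)] carrier_vecI) (use Uc(1) in \<open>simp add: carrier_matD\<close>)
    also have "mat_adjoint U *\<^sub>v col U 0 = col (mat_adjoint U * U) 0"
      by (rule col_mult2[OF Uc(2,1), symmetric]) (simp add: n)
    also have "\<dots> = unit_vec n 0" using Uc n by simp
    finally show ?thesis .
  qed
  have B0: "B $$ (i, 0) = (if i = 0 then e else 0)" if "i < n" for i
    using arg_cong[OF colB, of "\<lambda>w. w $ i"] that B n by (auto simp: col_def)
  have Bh: "B $$ (i, j) = cnj (B $$ (j, i))" if "i < n" "j < n" for i j
    using arg_cong[OF herm[unfolded hermitian_mat_def], of "\<lambda>X. X $$ (i, j)"] that B by simp
  have B0': "B $$ (0, j) = 0" if "0 < j" "j < n" for j using Bh[of 0 j] B0[of j] that by simp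
  define B3 where "B3 = mat k k (\<lambda>(i, j). B $$ (Suc i, Suc j))"
  let ?E = "mat 1 1 (\<lambda>_. e)"
  have B3: "B3 \<in> carrier_mat k k" by (simp add: B3_def)
  have Bblock: "B = four_block_mat ?E (0\<^sub>m 1 k) (0\<^sub>m k 1) B3"
    using B B0 B0' n by (intro eq_matI) (auto simp: B3_def)
  have "hermitian_mat B3"
    unfolding hermitian_mat_def
  proof (rule eq_matI)
    fix i j assume "i < dim_row B3" "j < dim_col B3"
    then show "mat_adjoint B3 $$ (i, j) = B3 $$ (i, j)"
      using Bh[of "Suc i" "Suc j"] n by (simp add: B3_def)
  qed (simp_all add: B3_def)
  moreover have "char_poly B3 = (\<Prod>e\<leftarrow>es. [:-e, 1:])"
  proof -
    have "char_poly B = char_poly ?E * char_poly B3"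
      unfolding Bblock by (rule char_poly_four_block_zeros_col) (use B3 in auto)
    moreover have "char_poly ?E = [:-e, 1:]" by (simp add: char_poly_defs det_def sign_def)
    ultimately have "[:-e, 1:] * char_poly B3 = [:-e, 1:] * (\<Prod>e\<leftarrow>es. [:-e, 1:])" using cpB cp by simp
    then show ?thesis by (metis mult_cancel_left pCons_eq_0_iff zero_neq_one)
  qed
  ultimately obtain W where W: "unitary_mat k W" "B3 = W * mat_diag k (\<lambda>i. es ! i) * mat_adjoint W"
    using Cons.IH[OF B3] by blast
  note Wc = unitary_matD[OF W(1)]
  let ?W = "four_block_mat (1\<^sub>m 1) (0\<^sub>m 1 k) (0\<^sub>m k 1) W"
  let ?D = "mat_diag n (\<lambda>i. (e # es) ! i)"
  have uW: "unitary_mat n ?W" unfolding n using unitary_mat_four_block[of 1 "1\<^sub>m 1" k W] W(1)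
    by (simp add: unitary_mat_def)
  have D: "?D = four_block_mat ?E (0\<^sub>m 1 k) (0\<^sub>m k 1) (mat_diag k (\<lambda>i. es ! i))"
    unfolding n by (intro eq_matI) (auto simp: mat_diag_def nth_Cons')
  have z: "mat_adjoint (0\<^sub>m a b) = (0\<^sub>m b a :: complex mat)" for a b by (intro eq_matI) auto
  have dc: "mat_diag k (\<lambda>i. es ! i) \<in> carrier_mat k k" by (simp add: mat_diag_def)
  have "?W * ?D * mat_adjoint ?W = four_block_mat ?E (0\<^sub>m 1 k) (0\<^sub>m k 1) (W * mat_diag k (\<lambda>i. es ! i) * mat_adjoint W)"
  proof -
    have Ec: "?E \<in> carrier_mat 1 1" by simp
    have WD: "W * mat_diag k (\<lambda>i. es ! i) \<in> carrier_mat k k" by (rule mult_carrier_mat[OF Wc(1) dc])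
    have 1: "?W * ?D = four_block_mat ?E (0\<^sub>m 1 k) (0\<^sub>m k 1) (W * mat_diag k (\<lambda>i. es ! i))"
      unfolding D mult_four_block_mat[OF one_carrier_mat zero_carrier_mat zero_carrier_mat Wc(1)
          Ec zero_carrier_mat zero_carrier_mat dc]
      using Ec Wc(1) dc WD by (intro cong_four_block_mat)
        (simp_all add: left_mult_zero_mat[OF dc] right_mult_zero_mat[OF Wc(1)])
    have 2: "mat_adjoint ?W = four_block_mat (1\<^sub>m 1) (0\<^sub>m 1 k) (0\<^sub>m k 1) (mat_adjoint W)"
      unfolding mat_adjoint_four_block[OF one_carrier_mat zero_carrier_mat zero_carrier_mat Wc(1)] z by simp
    show ?thesis
      unfolding 1 2 mult_four_block_mat[OF Ec zero_carrier_mat zero_carrier_mat WD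
          one_carrier_mat zero_carrier_mat zero_carrier_mat Wc(2)]
      using Ec Wc(2) WD mult_carrier_mat[OF WD Wc(2)] by (intro cong_four_block_mat)
        (simp_all add: left_mult_zero_mat[OF Wc(2)] right_mult_zero_mat[OF WD] right_mult_zero_mat[OF Ec])
  qed
  then have Beq: "B = ?W * ?D * mat_adjoint ?W" unfolding Bblock W(2)[symmetric] by simp
  note uWc = unitary_matD[OF uW]
  have Dc: "?D \<in> carrier_mat n n" by (simp add: mat_diag_def)
  have "A = U * B * mat_adjoint U" using unitary_conj_back[OF U A] by (simp add: B_def)
  also have "\<dots> = (U * ?W) * ?D * mat_adjoint (U * ?W)"
    unfolding Beq mat_adjoint_mult[OF Uc(1) uWc(1)]
    by (rule conj_conj[OF Uc(1) uWc(1) Dc uWc(2) Uc(2)])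
  finally show ?case using unitary_mat_mult[OF U uW] by blast
qed

text \<open>Both matrices are unitarily similar to one diagonal matrix, so comparing characteristic
  polynomials replaces the construction of a similarity.\<close>

lemma unitarily_invariant_char_poly:
  assumes nrm: "unitarily_invariant_norm N nrm"
    and X: "X \<in> carrier_mat N N" "hermitian_mat X" and Y: "Y \<in> carrier_mat N N" "hermitian_mat Y"
    and eq: "char_poly X = char_poly Y"
  shows "nrm X = nrm Y"
proof -
  obtain es where es: "char_poly X = (\<Prod>e\<leftarrow>es. [:-e, 1:])" using char_poly_factorized[OF X(1)] by blast
  let ?D = "mat_diag N (\<lambda>i. es ! i)"
  have *: "nrm A = nrm ?D"
    if A: "A \<in> carrier_mat N N" "hermitian_mat A" "char_poly A = (\<Prod>e\<leftarrow>es. [:-e, 1:])" for A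
  proof -
    obtain U where U: "unitary_mat N U" "A = U * ?D * mat_adjoint U" using hermitian_spectral[OF A] by blast
    have "?D \<in> carrier_mat N N" by (simp add: mat_diag_def)
    then show ?thesis using nrm U unitary_mat_adjoint[OF U(1)] by (auto simp: unitarily_invariant_norm_def)
  qed
  show ?thesis using *[OF X es] *[OF Y] es eq by simp
qed

text \<open>The diagonal form is a unitary conjugate of \<open>A\<close>, hence Hermitian itself, so
  its entries are real.\<close>

theorem hermitian_real_spectral:
  fixes A :: "complex mat"
  assumes A: "A \<in> carrier_mat n n" "hermitian_mat A"
  obtains U \<alpha> where "unitary_mat n U" "A = U * real_diag n \<alpha> * mat_adjoint U"
    "char_poly A = (\<Prod>i<n. [:- complex_of_real (\<alpha> i), 1:])"
proof -
  obtain es where es: "char_poly A = (\<Prod>e\<leftarrow>es. [:-e, 1:])" "length es = n" using char_poly_factorized[OF A(1)] by blast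
  let ?D = "mat_diag n (\<lambda>i. es ! i)"
  obtain U where U: "unitary_mat n U" "A = U * ?D * mat_adjoint U" using hermitian_spectral[OF A es(1)] by blast
  note Uc = unitary_matD[OF U(1)]
  have D: "?D \<in> carrier_mat n n" by (simp add: mat_diag_def)
  have "mat_adjoint U * A * U = ?D"
    using unitary_conj_back[OF unitary_mat_adjoint[OF U(1)] D] by (simp add: U(2))
  then have "hermitian_mat ?D" using hermitian_conj[OF A(2,1) Uc(1)] by simp
  then have "cnj (es ! i) = es ! i" if "i < n" for i
  proof -
    have "mat_adjoint ?D $$ (i, i) = cnj (?D $$ (i, i))"
      using that by (intro mat_adjoint_index) (auto simp: mat_diag_def)
    then have "cnj (?D $$ (i, i)) = ?D $$ (i, i)" using \<open>hermitian_mat ?D\<close> by (metis hermitian_mat_def)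
    then show ?thesis using that by (simp add: mat_diag_def)
  qed
  then have r: "complex_of_real (Re (es ! i)) = es ! i" if "i < n" for i
    using that by (simp add: complex_eq_iff)
  then have "?D = real_diag n (\<lambda>i. Re (es ! i))" by (intro eq_matI) (auto simp: mat_diag_def)
  moreover have "(\<Prod>e\<leftarrow>es. [:-e, 1:]) = (\<Prod>i<n. [:- complex_of_real (Re (es ! i)), 1:])"
    using es(2) r by (simp add: prod.list_conv_set_nth lessThan_atLeast0)
  ultimately show thesis using that U es by simp
qed

section \<open>The characteristic polynomial of a rank-one coupling\<close>

lemma mult_uminus_mat:
  fixes A B :: "complex mat"
  assumes "A \<in> carrier_mat n m" "B \<in> carrier_mat m k"
  shows "A * - B = - (A * B)"
  using carrier_matD[OF assms(1)] carrier_matD[OF assms(2)] by (intro uminus_mult_right_mat) simp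

lemma uminus_add_mat:
  fixes X Y :: "complex mat"
  assumes "X \<in> carrier_mat n m" "Y \<in> carrier_mat n m"
  shows "- X + Y = Y - X" and add_uminus_mat: "Y + - X = Y - X"
  using assms by (auto intro!: eq_matI)

text \<open>Right multiplication by a block unitriangular matrix of determinant 1 clears the block
  \<open>B\<close>.\<close>

lemma det_four_block_schur_left:
  fixes A Ai B C D :: "complex mat"
  assumes A: "A \<in> carrier_mat n n" and Ai: "Ai \<in> carrier_mat n n" "A * Ai = 1\<^sub>m n"
    and B: "B \<in> carrier_mat n m" and C: "C \<in> carrier_mat m n" and D: "D \<in> carrier_mat m m"
  shows "det (four_block_mat A B C D) = det A * det (D - C * (Ai * B))"
proof -
  have AiB: "Ai * B \<in> carrier_mat n m" by (rule mult_carrier_mat[OF Ai(1) B])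
  have nAiB: "- (Ai * B) \<in> carrier_mat n m" using AiB by simp
  let ?S = "four_block_mat (1\<^sub>m n) (- (Ai * B)) (0\<^sub>m m n) (1\<^sub>m m)"
  have "four_block_mat A B C D * ?S = four_block_mat (A * 1\<^sub>m n + B * 0\<^sub>m m n) (A * - (Ai * B) + B * 1\<^sub>m m)
     (C * 1\<^sub>m n + D * 0\<^sub>m m n) (C * - (Ai * B) + D * 1\<^sub>m m)"
    by (rule mult_four_block_mat[OF A B C D one_carrier_mat nAiB zero_carrier_mat one_carrier_mat])
  also have "A * 1\<^sub>m n + B * 0\<^sub>m m n = A" using A B by simp
  also have "C * 1\<^sub>m n + D * 0\<^sub>m m n = C" using C D by simp
  also have "A * - (Ai * B) + B * 1\<^sub>m m = 0\<^sub>m n m"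
  proof -
    have "A * (Ai * B) = B" using assoc_mult_mat[OF A Ai(1) B] Ai(2) B by simp
    then have "A * - (Ai * B) = - B" by (simp only: mult_uminus_mat[OF A AiB])
    moreover have "B * 1\<^sub>m m = B" using B by simp
    ultimately show ?thesis using B by (simp only:) (intro eq_matI; simp)
  qed
  also have "C * - (Ai * B) + D * 1\<^sub>m m = D - C * (Ai * B)"
  proof -
    have "C * - (Ai * B) = - (C * (Ai * B))" "D * 1\<^sub>m m = D"
      using mult_uminus_mat[OF C AiB] D by simp_all
    then show ?thesis by (simp only: uminus_add_mat[OF mult_carrier_mat[OF C AiB] D])
  qed
  finally have eq: "four_block_mat A B C D * ?S = four_block_mat A (0\<^sub>m n m) C (D - C * (Ai * B))" .
  have "det (four_block_mat A B C D * ?S) = det (four_block_mat A B C D) * det ?S"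
    by (rule det_mult[of _ "n + m"]) (use A D in auto)
  also have "det ?S = 1"
    by (subst det_four_block_mat_lower_left_zero[OF one_carrier_mat nAiB refl one_carrier_mat]) simp
  finally show ?thesis unfolding eq
    using det_four_block_mat_upper_right_zero[OF A refl C, of "D - C * (Ai * B)"] D C AiB
    by (simp add: mult_carrier_mat[OF C AiB] minus_carrier_mat)
qed

text \<open>Here the unitriangular factor clears \<open>C\<close>.\<close>

lemma det_four_block_schur_right:
  fixes A B C D Di :: "complex mat"
  assumes A: "A \<in> carrier_mat n n" and B: "B \<in> carrier_mat n m" and C: "C \<in> carrier_mat m n"
    and D: "D \<in> carrier_mat m m" and Di: "Di \<in> carrier_mat m m" "D * Di = 1\<^sub>m m"
  shows "det (four_block_mat A B C D) = det (A - B * (Di * C)) * det D"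
proof -
  have DiC: "Di * C \<in> carrier_mat m n" by (rule mult_carrier_mat[OF Di(1) C])
  have nDiC: "- (Di * C) \<in> carrier_mat m n" using DiC by simp
  let ?S = "four_block_mat (1\<^sub>m n) (0\<^sub>m n m) (- (Di * C)) (1\<^sub>m m)"
  have "four_block_mat A B C D * ?S = four_block_mat (A * 1\<^sub>m n + B * - (Di * C)) (A * 0\<^sub>m n m + B * 1\<^sub>m m)
     (C * 1\<^sub>m n + D * - (Di * C)) (C * 0\<^sub>m n m + D * 1\<^sub>m m)"
    by (rule mult_four_block_mat[OF A B C D one_carrier_mat zero_carrier_mat nDiC one_carrier_mat])
  also have "A * 0\<^sub>m n m + B * 1\<^sub>m m = B" using A B by simp
  also have "C * 0\<^sub>m n m + D * 1\<^sub>m m = D" using C D by simp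
  also have "C * 1\<^sub>m n + D * - (Di * C) = 0\<^sub>m m n"
  proof -
    have "D * (Di * C) = C" using assoc_mult_mat[OF D Di(1) C] Di(2) C by simp
    then have "D * - (Di * C) = - C" by (simp only: mult_uminus_mat[OF D DiC])
    moreover have "C * 1\<^sub>m n = C" using C by simp
    ultimately show ?thesis using C by (simp only:) (intro eq_matI; simp)
  qed
  also have "A * 1\<^sub>m n + B * - (Di * C) = A - B * (Di * C)"
  proof -
    have "B * - (Di * C) = - (B * (Di * C))" "A * 1\<^sub>m n = A"
      using mult_uminus_mat[OF B DiC] A by simp_all
    then show ?thesis by (simp only: add_uminus_mat[OF mult_carrier_mat[OF B DiC] A])
  qed
  finally have eq: "four_block_mat A B C D * ?S = four_block_mat (A - B * (Di * C)) B (0\<^sub>m m n) D" .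
  have "det (four_block_mat A B C D * ?S) = det (four_block_mat A B C D) * det ?S"
    by (rule det_mult[of _ "n + m"]) (use A D in auto)
  also have "det ?S = 1"
    by (subst det_four_block_mat_upper_right_zero[OF one_carrier_mat refl nDiC one_carrier_mat]) simp
  finally show ?thesis unfolding eq
    using det_four_block_mat_lower_left_zero[OF _ B refl D, of "A - B * (Di * C)"] A B DiC
    by (simp add: mult_carrier_mat[OF B DiC] minus_carrier_mat)
qed

lemma det_mat_diag: "det (mat_diag n f) = (\<Prod>i<n. f i :: complex)"
proof -
  have "det (mat_diag n f) = prod_list (diag_mat (mat_diag n f))"
    by (rule det_upper_triangular[of _ n]) (auto simp: mat_diag_def)
  also have "diag_mat (mat_diag n f) = map f [0..<n]"
    by (auto simp: diag_mat_def mat_diag_def intro!: nth_equalityI)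
  finally show ?thesis by (simp add: prod.list_conv_set_nth lessThan_atLeast0)
qed

text \<open>The matrix determinant lemma, obtained by evaluating one bordered determinant through
  its two Schur complements.\<close>

lemma det_diag_minus_rank_one:
  fixes f b b' :: "nat \<Rightarrow> complex"
  assumes "\<And>i. i < n \<Longrightarrow> f i \<noteq> 0"
  shows "det (mat n n (\<lambda>(i, j). (if i = j then f i else 0) - b i * b' j))
    = (\<Prod>i<n. f i) * (1 - (\<Sum>i<n. b i * b' i / f i))"
proof -
  let ?B = "mat 1 n (\<lambda>(i, j). b' j)" and ?C = "mat n 1 (\<lambda>(i, j). b i)"
  let ?D = "mat_diag n f" and ?Di = "mat_diag n (\<lambda>i. 1 / f i)"
  have DDi: "?D * ?Di = 1\<^sub>m n" using assms by (intro eq_matI) (auto simp: mat_diag_def scalar_prod_def sum.delta if_distrib cong: if_cong)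
  have "mat n n (\<lambda>(i, j). (if i = j then f i else 0) - b i * b' j) = ?D - ?C * (1\<^sub>m 1 * ?B)"
    by (intro eq_matI) (auto simp: mat_diag_def scalar_prod_def)
  then have "det (mat n n (\<lambda>(i, j). (if i = j then f i else 0) - b i * b' j)) = det (four_block_mat (1\<^sub>m 1) ?B ?C ?D)"
    using det_four_block_schur_left[of "1\<^sub>m 1" 1 "1\<^sub>m 1" ?B n ?C ?D] by simp
  also have "\<dots> = det (1\<^sub>m 1 - ?B * (?Di * ?C)) * det ?D"
    by (rule det_four_block_schur_right[OF _ _ _ _ _ DDi]) auto
  also have "det (1\<^sub>m 1 - ?B * (?Di * ?C)) = 1 - (\<Sum>i<n. b i * b' i / f i)"
    by (subst det_single) (auto simp: mat_diag_mult_left[of _ n 1] scalar_prod_def lessThan_atLeast0 intro!: sum.cong)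
  finally show ?thesis by (simp add: det_mat_diag mult.commute)
qed

text \<open>The coupled matrix in eigenbases of \<open>H1\<close> and \<open>H2\<close>: diagonal
  blocks, and \<open>b\<close> times the adjoint of \<open>a\<close> as lower left block.\<close>

definition bordered :: "nat \<Rightarrow> nat \<Rightarrow> (nat \<Rightarrow> real) \<Rightarrow> (nat \<Rightarrow> real) \<Rightarrow> (nat \<Rightarrow> complex) \<Rightarrow> (nat \<Rightarrow> complex) \<Rightarrow> complex mat" where
  "bordered m n \<alpha> \<beta> a b = four_block_mat (real_diag m \<alpha>) (mat m n (\<lambda>(i, j). a i * cnj (b j)))
     (mat n m (\<lambda>(i, j). b i * cnj (a j))) (real_diag n \<beta>)"

lemma bordered_carrier: "bordered m n \<alpha> \<beta> a b \<in> carrier_mat (m + n) (m + n)"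
  by (simp add: bordered_def)

lemma poly_of_real_linear_prod:
  "poly (map_poly of_real (linear_prod I \<alpha>)) (x :: complex) = (\<Prod>i\<in>I. x - of_real (\<alpha> i))"
  by (simp add: linear_prod_def of_real_poly_hom.hom_prod poly_prod)

lemma poly_of_real_weighted_poly:
  assumes "finite I" "\<And>i. i \<in> I \<Longrightarrow> x \<noteq> complex_of_real (\<alpha> i)"
  shows "poly (map_poly of_real (weighted_poly I \<alpha> p)) x
    = (\<Prod>i\<in>I. x - of_real (\<alpha> i)) * (\<Sum>i\<in>I. of_real (p i) / (x - of_real (\<alpha> i)))"
proof -
  have "of_real (p i) * (\<Prod>k\<in>I - {i}. x - of_real (\<alpha> k))
    = (\<Prod>k\<in>I. x - of_real (\<alpha> k)) * (of_real (p i) / (x - of_real (\<alpha> i)))" if "i \<in> I" for i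
  proof -
    have "x - of_real (\<alpha> i) \<noteq> 0" using assms(2)[OF that] by auto
    then show ?thesis by (subst prod.remove[OF assms(1) that]) (simp add: field_simps)
  qed
  then show ?thesis
    by (simp add: weighted_poly_def linear_prod_def of_real_poly_hom.hom_sum of_real_hom.map_poly_hom_smult
        of_real_poly_hom.hom_prod poly_sum poly_prod sum_distrib_left)
qed

text \<open>Away from the diagonal entries the Schur complement is diagonal minus rank one, so its
  determinant is known. Agreement at infinitely many points then gives equality of the
  polynomials.\<close>

theorem char_poly_bordered:
  "char_poly (bordered m n \<alpha> \<beta> a b) = map_poly of_real (linear_prod {..<m} \<alpha> * linear_prod {..<n} \<beta>
    - weighted_poly {..<m} \<alpha> (\<lambda>i. (cmod (a i))\<^sup>2) * weighted_poly {..<n} \<beta> (\<lambda>j. (cmod (b j))\<^sup>2))"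
    (is "?l = ?r")
proof -
  let ?S = "of_real ` \<alpha> ` {..<m} \<union> of_real ` \<beta> ` {..<n} :: complex set"
  have "poly ?l x = poly ?r x" if "x \<notin> ?S" for x
  proof -
    have nz: "x \<noteq> of_real (\<alpha> i)" "x \<noteq> of_real (\<beta> j)" if "i < m" "j < n" for i j using \<open>x \<notin> ?S\<close> that by auto
    have nza: "x - of_real (\<alpha> i) \<noteq> 0" if "i < m" for i using \<open>x \<notin> ?S\<close> that by auto
    have nzb: "x - of_real (\<beta> i) \<noteq> 0" if "i < n" for i using \<open>x \<notin> ?S\<close> that by auto
    define F where "F = (\<Sum>i<m. of_real ((cmod (a i))\<^sup>2) / (x - of_real (\<alpha> i)))"
    let ?A = "mat_diag m (\<lambda>i. x - of_real (\<alpha> i))" and ?Ai = "mat_diag m (\<lambda>i. 1 / (x - of_real (\<alpha> i)))"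
    let ?B = "mat m n (\<lambda>(i, j). - (a i * cnj (b j)))" and ?C = "mat n m (\<lambda>(i, j). - (b i * cnj (a j)))"
    let ?D = "mat_diag n (\<lambda>i. x - of_real (\<beta> i))"
    have AAi: "?A * ?Ai = 1\<^sub>m m" using nza
      by (intro eq_matI) (auto simp: mat_diag_def scalar_prod_def sum.delta if_distrib cong: if_cong)
    have "poly ?l x = det (four_block_mat ?A ?B ?C ?D)"
      unfolding char_poly_def
      by (rule poly_det_cong[of _ "m + n"])
        (auto simp: bordered_def char_poly_matrix_def mat_diag_def)
    also have "\<dots> = det ?A * det (?D - ?C * (?Ai * ?B))"
      by (rule det_four_block_schur_left[OF _ _ AAi]) auto
    also have "?D - ?C * (?Ai * ?B)
      = mat n n (\<lambda>(i, j). (if i = j then x - of_real (\<beta> i) else 0) - F * b i * cnj (b j))"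
    proof (rule eq_matI)
      fix i j assume "i < dim_row (mat n n (\<lambda>(i, j). (if i = j then x - of_real (\<beta> i) else 0) - F * b i * cnj (b j)))"
        "j < dim_col (mat n n (\<lambda>(i, j). (if i = j then x - of_real (\<beta> i) else 0) - F * b i * cnj (b j)))"
      then have ij: "i < n" "j < n" by auto
      have "(?C * (?Ai * ?B)) $$ (i, j) = (\<Sum>k<m. b i * cnj (a k) * (1 / (x - of_real (\<alpha> k)) * (a k * cnj (b j))))"
        using ij by (simp add: mat_diag_mult_left[of _ m n] scalar_prod_def lessThan_atLeast0)
      also have "\<dots> = F * b i * cnj (b j)"
        unfolding F_def sum_distrib_right complex_norm_square by (intro sum.cong) auto
      finally show "(?D - ?C * (?Ai * ?B)) $$ (i, j)
        = mat n n (\<lambda>(i, j). (if i = j then x - of_real (\<beta> i) else 0) - F * b i * cnj (b j)) $$ (i, j)"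
        using ij by (simp add: mat_diag_def)
    qed (auto simp: mat_diag_def)
    also have "det \<dots> = (\<Prod>i<n. x - of_real (\<beta> i)) * (1 - (\<Sum>i<n. (F * b i) * cnj (b i) / (x - of_real (\<beta> i))))"
      by (rule det_diag_minus_rank_one) (rule nzb)
    also have "(\<Sum>i<n. (F * b i) * cnj (b i) / (x - of_real (\<beta> i)))
      = F * (\<Sum>i<n. of_real ((cmod (b i))\<^sup>2) / (x - of_real (\<beta> i)))"
      unfolding sum_distrib_left complex_norm_square by (intro sum.cong) auto
    finally have l: "poly ?l x = (\<Prod>i<m. x - of_real (\<alpha> i)) * ((\<Prod>i<n. x - of_real (\<beta> i))
      * (1 - F * (\<Sum>i<n. of_real ((cmod (b i))\<^sup>2) / (x - of_real (\<beta> i)))))"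
      by (simp add: det_mat_diag)
    have 1: "poly (map_poly of_real (weighted_poly {..<m} \<alpha> (\<lambda>i. (cmod (a i))\<^sup>2))) x = (\<Prod>i<m. x - of_real (\<alpha> i)) * F"
      unfolding F_def by (rule poly_of_real_weighted_poly) (use nza in auto)
    have 2: "poly (map_poly of_real (weighted_poly {..<n} \<beta> (\<lambda>i. (cmod (b i))\<^sup>2))) x
      = (\<Prod>i<n. x - of_real (\<beta> i)) * (\<Sum>i<n. of_real ((cmod (b i))\<^sup>2) / (x - of_real (\<beta> i)))"
      by (rule poly_of_real_weighted_poly) (use nzb in auto)
    show ?thesis
      unfolding l of_real_poly_hom.hom_minus of_real_poly_hom.hom_mult poly_diff poly_mult poly_of_real_linear_prod 1 2
      by (simp add: algebra_simps)
  qed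
  then have "- ?S \<subseteq> {x. poly (?l - ?r) x = 0}" by auto
  moreover have "infinite (- ?S)"
    by (metis (no_types, lifting) finite_Un finite_imageI finite_lessThan finite_compl infinite_UNIV_char_0)
  ultimately have "?l - ?r = 0" using poly_roots_finite finite_subset by blast
  then show ?thesis by simp
qed

text \<open>Two independent columns would force rank 2, so all columns are multiples of one nonzero
  column \<open>u\<close>; the conjugated multipliers form \<open>w\<close>.\<close>

lemma rank_le_one_factor:
  fixes E :: "complex mat"
  assumes E: "E \<in> carrier_mat n m" and rank: "vec_space.rank n E \<le> 1"
  obtains u w where "\<And>i j. i < n \<Longrightarrow> j < m \<Longrightarrow> E $$ (i, j) = u i * cnj (w j)"
proof -
  interpret vec_space "TYPE(complex)" n .
  show thesis
  proof (cases "\<exists>j<m. col E j \<noteq> 0\<^sub>v n")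
    case False
    have "E $$ (i, j) = 0 * cnj 0" if "i < n" "j < m" for i j
    proof -
      have "col E j = 0\<^sub>v n" using False that by auto
      then have "col E j $ i = 0" using that by simp
      then show ?thesis using that E by simp
    qed
    then show thesis by (rule that)
  next
    case True
    then obtain l where l: "l < m" "col E l \<noteq> 0\<^sub>v n" by auto
    have c: "col E j \<in> carrier_vec n" for j using E by (intro carrier_vecI) simp
    have "\<exists>k. col E j = k \<cdot>\<^sub>v col E l" if j: "j < m" for j
    proof (rule ccontr)
      assume no: "\<nexists>k. col E j = k \<cdot>\<^sub>v col E l"
      let ?U = "{col E j, col E l}"
      have ne: "col E j \<noteq> col E l" using no by (metis one_smult_vec)
      have U: "?U \<subseteq> carrier_vec n" using c by auto
      have "lin_indpt ?U"
      proof (rule finite_lin_indpt2)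
        fix f assume lc: "lincomb f ?U = 0\<^sub>v n"
        have e: "f (col E j) * (col E j $ i) + f (col E l) * (col E l $ i) = 0" if "i < n" for i
        proof -
          have "lincomb f ?U $ i = (\<Sum>x\<in>?U. f x * x $ i)" by (rule lincomb_index[OF that U])
          then show ?thesis using lc ne that by simp
        qed
        have fj: "f (col E j) = 0"
        proof (rule ccontr)
          assume f0: "f (col E j) \<noteq> 0"
          have "col E j = (- f (col E l) / f (col E j)) \<cdot>\<^sub>v col E l"
          proof (rule eq_vecI)
            fix i assume "i < dim_vec ((- f (col E l) / f (col E j)) \<cdot>\<^sub>v col E l)"
            then have "i < n" using E by simp
            moreover have "f (col E j) * (col E j $ i) = - (f (col E l) * (col E l $ i))"
              using e[OF \<open>i < n\<close>] by (simp add: eq_neg_iff_add_eq_0)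
            ultimately show "col E j $ i = ((- f (col E l) / f (col E j)) \<cdot>\<^sub>v col E l) $ i"
              using f0 E by (simp add: field_simps)
          qed (use E in auto)
          then show False using no by blast
        qed
        obtain i where i: "i < n" "col E l $ i \<noteq> 0" using l(2) c[of l] by (metis carrier_vecD eq_vecI index_zero_vec)
        have "f (col E l) = 0" using e[OF i(1)] fj i(2) by simp
        then show "\<forall>v\<in>?U. f v = 0" using fj by simp
      qed (use U in auto)
      moreover have "?U \<subseteq> set (cols E)" using j l E by (auto simp: cols_def)
      ultimately have "card ?U \<le> rank E" using rank_ge_card_indpt[OF E] by blast
      then show False using rank ne by simp
    qed
    then obtain k where k: "\<And>j. j < m \<Longrightarrow> col E j = k j \<cdot>\<^sub>v col E l" by metis
    have "E $$ (i, j) = E $$ (i, l) * cnj (cnj (k j))" if "i < n" "j < m" for i j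
    proof -
      have "col E j $ i = (k j \<cdot>\<^sub>v col E l) $ i" using k[OF that(2)] by simp
      then show ?thesis using that E l by simp
    qed
    then show thesis by (rule that)
  qed
qed

lemma eig_of_char_poly:
  fixes N :: nat
  assumes "char_poly A = map_poly of_real (linear_prod {..<N} \<mu>)"
  shows "eig A = image_mset (\<lambda>k. complex_of_real (\<mu> k)) (mset_set {..<N})"
proof -
  have "eig A = proots (\<Prod>k<N. [:- complex_of_real (\<mu> k), 1:])"
    by (simp add: eig_def assms linear_prod_def of_real_poly_hom.hom_prod)
  also have "\<dots> = (\<Sum>k<N. {#complex_of_real (\<mu> k)#})" by (subst proots_prod) auto
  also have "\<dots> = image_mset (\<lambda>k. complex_of_real (\<mu> k)) (mset_set {..<N})"
    by (induction N) (auto simp: lessThan_Suc)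
  finally show ?thesis .
qed

text \<open>Vectors as one-column matrices, so that rank-one matrices and their conjugates are plain
  matrix products.\<close>

definition col_mat :: "nat \<Rightarrow> (nat \<Rightarrow> complex) \<Rightarrow> complex mat" where
  "col_mat n u = mat n 1 (\<lambda>(i, j). u i)"

lemma col_mat_carrier: "col_mat n u \<in> carrier_mat n 1"
  by (simp add: col_mat_def)

lemma unitary_col_mat_norm:
  fixes u :: "nat \<Rightarrow> complex"
  assumes "unitary_mat n U"
  defines "b \<equiv> \<lambda>i. (mat_adjoint U * col_mat n u) $$ (i, 0)"
  shows "mat_adjoint U * col_mat n u = col_mat n b" "(\<Sum>i<n. (cmod (b i))\<^sup>2) = (\<Sum>i<n. (cmod (u i))\<^sup>2)"
proof -
  note U = unitary_matD[OF assms(1)]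
  have B: "mat_adjoint U * col_mat n u \<in> carrier_mat n 1" by (rule mult_carrier_mat[OF U(2) col_mat_carrier])
  show eq: "mat_adjoint U * col_mat n u = col_mat n b"
    using carrier_matD[OF B] by (intro eq_matI) (auto simp: col_mat_def b_def)
  have sq: "(mat_adjoint (col_mat n u) * col_mat n u) $$ (0, 0) = complex_of_real (\<Sum>i<n. (cmod (u i))\<^sup>2)" for u
    by (simp add: scalar_prod_def col_mat_def lessThan_atLeast0 complex_norm_square mult.commute del: of_real_power)
  have "mat_adjoint (col_mat n b) * col_mat n b = mat_adjoint (col_mat n u) * U * (mat_adjoint U * col_mat n u)"
    unfolding eq[symmetric] mat_adjoint_mult[OF U(2) col_mat_carrier] by simp
  also have "\<dots> = mat_adjoint (col_mat n u) * col_mat n u"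
    by (rule mult_mid_cancel[OF mat_adjoint_carrier[OF col_mat_carrier] U(1,2) col_mat_carrier U(4)])
  finally show "(\<Sum>i<n. (cmod (b i))\<^sup>2) = (\<Sum>i<n. (cmod (u i))\<^sup>2)" using sq[of b] sq[of u] of_real_eq_iff by metis
qed

lemma bordered_alt:
  "bordered m n \<alpha> \<beta> a b = four_block_mat (real_diag m \<alpha>) (mat_adjoint (col_mat n b * mat_adjoint (col_mat m a)))
     (col_mat n b * mat_adjoint (col_mat m a)) (real_diag n \<beta>)"
  unfolding bordered_def
  by (intro cong_four_block_mat refl eq_matI) (auto simp: col_mat_def scalar_prod_def)

lemma block_diag_conj:
  fixes U1 U2 A B C D :: "complex mat"
  assumes U1: "U1 \<in> carrier_mat m m" and U2: "U2 \<in> carrier_mat n n"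
    and A: "A \<in> carrier_mat m m" and B: "B \<in> carrier_mat m n" and C: "C \<in> carrier_mat n m" and D: "D \<in> carrier_mat n n"
  defines "W \<equiv> four_block_mat U1 (0\<^sub>m m n) (0\<^sub>m n m) U2"
  shows "W * four_block_mat A B C D * mat_adjoint W
    = four_block_mat (U1 * A * mat_adjoint U1) (U1 * B * mat_adjoint U2) (U2 * C * mat_adjoint U1) (U2 * D * mat_adjoint U2)"
proof -
  note a1 = mat_adjoint_carrier[OF U1] and a2 = mat_adjoint_carrier[OF U2]
  note c = mult_carrier_mat[OF U1 A] mult_carrier_mat[OF U1 B] mult_carrier_mat[OF U2 C] mult_carrier_mat[OF U2 D]
  have z: "mat_adjoint (0\<^sub>m a b) = (0\<^sub>m b a :: complex mat)" for a b by (intro eq_matI) auto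
  have 1: "W * four_block_mat A B C D = four_block_mat (U1 * A) (U1 * B) (U2 * C) (U2 * D)"
    unfolding W_def mult_four_block_mat[OF U1 zero_carrier_mat zero_carrier_mat U2 A B C D]
      left_mult_zero_mat[OF A] left_mult_zero_mat[OF B] left_mult_zero_mat[OF C] left_mult_zero_mat[OF D]
      left_add_zero_mat[OF c(3)] left_add_zero_mat[OF c(4)] right_add_zero_mat[OF c(1)] right_add_zero_mat[OF c(2)] ..
  have 2: "mat_adjoint W = four_block_mat (mat_adjoint U1) (0\<^sub>m m n) (0\<^sub>m n m) (mat_adjoint U2)"
    unfolding W_def mat_adjoint_four_block[OF U1 zero_carrier_mat zero_carrier_mat U2] z ..
  note c' = mult_carrier_mat[OF c(1) a1] mult_carrier_mat[OF c(2) a2] mult_carrier_mat[OF c(3) a1] mult_carrier_mat[OF c(4) a2]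
  show ?thesis
    unfolding 1 2 mult_four_block_mat[OF c a1 zero_carrier_mat zero_carrier_mat a2]
      right_mult_zero_mat[OF c(1)] right_mult_zero_mat[OF c(2)] right_mult_zero_mat[OF c(3)] right_mult_zero_mat[OF c(4)]
      right_add_zero_mat[OF c'(1)] left_add_zero_mat[OF c'(2)] right_add_zero_mat[OF c'(3)] left_add_zero_mat[OF c'(4)] ..
qed

text \<open>Conjugation by the block diagonal unitary of \<open>U1\<close> and \<open>U2\<close>
  leads to \<open>bordered\<close>; it replaces \<open>w\<close> and \<open>u\<close> by unitary
  images with the same Euclidean norms.\<close>

theorem char_poly_block_rank_one:
  assumes U1: "unitary_mat m U1" and H1: "H1 = U1 * real_diag m \<alpha> * mat_adjoint U1"
    and U2: "unitary_mat n U2" and H2: "H2 = U2 * real_diag n \<beta> * mat_adjoint U2"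
    and E: "E \<in> carrier_mat n m" "\<And>i j. i < n \<Longrightarrow> j < m \<Longrightarrow> E $$ (i, j) = u i * cnj (w j)"
  obtains a b where "(\<Sum>i<m. (cmod (a i))\<^sup>2) = (\<Sum>i<m. (cmod (w i))\<^sup>2)"
    "(\<Sum>j<n. (cmod (b j))\<^sup>2) = (\<Sum>j<n. (cmod (u j))\<^sup>2)"
    "char_poly (four_block_mat H1 (mat_adjoint E) E H2) = map_poly of_real (linear_prod {..<m} \<alpha> * linear_prod {..<n} \<beta>
      - weighted_poly {..<m} \<alpha> (\<lambda>i. (cmod (a i))\<^sup>2) * weighted_poly {..<n} \<beta> (\<lambda>j. (cmod (b j))\<^sup>2))"
proof
  define a where "a i = (mat_adjoint U1 * col_mat m w) $$ (i, 0)" for i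
  define b where "b i = (mat_adjoint U2 * col_mat n u) $$ (i, 0)" for i
  note a = unitary_col_mat_norm[OF U1, of w, folded a_def]
  note b = unitary_col_mat_norm[OF U2, of u, folded b_def]
  show "(\<Sum>i<m. (cmod (a i))\<^sup>2) = (\<Sum>i<m. (cmod (w i))\<^sup>2)" by (rule a(2))
  show "(\<Sum>j<n. (cmod (b j))\<^sup>2) = (\<Sum>j<n. (cmod (u j))\<^sup>2)" by (rule b(2))
  note u1 = unitary_matD[OF U1] and u2 = unitary_matD[OF U2]
  have Eeq: "E = col_mat n u * mat_adjoint (col_mat m w)"
    using E by (intro eq_matI) (auto simp: col_mat_def scalar_prod_def)
  let ?C = "col_mat n b * mat_adjoint (col_mat m a)"
  have C: "?C \<in> carrier_mat n m" by (rule mult_carrier_mat[OF col_mat_carrier mat_adjoint_carrier[OF col_mat_carrier]])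
  have eq: "?C = mat_adjoint U2 * E * U1"
  proof -
    have cw: "mat_adjoint (col_mat m w) \<in> carrier_mat 1 m" by (rule mat_adjoint_carrier[OF col_mat_carrier])
    have "?C = (mat_adjoint U2 * col_mat n u) * (mat_adjoint (col_mat m w) * U1)"
      unfolding a(1)[symmetric] b(1)[symmetric] mat_adjoint_mult[OF u1(2) col_mat_carrier] by simp
    also have "\<dots> = mat_adjoint U2 * (col_mat n u * mat_adjoint (col_mat m w)) * U1"
      unfolding assoc_mult_mat[OF u2(2) col_mat_carrier cw, symmetric]
      by (rule assoc_mult_mat[OF mult_carrier_mat[OF u2(2) col_mat_carrier] cw u1(1), symmetric])
    finally show ?thesis unfolding Eeq .
  qed
  have E_back: "U2 * ?C * mat_adjoint U1 = E"
  proof -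
    have "U2 * (mat_adjoint U2 * E * U1) = U2 * (mat_adjoint U2 * (E * U1))"
      by (simp only: assoc_mult_mat[OF u2(2) E(1) u1(1)])
    also have "\<dots> = U2 * mat_adjoint U2 * (E * U1)"
      by (rule assoc_mult_mat[OF u2(1,2) mult_carrier_mat[OF E(1) u1(1)], symmetric])
    also have "\<dots> = E * U1" unfolding u2(4) by (rule left_mult_one_mat[OF mult_carrier_mat[OF E(1) u1(1)]])
    also have "\<dots> * mat_adjoint U1 = E * (U1 * mat_adjoint U1)" by (rule assoc_mult_mat[OF E(1) u1(1,2)])
    finally show ?thesis unfolding eq u1(4) by (simp only: right_mult_one_mat[OF E(1)])
  qed
  have adjoint_back: "U1 * mat_adjoint ?C * mat_adjoint U2 = mat_adjoint E"
  proof -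
    have "mat_adjoint E = mat_adjoint (mat_adjoint U1) * mat_adjoint (U2 * ?C)"
      unfolding E_back[symmetric] by (rule mat_adjoint_mult[OF mult_carrier_mat[OF u2(1) C] u1(2)])
    also have "mat_adjoint (U2 * ?C) = mat_adjoint ?C * mat_adjoint U2" by (rule mat_adjoint_mult[OF u2(1) C])
    also have "mat_adjoint (mat_adjoint U1) * (mat_adjoint ?C * mat_adjoint U2) = U1 * mat_adjoint ?C * mat_adjoint U2"
      unfolding mat_adjoint_adjoint by (rule assoc_mult_mat[OF u1(1) mat_adjoint_carrier[OF C] u2(2), symmetric])
    finally show ?thesis by simp
  qed
  let ?W = "four_block_mat U1 (0\<^sub>m m n) (0\<^sub>m n m) U2"
  have "four_block_mat H1 (mat_adjoint E) E H2 = ?W * bordered m n \<alpha> \<beta> a b * mat_adjoint ?W"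
    unfolding bordered_alt block_diag_conj[OF u1(1) u2(1) mat_diag_dim mat_adjoint_carrier[OF C] C mat_diag_dim] E_back adjoint_back H1 H2 ..
  then show "char_poly (four_block_mat H1 (mat_adjoint E) E H2) = map_poly of_real (linear_prod {..<m} \<alpha> * linear_prod {..<n} \<beta>
      - weighted_poly {..<m} \<alpha> (\<lambda>i. (cmod (a i))\<^sup>2) * weighted_poly {..<n} \<beta> (\<lambda>j. (cmod (b j))\<^sup>2))"
    using char_poly_unitary_conj[OF unitary_mat_four_block[OF U1 U2] bordered_carrier] char_poly_bordered by simp
qed

section \<open>The eigenvalue bound\<close>

lemma weighted_poly_smult: "weighted_poly I \<alpha> (\<lambda>i. c * p i) = smult c (weighted_poly I \<alpha> p)"
  by (simp add: weighted_poly_def smult_sum2 mult.commute)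

lemma cauchy_schwarz_cmod:
  fixes u v :: "nat \<Rightarrow> complex"
  shows "cmod (\<Sum>i<m. cnj (u i) * v i) \<le> sqrt (\<Sum>i<m. (cmod (u i))\<^sup>2) * sqrt (\<Sum>i<m. (cmod (v i))\<^sup>2)"
proof -
  have "cmod (\<Sum>i<m. cnj (u i) * v i) \<le> (\<Sum>i<m. \<bar>cmod (u i)\<bar> * \<bar>cmod (v i)\<bar>)"
    by (rule order_trans[OF norm_sum]) (simp add: norm_mult)
  also have "\<dots> \<le> L2_set (\<lambda>i. cmod (u i)) {..<m} * L2_set (\<lambda>i. cmod (v i)) {..<m}" by (rule L2_set_mult_ineq)
  finally show ?thesis by (simp add: L2_set_def)
qed

text \<open>\<open>E v\<close> has norm \<open>|u|\<close> times the modulus of the inner product of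
  \<open>w\<close> and \<open>v\<close>. By Cauchy-Schwarz the supremum is attained at the
  normalised \<open>w\<close>.\<close>

lemma spectral_norm_rank_one:
  fixes E :: "complex mat"
  assumes E: "E \<in> carrier_mat n m" "\<And>i j. i < n \<Longrightarrow> j < m \<Longrightarrow> E $$ (i, j) = u i * cnj (w j)"
    and w: "(\<Sum>i<m. (cmod (w i))\<^sup>2) > 0"
  shows "spectral_norm E = sqrt (\<Sum>i<n. (cmod (u i))\<^sup>2) * sqrt (\<Sum>i<m. (cmod (w i))\<^sup>2)"
proof -
  let ?u = "sqrt (\<Sum>i<n. (cmod (u i))\<^sup>2)" and ?w = "sqrt (\<Sum>i<m. (cmod (w i))\<^sup>2)"
  have w0: "?w > 0" using w by simp
  have Ev: "euclidean_norm (E *\<^sub>v v) = ?u * cmod (\<Sum>j<m. cnj (w j) * v $ j)" if v: "v \<in> carrier_vec m" for v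
  proof -
    have "(E *\<^sub>v v) $ i = u i * (\<Sum>j<m. cnj (w j) * v $ j)" if "i < n" for i
    proof -
      have "(E *\<^sub>v v) $ i = (\<Sum>j<m. E $$ (i, j) * v $ j)"
        using that E(1) v by (simp add: scalar_prod_def lessThan_atLeast0)
      also have "\<dots> = (\<Sum>j<m. u i * (cnj (w j) * v $ j))" using E(2)[OF that] by (intro sum.cong) auto
      finally show ?thesis by (simp add: sum_distrib_left)
    qed
    then have "euclidean_norm (E *\<^sub>v v) = sqrt (\<Sum>i<n. (cmod (u i))\<^sup>2 * (cmod (\<Sum>j<m. cnj (w j) * v $ j))\<^sup>2)"
      using E(1) by (simp add: euclidean_norm_def norm_mult power_mult_distrib)
    then show ?thesis by (simp add: sum_distrib_right[symmetric] real_sqrt_mult)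
  qed
  show ?thesis
    unfolding spectral_norm_def
  proof (rule cSup_eq_maximum)
    fix x assume "x \<in> (\<lambda>v. euclidean_norm (E *\<^sub>v v)) ` {v \<in> carrier_vec (dim_col E). euclidean_norm v = 1}"
    then obtain v where v: "v \<in> carrier_vec m" "euclidean_norm v = 1" "x = euclidean_norm (E *\<^sub>v v)" using E(1) by auto
    have "cmod (\<Sum>j<m. cnj (w j) * v $ j) \<le> ?w * sqrt (\<Sum>j<m. (cmod (v $ j))\<^sup>2)" by (rule cauchy_schwarz_cmod)
    also have "sqrt (\<Sum>j<m. (cmod (v $ j))\<^sup>2) = 1" using v by (simp add: euclidean_norm_def)
    finally show "x \<le> ?u * ?w" unfolding v(3) Ev[OF v(1)] by (intro mult_left_mono) (auto simp: sum_nonneg)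
  next
    define v where "v = vec m (\<lambda>i. w i / of_real ?w)"
    have v: "v \<in> carrier_vec m" by (simp add: v_def)
    have S: "S / (sqrt S)\<^sup>2 = 1" "S / sqrt S = sqrt S" if "S > 0" for S :: real
      using that by (simp_all add: real_div_sqrt)
    have "euclidean_norm v = sqrt ((\<Sum>i<m. (cmod (w i))\<^sup>2) / ?w\<^sup>2)"
    proof -
      have "(cmod (v $ i))\<^sup>2 = (cmod (w i))\<^sup>2 / ?w\<^sup>2" if "i < m" for i
        using w0 that by (simp only: v_def index_vec norm_divide norm_of_real power_divide power2_abs)
      then show ?thesis using v by (simp only: euclidean_norm_def sum_divide_distrib carrier_vecD) simp
    qed
    also have "\<dots> = 1" unfolding S(1)[OF w] by simp
    finally have v1: "euclidean_norm v = 1" .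
    have "(\<Sum>j<m. cnj (w j) * v $ j) = of_real ((\<Sum>i<m. (cmod (w i))\<^sup>2) / ?w)"
      by (simp add: v_def sum_divide_distrib complex_norm_square mult.commute del: of_real_power)
    also have "(\<Sum>i<m. (cmod (w i))\<^sup>2) / ?w = ?w" by (rule S(2)[OF w])
    finally have "euclidean_norm (E *\<^sub>v v) = ?u * ?w" unfolding Ev[OF v] using w0 by simp
    then show "?u * ?w \<in> (\<lambda>v. euclidean_norm (E *\<^sub>v v)) ` {v \<in> carrier_vec (dim_col E). euclidean_norm v = 1}"
      using v v1 E(1) by (intro image_eqI[of _ _ v]) auto
  qed
qed

lemma eig_gap_bounds:
  fixes m n :: nat
  assumes H1: "eig X = image_mset (\<lambda>k. complex_of_real (\<alpha> k)) (mset_set {..<m})"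
    and H2: "eig Y = image_mset (\<lambda>k. complex_of_real (\<beta> k)) (mset_set {..<n})"
    and mn: "m \<ge> 1" "n \<ge> 1"
  shows "0 \<le> eig_gap X Y" "\<And>i j. i < m \<Longrightarrow> j < n \<Longrightarrow> eig_gap X Y \<le> \<bar>\<alpha> i - \<beta> j\<bar>"
proof -
  let ?S = "{cmod (\<mu>\<^sub>1 - \<mu>\<^sub>2) | \<mu>\<^sub>1 \<mu>\<^sub>2. \<mu>\<^sub>1 \<in># eig X \<and> \<mu>\<^sub>2 \<in># eig Y}"
  have S: "?S = (\<lambda>(i, j). \<bar>\<alpha> i - \<beta> j\<bar>) ` ({..<m} \<times> {..<n})"
  proof -
    have c: "cmod (complex_of_real a - complex_of_real b) = \<bar>a - b\<bar>" for a b
      by (metis norm_of_real of_real_diff)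
    have mem: "z \<in># eig X \<longleftrightarrow> (\<exists>i<m. z = complex_of_real (\<alpha> i))"
      "z \<in># eig Y \<longleftrightarrow> (\<exists>j<n. z = complex_of_real (\<beta> j))" for z
      unfolding H1 H2 by auto
    have "?S = {cmod (complex_of_real (\<alpha> i) - complex_of_real (\<beta> j)) | i j. i < m \<and> j < n}"
      unfolding mem by fast
    then show ?thesis unfolding c by auto
  qed
  have fin: "finite ?S" unfolding S by simp
  have "?S \<noteq> {}" unfolding S using mn by (auto simp: lessThan_empty_iff)
  then have "Min ?S \<in> ?S" by (rule Min_in[OF fin])
  then show "0 \<le> eig_gap X Y" unfolding eig_gap_def by auto
  fix i j assume "i < m" "j < n"
  then have "\<bar>\<alpha> i - \<beta> j\<bar> \<in> ?S" unfolding S by auto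
  then show "eig_gap X Y \<le> \<bar>\<alpha> i - \<beta> j\<bar>" unfolding eig_gap_def by (rule Min_le[OF fin])
qed

text \<open>Completing the square gives \<open>2 * s + \<eta> \<le> R\<close> with
  \<open>R\<^sup>2 = \<eta>\<^sup>2 + 4 * \<epsilon>\<^sup>2\<close>; rationalising
  \<open>R - \<eta>\<close> yields the denominator of \<open>phi\<close>.\<close>

lemma le_phi_mult:
  assumes "s\<^sup>2 + \<eta> * s \<le> \<epsilon>\<^sup>2" "\<eta> \<ge> 0" "\<epsilon> > 0"
  shows "s \<le> phi \<eta> \<epsilon> * \<epsilon>"
proof -
  define R where "R = sqrt (\<eta>\<^sup>2 + 4 * \<epsilon>\<^sup>2)"
  have R: "R > 0" "R\<^sup>2 = \<eta>\<^sup>2 + 4 * \<epsilon>\<^sup>2" using assms(3) by (auto simp: R_def add_nonneg_pos)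
  have "(2 * s + \<eta>)\<^sup>2 \<le> R\<^sup>2" using assms(1) unfolding R(2) by (simp add: power2_eq_square algebra_simps)
  then have "2 * s + \<eta> \<le> R" using R(1) by (simp add: abs_le_square_iff[symmetric])
  then have "(2 * s + \<eta>) * (\<eta> + R) \<le> R * (\<eta> + R)" using R assms(2) by (intro mult_right_mono) auto
  then have "s * (\<eta> + R) \<le> 2 * \<epsilon>\<^sup>2" using R(2) by (simp add: power2_eq_square algebra_simps)
  then have "s \<le> 2 * \<epsilon>\<^sup>2 / (\<eta> + R)" using R assms(2) by (simp add: pos_le_divide_eq)
  then show ?thesis using assms(3) by (simp add: phi_def R_def power2_eq_square)
qed

lemma hermitian_real_diag: "hermitian_mat (real_diag N g)"
  unfolding hermitian_mat_def by (intro eq_matI) (auto simp: mat_diag_def)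

lemma char_poly_real_diag: "char_poly (real_diag N g) = map_poly of_real (linear_prod {..<N} g)"
proof -
  have "char_poly (real_diag N g) = (\<Prod>a\<leftarrow>diag_mat (real_diag N g). [:- a, 1:])"
    by (rule char_poly_upper_triangular[of _ N]) (auto simp: mat_diag_def)
  also have "diag_mat (real_diag N g) = map (\<lambda>i. complex_of_real (g i)) [0..<N]"
    by (auto simp: diag_mat_def mat_diag_def intro!: nth_equalityI)
  finally show ?thesis
    by (simp add: linear_prod_def of_real_poly_hom.hom_prod prod.list_conv_set_nth lessThan_atLeast0)
qed

text \<open>With zero diagonal blocks \<open>char_poly_bordered\<close> gives
  \<open>x^(m+n-2) * (x^2 - \<epsilon>^2)\<close>, which is also the characteristic polynomial of
  the diagonal matrix with entries \<open>\<epsilon>\<close>, \<open>- \<epsilon>\<close> and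
  zeros.\<close>

lemma norm_unit_diag_difference:
  fixes u w :: "nat \<Rightarrow> complex"
  assumes nrm: "unitarily_invariant_norm (m + n) nrm" and mn: "m \<ge> 1" "n \<ge> 1"
    and E: "E \<in> carrier_mat n m" "\<And>i j. i < n \<Longrightarrow> j < m \<Longrightarrow> E $$ (i, j) = u i * cnj (w j)"
    and ij: "i < m + n" "j < m + n" "i \<noteq> j"
  defines "\<epsilon> \<equiv> sqrt (\<Sum>i<n. (cmod (u i))\<^sup>2) * sqrt (\<Sum>i<m. (cmod (w i))\<^sup>2)"
  shows "\<epsilon> * nrm (real_diag (m + n) (\<lambda>k. (if k = i then 1 else 0) - (if k = j then 1 else 0)))
    = nrm (four_block_mat (0\<^sub>m m m) (mat_adjoint E) E (0\<^sub>m n n))"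
proof -
  let ?N = "m + n" and ?V = "four_block_mat (0\<^sub>m m m) (mat_adjoint E) E (0\<^sub>m n n)"
  let ?g = "\<lambda>k. (if k = i then 1 else 0) - (if k = j then 1 else (0::real))"
  have \<epsilon>0: "\<epsilon> \<ge> 0" unfolding \<epsilon>_def by (intro mult_nonneg_nonneg) (auto simp: sum_nonneg)
  have \<epsilon>2: "\<epsilon>\<^sup>2 = (\<Sum>i<n. (cmod (u i))\<^sup>2) * (\<Sum>i<m. (cmod (w i))\<^sup>2)"
    by (simp add: \<epsilon>_def power_mult_distrib sum_nonneg)
  have V: "?V = bordered m n (\<lambda>_. 0) (\<lambda>_. 0) w u"
    unfolding bordered_def using E by (intro cong_four_block_mat eq_matI) (auto simp: mat_diag_def)
  have Vc: "?V \<in> carrier_mat ?N ?N" unfolding V by (rule bordered_carrier)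
  have Vh: "hermitian_mat ?V"
    unfolding hermitian_mat_def using E(1)
    by (subst mat_adjoint_four_block[OF zero_carrier_mat mat_adjoint_carrier[OF E(1)] E(1) zero_carrier_mat])
      (intro cong_four_block_mat eq_matI; auto)
  have "linear_prod {..<?N} (\<lambda>k. \<epsilon> * ?g k) = linear_prod {..<m} (\<lambda>_. 0) * linear_prod {..<n} (\<lambda>_. 0)
    - weighted_poly {..<m} (\<lambda>_. 0) (\<lambda>i. (cmod (w i))\<^sup>2) * weighted_poly {..<n} (\<lambda>_. 0) (\<lambda>j. (cmod (u j))\<^sup>2)"
    (is "?l = ?r")
  proof -
    have "poly ?l x = poly ?r x" for x
    proof -
      have c: "card ({..<?N} - {i} - {j}) = (m - 1) + (n - 1)" using ij mn by (simp add: card_Diff_singleton)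
      have "poly ?l x = (x - \<epsilon> * ?g i) * ((x - \<epsilon> * ?g j) * (\<Prod>k\<in>{..<?N} - {i} - {j}. x - \<epsilon> * ?g k))"
        unfolding poly_linear_prod using ij
        by (subst prod.remove[of _ i], simp, simp, subst prod.remove[of _ j]) auto
      also have "(\<Prod>k\<in>{..<?N} - {i} - {j}. x - \<epsilon> * ?g k) = (\<Prod>k\<in>{..<?N} - {i} - {j}. x)"
        by (intro prod.cong) auto
      also have "\<dots> = x ^ (m - 1) * x ^ (n - 1)" by (simp add: c power_add)
      finally have l: "poly ?l x = (x * x - \<epsilon>\<^sup>2) * (x ^ (m - 1) * x ^ (n - 1))"
        using ij by (simp add: algebra_simps power2_eq_square)
      have "poly ?r x = x ^ m * x ^ n - (\<Sum>i<m. (cmod (w i))\<^sup>2 * x ^ (m - 1)) * (\<Sum>i<n. (cmod (u i))\<^sup>2 * x ^ (n - 1))"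
        by (simp add: poly_linear_prod poly_weighted_poly)
      also have "x ^ m * x ^ n = (x * x ^ (m - 1)) * (x * x ^ (n - 1))"
        using mn by (simp flip: power_Suc)
      finally have r: "poly ?r x = (x * x ^ (m - 1)) * (x * x ^ (n - 1))
        - (\<Sum>i<m. (cmod (w i))\<^sup>2 * x ^ (m - 1)) * (\<Sum>i<n. (cmod (u i))\<^sup>2 * x ^ (n - 1))" .
      show ?thesis unfolding l r \<epsilon>2 sum_distrib_right[symmetric] by (simp add: algebra_simps)
    qed
    then show ?thesis by (simp add: poly_eq_poly_eq_iff[symmetric] fun_eq_iff)
  qed
  then have "char_poly (real_diag ?N (\<lambda>k. \<epsilon> * ?g k)) = char_poly ?V"
    unfolding V char_poly_bordered char_poly_real_diag by simp
  then have "nrm (real_diag ?N (\<lambda>k. \<epsilon> * ?g k)) = nrm ?V"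
    by (rule unitarily_invariant_char_poly[OF nrm mat_diag_dim hermitian_real_diag Vc Vh])
  moreover have "real_diag ?N (\<lambda>k. \<epsilon> * ?g k) = of_real \<epsilon> \<cdot>\<^sub>m real_diag ?N ?g"
    by (intro eq_matI) (auto simp: mat_diag_def)
  moreover have "nrm (of_real \<epsilon> \<cdot>\<^sub>m real_diag ?N ?g) = \<epsilon> * nrm (real_diag ?N ?g)"
    using nrm \<epsilon>0 by (simp add: unitarily_invariant_norm_def matrix_norm_on_def)
  ultimately show ?thesis by simp
qed


theorem theorem4p1:
  fixes m n :: nat
    and H\<^sub>1 H\<^sub>2 E A A' V :: "complex mat"
    and \<epsilon>\<^sub>2 \<eta> :: real
    and nrm :: "complex mat \<Rightarrow> real"
  assumes "m \<ge> 1" and "n \<ge> 1"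
    and "H\<^sub>1 \<in> carrier_mat m m" and "hermitian_mat H\<^sub>1"
    and "H\<^sub>2 \<in> carrier_mat n n" and "hermitian_mat H\<^sub>2"
    and "E \<in> carrier_mat n m"
    and "A = four_block_mat H\<^sub>1 (mat_adjoint E) E H\<^sub>2"
    and "A' = four_block_mat H\<^sub>1 (0\<^sub>m m n) (0\<^sub>m n m) H\<^sub>2"
    and "V = A - A'"
    and "\<epsilon>\<^sub>2 = spectral_norm E"
    and "\<eta> = eig_gap H\<^sub>1 H\<^sub>2"
    and "vec_space.rank n E \<le> 1"
    and "unitarily_invariant_norm (m + n) nrm"
  shows "nrm (diag_vec (eigvals_decreasing A - eigvals_decreasing A')) \<le> phi \<eta> \<epsilon>\<^sub>2 * nrm V"
proof -
  let ?N = "m + n"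
  note E = \<open>E \<in> carrier_mat n m\<close>
  have nrm: "matrix_norm_on ?N nrm" using assms by (simp add: unitarily_invariant_norm_def)
  obtain U1 \<alpha> where U1: "unitary_mat m U1" "H\<^sub>1 = U1 * real_diag m \<alpha> * mat_adjoint U1"
    and c1: "char_poly H\<^sub>1 = (\<Prod>i<m. [:- complex_of_real (\<alpha> i), 1:])"
    using hermitian_real_spectral[OF assms(3,4)] .
  obtain U2 \<beta> where U2: "unitary_mat n U2" "H\<^sub>2 = U2 * real_diag n \<beta> * mat_adjoint U2"
    and c2: "char_poly H\<^sub>2 = (\<Prod>i<n. [:- complex_of_real (\<beta> i), 1:])"
    using hermitian_real_spectral[OF assms(5,6)] .
  define P Q where "P = linear_prod {..<m} \<alpha>" and "Q = linear_prod {..<n} \<beta>"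
  define \<gamma> where "\<gamma> k = (if k < m then \<alpha> k else \<beta> (k - m))" for k
  have PQ: "linear_prod {..<?N} \<gamma> = P * Q"
  proof -
    have "linear_prod {..<?N} \<gamma> = linear_prod {..<m} \<gamma> * linear_prod {m..<?N} \<gamma>"
      unfolding linear_prod_def by (subst prod.union_disjoint[symmetric]) (auto simp: ivl_disj_un)
    also have "linear_prod {m..<?N} \<gamma> = Q"
      unfolding linear_prod_def Q_def \<gamma>_def
      using prod.shift_bounds_nat_ivl[of "\<lambda>k. [:- (if k < m then \<alpha> k else \<beta> (k - m)), 1:]" 0 m n]
      by (simp add: lessThan_atLeast0 add.commute)
    finally show ?thesis by (simp add: P_def linear_prod_def \<gamma>_def)
  qed
  have V: "V = four_block_mat (0\<^sub>m m m) (mat_adjoint E) E (0\<^sub>m n n)"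
    unfolding assms by (rule perturbation_block_form[OF assms(7,3,5)])
  obtain u w where "\<forall>i<n. \<forall>j<m. E $$ (i, j) = u i * cnj (w j)"
    by (rule rank_le_one_factor[OF E assms(13)]) blast
  then have uw: "\<And>i j. i < n \<Longrightarrow> j < m \<Longrightarrow> E $$ (i, j) = u i * cnj (w j)" by blast
  let ?u = "\<Sum>i<n. (cmod (u i))\<^sup>2" and ?w = "\<Sum>i<m. (cmod (w i))\<^sup>2"
  show ?thesis
  proof (cases "?u = 0 \<or> ?w = 0")
    \<comment> \<open>Here \<open>E = 0\<close>, so \<open>A = A'\<close> and both sides are
      zero.\<close>
    case True
    then have "(\<forall>i<n. u i = 0) \<or> (\<forall>i<m. w i = 0)" by (auto simp: sum_nonneg_eq_0_iff)
    then have E0: "E = 0\<^sub>m n m" using E uw by (intro eq_matI) auto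
    have adj0: "mat_adjoint (0\<^sub>m n m) = (0\<^sub>m m n :: complex mat)" by (intro eq_matI) auto
    have "A = A'" unfolding assms E0 adj0 ..
    then have "diag_vec (eigvals_decreasing A - eigvals_decreasing A') = 0\<^sub>m ?N ?N"
      using carrier_vecD[OF eigvals_decreasing_carrier[of A' ?N]] assms(3,5,9)
      by (intro eq_matI) (auto simp: diag_vec_def mat_diag_def)
    moreover have "V = 0\<^sub>m ?N ?N" unfolding V E0 adj0 by simp
    moreover have "nrm (0\<^sub>m ?N ?N) = 0" using nrm by (simp add: matrix_norm_on_def)
    ultimately show ?thesis by simp
  next
    case False
    then have u: "?u > 0" and w: "?w > 0" by (simp_all add: sum_nonneg order.not_eq_order_implies_strict)
    define \<epsilon> where "\<epsilon> = sqrt ?u * sqrt ?w"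
    have \<epsilon>: "\<epsilon> > 0" "\<epsilon>\<^sup>2 = ?w * ?u" using u w by (simp_all add: \<epsilon>_def power_mult_distrib)
    have \<epsilon>\<^sub>2: "\<epsilon>\<^sub>2 = \<epsilon>" unfolding assms(11) \<epsilon>_def by (rule spectral_norm_rank_one[OF E uw w])
    obtain a b where a: "(\<Sum>i<m. (cmod (a i))\<^sup>2) = ?w" and b: "(\<Sum>j<n. (cmod (b j))\<^sup>2) = ?u"
      and cA: "char_poly A = map_poly of_real (P * Q
        - weighted_poly {..<m} \<alpha> (\<lambda>i. (cmod (a i))\<^sup>2) * weighted_poly {..<n} \<beta> (\<lambda>j. (cmod (b j))\<^sup>2))"
      unfolding assms(8) P_def Q_def by (rule char_poly_block_rank_one[OF U1 U2 E uw])
    \<comment> \<open>Normalising by the squared norms of \<open>w\<close> and \<open>u\<close>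
      gives probability weights and extracts their product
      \<open>\<epsilon>\<^sup>2\<close>.\<close>
    define p q where "p i = (cmod (a i))\<^sup>2 / ?w" and "q i = (cmod (b i))\<^sup>2 / ?u" for i
    have p: "\<forall>i<m. p i \<ge> 0" "sum p {..<m} = 1"
      using a w by (auto simp: p_def sum_divide_distrib[symmetric])
    have q: "\<forall>i<n. q i \<ge> 0" "sum q {..<n} = 1"
      using b u by (auto simp: q_def sum_divide_distrib[symmetric])
    have "weighted_poly {..<m} \<alpha> (\<lambda>i. (cmod (a i))\<^sup>2) = smult ?w (weighted_poly {..<m} \<alpha> p)"
      "weighted_poly {..<n} \<beta> (\<lambda>i. (cmod (b i))\<^sup>2) = smult ?u (weighted_poly {..<n} \<beta> q)"
      unfolding weighted_poly_smult[symmetric] p_def q_def using u w by simp_all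
    then have wp: "weighted_poly {..<m} \<alpha> (\<lambda>i. (cmod (a i))\<^sup>2) * weighted_poly {..<n} \<beta> (\<lambda>j. (cmod (b j))\<^sup>2)
      = smult (\<epsilon>\<^sup>2) (weighted_poly {..<m} \<alpha> p * weighted_poly {..<n} \<beta> q)"
      by (simp add: \<epsilon>(2) mult.commute)
    have eigH: "eig H\<^sub>1 = image_mset (\<lambda>k. complex_of_real (\<alpha> k)) (mset_set {..<m})"
      "eig H\<^sub>2 = image_mset (\<lambda>k. complex_of_real (\<beta> k)) (mset_set {..<n})"
      using c1 c2 by (intro eig_of_char_poly; simp add: linear_prod_def of_real_poly_hom.hom_prod)+
    note gap = eig_gap_bounds[OF eigH assms(1,2), folded assms(12)]
    obtain \<mu> where \<mu>: "linear_prod {..<?N} \<mu> = P * Q - smult (\<epsilon>\<^sup>2) (weighted_poly {..<m} \<alpha> p * weighted_poly {..<n} \<beta> q)"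
      "(\<Sum>k<?N. \<mu> k - \<gamma> k) = 0"
      "(\<Sum>k<?N. max 0 (\<mu> k - \<gamma> k))\<^sup>2 + \<eta> * (\<Sum>k<?N. max 0 (\<mu> k - \<gamma> k)) \<le> \<epsilon>\<^sup>2"
      using shift_bound_general[where \<alpha> = \<alpha> and \<beta> = \<beta>, OF assms(1,2) p q \<epsilon>(1) gap(2)]
      unfolding P_def Q_def \<gamma>_def by blast
    have eA: "eig A = image_mset (\<lambda>k. complex_of_real (\<mu> k)) (mset_set {..<?N})"
      by (rule eig_of_char_poly) (simp only: cA wp \<mu>(1))
    have eA': "eig A' = image_mset (\<lambda>k. complex_of_real (\<gamma> k)) (mset_set {..<?N})"
    proof (rule eig_of_char_poly)
      have adj0: "mat_adjoint (0\<^sub>m n m) = (0\<^sub>m m n :: complex mat)" by (intro eq_matI) auto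
      \<comment> \<open>\<open>A'\<close> is the coupled matrix with \<open>E = 0\<close>: the zero
        factors force \<open>a' = 0\<close>, and the coupling term drops out.\<close>
      obtain a' b' where a': "(\<Sum>i<m. (cmod (a' i))\<^sup>2) = (\<Sum>i<m. (cmod 0)\<^sup>2)"
        and cA': "char_poly (four_block_mat H\<^sub>1 (mat_adjoint (0\<^sub>m n m)) (0\<^sub>m n m) H\<^sub>2) = map_poly of_real (P * Q
        - weighted_poly {..<m} \<alpha> (\<lambda>i. (cmod (a' i))\<^sup>2) * weighted_poly {..<n} \<beta> (\<lambda>j. (cmod (b' j))\<^sup>2))"
        unfolding P_def Q_def
        by (rule char_poly_block_rank_one[OF U1 U2 zero_carrier_mat, of "\<lambda>_. 0" "\<lambda>_. 0"]) auto
      have "weighted_poly {..<m} \<alpha> (\<lambda>i. (cmod (a' i))\<^sup>2) = 0"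
        using a' by (simp add: weighted_poly_def sum_nonneg_eq_0_iff)
      then show "char_poly A' = map_poly of_real (linear_prod {..<?N} \<gamma>)"
        using cA' by (simp add: assms(9) adj0 PQ)
    qed
    define d where "d = eigvals_decreasing A - eigvals_decreasing A'"
    \<comment> \<open>Passing from the pairing of \<open>\<mu> k\<close> with
      \<open>\<gamma> k\<close> to the pairing by rank keeps the zero sum and does not enlarge the
      positive part.\<close>
    note d = eigvals_decreasing_diff[OF eA eA', folded d_def]
    let ?s = "\<Sum>k<?N. max 0 (d $ k)"
    have s: "?s \<le> phi \<eta> \<epsilon> * \<epsilon>"
      using d(3) le_phi_mult[OF \<mu>(3) gap(1) \<epsilon>(1)] by linarith
    \<comment> \<open>Each unit of transported eigenvalue mass costs
      \<open>nrm V / \<epsilon>\<close>.\<close>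
    have unit: "nrm (real_diag ?N (\<lambda>k. (if k = i then 1 else 0) - (if k = j then 1 else 0))) \<le> nrm V / \<epsilon>"
      if "i < ?N" "j < ?N" "i \<noteq> j" for i j
      using norm_unit_diag_difference[OF assms(14) assms(1,2) E uw that, folded \<epsilon>_def V] \<epsilon>(1)
      by (simp add: field_simps)
    have "nrm (diag_vec d) = nrm (real_diag ?N (\<lambda>k. d $ k))" by (simp add: diag_vec_def d(1))
    also have "\<dots> \<le> ?s * (nrm V / \<epsilon>)"
      by (rule norm_real_diag_le[OF nrm]) (use d(2) \<mu>(2) unit in auto)
    also have "\<dots> \<le> phi \<eta> \<epsilon> * \<epsilon> * (nrm V / \<epsilon>)"
    proof (rule mult_right_mono[OF s])
      have "V \<in> carrier_mat ?N ?N" unfolding V using E by simp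
      then show "0 \<le> nrm V / \<epsilon>" using nrm \<epsilon>(1) by (simp add: matrix_norm_on_def)
    qed
    also have "\<dots> = phi \<eta> \<epsilon>\<^sub>2 * nrm V" using \<epsilon>(1) by (simp add: \<epsilon>\<^sub>2)
    finally show ?thesis by (simp add: d_def)
  qed
qed

end
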